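(* Let $k$ be a finite field of odd characteristic. Let $\Pi$ be an irreducible generic cuspidal representation of $\mathrm{G}_2(k)$ and $\tau$ an irreducible generic representation of $\mathrm{GL}_2(k)$. Then there exists a number $\gamma(\Pi\times \tau,\psi)$ such that $$\Psi(W,M_{w_2}(f))=\gamma(\Pi\times \tau,\psi)\,\Psi(W,f)$$ for all $W\in \mathcal{W}(\Pi,\psi)$ and $f\in I(\mathcal{W}(\tau,\psi^{-1}))$.
   Context: All representations are complex and finite dimensional; $\psi$ is a fixed nontrivial additive character of $k$. $E_{ij}$ are the $7\times 7$ matrix units, $I=I_7$. For $r\in k$ put $\mathbf{x}_\alpha(r)=I-2rE_{24}-r^2E_{26}+rE_{46}-rE_{51}-rE_{73}$, $\mathbf{x}_{-\alpha}(r)=I-rE_{15}-rE_{37}-rE_{42}-r^2E_{62}+2rE_{64}$, $\mathbf{x}_\beta(r)=I+rE_{12}-rE_{67}$, $\mathbf{x}_{-\beta}(r)={}^t\mathbf{x}_\beta(r)$, $\mathbf{x}_{\alpha+\beta}(r)=I-2rE_{14}-r^2E_{17}+rE_{47}+rE_{52}+rE_{63}$, $\mathbf{x}_{2\alpha+\beta}(r)=I-rE_{16}+rE_{27}-rE_{43}+r^2E_{53}-2rE_{54}$, $\mathbf{x}_{3\alpha+\beta}(r)=I+rE_{23}+rE_{56}$, $\mathbf{x}_{3\alpha+2\beta}(r)=I+rE_{13}+rE_{57}$. $\mathrm{G}_2(k)\subset \mathrm{GL}_7(k)$ is the group generated by all $\mathbf{x}_{\pm\alpha}(r),\mathbf{x}_{\pm\beta}(r)$;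 it is the split group of type $\mathrm{G}_2$ with short simple root $\alpha$ and long simple root $\beta$, contained in $\mathrm{SO}_7(k)=\{g\in \mathrm{GL}_7(k): {}^tgQg=Q,\det g=1\}$, where $Q=E_{17}+E_{26}-E_{35}+2E_{44}-E_{53}+E_{62}+E_{71}$. Let $U_\gamma=\{\mathbf{x}_\gamma(r)\}$, $w_\gamma=\mathbf{x}_\gamma(1)\mathbf{x}_{-\gamma}(-1)\mathbf{x}_\gamma(1)$ for $\gamma\in\{\alpha,\beta\}$, $h(a,b)=\mathrm{diag}(a,b,(ab)^{-1},1,ab,b^{-1},a^{-1})$, $U$ the group generated by all $U_\gamma$, $\gamma>0$, and $U_H$ the group generated by $U_\beta,U_{2\alpha+\beta},U_{3\alpha+\beta},U_{3\alpha+2\beta}$. $\psi_U$ is the character of $U$ with $\psi_U(\mathbf{x}_\alpha(r))=\psi_U(\mathbf{x}_\beta(r))=\psi(r)$, trivial on the other positive root subgroups. An irreducible $\Pi$ is generic if $\mathrm{Hom}_U(\Pi,\psi_U)\ne0$ (then one-dimensional); for $0\ne l$ in it, $\mathcal{W}(\Pi,\psi)=\{g\mapsto l(\Pi(g)v):v\in\Pi\}$. Genericity for $\mathrm{GL}_2(k)$ is with respect to its upper triangular unipotent subgroup $N_{\mathrm{GL}_2}$. For $a\in\mathrm{GL}_2(k)$ put $a^*=\begin{pmatrix}0&1\\1&0\end{pmatrix}{}^ta^{-1}\begin{pmatrix}0&1\\1&0\end{pmatrix}$. $\widetilde P\subset\mathrm{SO}_7(k)$ is the parabolic subgroup of block upper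 triangular matrices with diagonal blocks of sizes $2,3,2$; its Levi consists of $\mathrm{diag}(a,b,a^* )$, $a\in\mathrm{GL}_2(k)$, $b\in\mathrm{SO}_3(k)$ (special orthogonal group of $\begin{pmatrix}&&-1\\&2&\\-1&&\end{pmatrix}$); $\widetilde U$ is its unipotent radical. With $V_\tau$ the space of $\tau$, $I(\tau)=\mathrm{Ind}_{\widetilde P}^{\mathrm{SO}_7(k)}(\tau\otimes1_{\mathrm{SO}_3})$ is the space of $\xi:\mathrm{SO}_7(k)\to V_\tau$ with $\xi(\mathrm{diag}(a,b,a^* )ug)=\tau(a)\xi(g)$ for $u\in\widetilde U$. Fix $0\ne\Lambda\in\mathrm{Hom}_{N_{\mathrm{GL}_2}}(\tau,\psi^{-1})$, where $\psi^{-1}\begin{pmatrix}1&x\\0&1\end{pmatrix}=\psi^{-1}(x)$. $I(\mathcal{W}(\tau,\psi^{-1}))$ is the space of functions $f_\xi(g,a)=\Lambda(\tau(a)\xi(g))$ on $\mathrm{SO}_7(k)\times\mathrm{GL}_2(k)$, $\xi\in I(\tau)$. Put $$\Psi(W,f)=\sum_{g\in U_H\backslash\mathrm{G}_2(k)}W(g)f(g,I_2),$$ where $I_2$ is the $2\times2$ identity matrix. Let $w_2=h(1,-1)w_\alpha w_\beta w_\alpha w_\beta^{-1}w_\alpha^{-1}$, $d_1=\mathrm{diag}(-1,1)$, and $M_{w_2}(f)(g,a)=\sum_{u\in\widetilde U}f(w_2ug,d_1a^* )$, a function on $\mathrm{SO}_7(k)\times\mathrm{GL}_2(k)$; $\Psi(W,M_{w_2}(f))=\sum_{g\in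 U_H\backslash\mathrm{G}_2(k)}W(g)M_{w_2}(f)(g,I_2)$. *)

theory Defs
  imports "HOL-Analysis.Analysis" "HOL-Algebra.Generated_Groups"
begin

section \<open>Matrix groups\<close>

definition GL :: "('k::field^'n^'n) monoid" where
  "GL = \<lparr>carrier = {A. invertible A}, mult = (**), one = mat 1\<rparr>"

definition SO :: "'k::field^'n^'n \<Rightarrow> ('k^'n^'n) set" where
  "SO S = {g. transpose g ** S ** g = S \<and> det g = 1}"

text \<open>\<open>mE i j c\<close> is \<open>c\<close> times the matrix unit \<open>E\<^sub>i\<^sub>j\<close>. The index type is the library's
  numeral type \<open>7\<close>, whose elements are \<open>1, \<dots>, 7\<close>. There \<open>7 = 0\<close>, so the order of that
  type is not the usual order of the indices and is never used below.\<close>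

definition mE :: "7 \<Rightarrow> 7 \<Rightarrow> 'k::field \<Rightarrow> 'k^7^7" where
  "mE i j c = (\<chi> a b. if a = i \<and> b = j then c else 0)"


section \<open>The group \<open>G\<^sub>2(k)\<close> and its subgroups\<close>

definition x_a :: "'k::field \<Rightarrow> 'k^7^7" where
  "x_a r = mat 1 - mE 2 4 (2*r) - mE 2 6 (r^2) + mE 4 6 r - mE 5 1 r - mE 7 3 r"

definition x_neg_a :: "'k::field \<Rightarrow> 'k^7^7" where
  "x_neg_a r = mat 1 - mE 1 5 r - mE 3 7 r - mE 4 2 r - mE 6 2 (r^2) + mE 6 4 (2*r)"

definition x_b :: "'k::field \<Rightarrow> 'k^7^7" where
  "x_b r = mat 1 + mE 1 2 r - mE 6 7 r"

definition x_neg_b :: "'k::field \<Rightarrow> 'k^7^7" where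
  "x_neg_b r = transpose (x_b r)"

definition x_ab :: "'k::field \<Rightarrow> 'k^7^7" where
  "x_ab r = mat 1 - mE 1 4 (2*r) - mE 1 7 (r^2) + mE 4 7 r + mE 5 2 r + mE 6 3 r"

definition x_2ab :: "'k::field \<Rightarrow> 'k^7^7" where
  "x_2ab r = mat 1 - mE 1 6 r + mE 2 7 r - mE 4 3 r + mE 5 3 (r^2) - mE 5 4 (2*r)"

definition x_3ab :: "'k::field \<Rightarrow> 'k^7^7" where
  "x_3ab r = mat 1 + mE 2 3 r + mE 5 6 r"

definition x_3a2b :: "'k::field \<Rightarrow> 'k^7^7" where
  "x_3a2b r = mat 1 + mE 1 3 r + mE 5 7 r"

definition G2 :: "('k::field^7^7) set" where
  "G2 = generate GL (range x_a \<union> range x_neg_a \<union> range x_b \<union> range x_neg_b)"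

definition w_a :: "'k::field^7^7" where
  "w_a = x_a 1 ** x_neg_a (-1) ** x_a 1"

definition w_b :: "'k::field^7^7" where
  "w_b = x_b 1 ** x_neg_b (-1) ** x_b 1"

definition h_diag :: "'k::field \<Rightarrow> 'k \<Rightarrow> 'k^7^7" where
  "h_diag a b = mE 1 1 a + mE 2 2 b + mE 3 3 (inverse (a*b)) + mE 4 4 1
         + mE 5 5 (a*b) + mE 6 6 (inverse b) + mE 7 7 (inverse a)"

definition U_max :: "('k::field^7^7) set" where
  "U_max = generate GL (range x_a \<union> range x_b \<union> range x_ab \<union> range x_2ab
                      \<union> range x_3ab \<union> range x_3a2b)"

definition U_H :: "('k::field^7^7) set" where
  "U_H = generate GL (range x_b \<union> range x_2ab \<union> range x_3ab \<union> range x_3a2b)"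

text \<open>The unipotent radicals of the two standard maximal parabolic subgroups: \<open>V_b\<close> belongs
  to the parabolic whose Levi subgroup contains the root subgroup of \<open>\<beta>\<close>, \<open>V_a\<close> to the one
  whose Levi subgroup contains that of \<open>\<alpha>\<close>.\<close>

definition V_b :: "('k::field^7^7) set" where
  "V_b = generate GL (range x_a \<union> range x_ab \<union> range x_2ab \<union> range x_3ab \<union> range x_3a2b)"

definition V_a :: "('k::field^7^7) set" where
  "V_a = generate GL (range x_b \<union> range x_ab \<union> range x_2ab \<union> range x_3ab \<union> range x_3a2b)"


section \<open>Representations\<close>

text \<open>The space of a representation is an arbitrary finite dimensional complex vector space,
  given by a type \<open>'v\<close> together with its scalar multiplication \<open>s\<close>. Only the values of
  \<open>\<rho>\<close> on \<open>G\<close> are meaningful.\<close>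

definition representation ::
  "(complex \<Rightarrow> 'v \<Rightarrow> 'v) \<Rightarrow> ('k::field^'n^'n) set \<Rightarrow> ('k^'n^'n \<Rightarrow> 'v \<Rightarrow> 'v::ab_group_add) \<Rightarrow> bool"
  where
  "representation s G \<rho> \<longleftrightarrow>
     (\<exists>B. finite_dimensional_vector_space s B) \<and>
     (\<forall>g\<in>G. Vector_Spaces.linear s s (\<rho> g)) \<and>
     \<rho> (mat 1) = id \<and>
     (\<forall>g\<in>G. \<forall>g'\<in>G. \<rho> (g ** g') = \<rho> g \<circ> \<rho> g')"

definition irreducible_representation ::
  "(complex \<Rightarrow> 'v \<Rightarrow> 'v) \<Rightarrow> ('k::field^'n^'n) set \<Rightarrow> ('k^'n^'n \<Rightarrow> 'v \<Rightarrow> 'v::ab_group_add) \<Rightarrow> bool"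
  where
  "irreducible_representation s G \<rho> \<longleftrightarrow>
     representation s G \<rho> \<and>
     (\<exists>v::'v. v \<noteq> 0) \<and>
     (\<forall>S. module.subspace s S \<and> (\<forall>g\<in>G. \<forall>v\<in>S. \<rho> g v \<in> S) \<longrightarrow> S = {0} \<or> S = UNIV)"

definition Hom_char ::
  "(complex \<Rightarrow> 'v \<Rightarrow> 'v) \<Rightarrow> ('k::field^'n^'n) set \<Rightarrow> ('k^'n^'n \<Rightarrow> 'v \<Rightarrow> 'v::ab_group_add)
     \<Rightarrow> ('k^'n^'n \<Rightarrow> complex) \<Rightarrow> ('v \<Rightarrow> complex) set"
  where
  "Hom_char s H \<rho> \<omega> =
     {l. Vector_Spaces.linear s (*) l \<and> (\<forall>u\<in>H. \<forall>v. l (\<rho> u v) = \<omega> u * l v)}"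

definition nontrivial_additive_character :: "('k::field \<Rightarrow> complex) \<Rightarrow> bool" where
  "nontrivial_additive_character \<psi> \<longleftrightarrow>
     \<psi> 0 = 1 \<and> (\<forall>x y. \<psi> (x + y) = \<psi> x * \<psi> y) \<and> (\<exists>x. \<psi> x \<noteq> 1)"

text \<open>Cuspidality: no nonzero vector is fixed by the unipotent radical of a proper parabolic
  subgroup. The proper parabolic subgroups are the conjugates of the Borel subgroup (unipotent
  radical \<open>U_max\<close>) and of the two standard maximal ones.\<close>

definition cuspidal_G2 :: "('k::field^7^7 \<Rightarrow> 'v \<Rightarrow> 'v::ab_group_add) \<Rightarrow> bool" where
  "cuspidal_G2 \<rho> \<longleftrightarrow>
     (\<forall>N\<in>{U_max, V_a, V_b}. \<forall>g\<in>G2. \<forall>v.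
        (\<forall>n\<in>N. \<rho> (g ** n ** matrix_inv g) v = v) \<longrightarrow> v = 0)"

text \<open>The conditions determine \<open>psi_U \<psi>\<close> on \<open>U_max\<close>, because the positive root subgroups
  generate \<open>U_max\<close>; its values off \<open>U_max\<close> are never used.\<close>

definition psi_U :: "('k::field \<Rightarrow> complex) \<Rightarrow> 'k^7^7 \<Rightarrow> complex" where
  "psi_U \<psi> = (SOME \<omega>.
     \<omega> (mat 1) = 1 \<and> (\<forall>u\<in>U_max. \<forall>u'\<in>U_max. \<omega> (u ** u') = \<omega> u * \<omega> u') \<and>
     (\<forall>r. \<omega> (x_a r) = \<psi> r \<and> \<omega> (x_b r) = \<psi> r \<and>
          \<omega> (x_ab r) = 1 \<and> \<omega> (x_2ab r) = 1 \<and> \<omega> (x_3ab r) = 1 \<and> \<omega> (x_3a2b r) = 1))"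

definition generic_G2 ::
  "(complex \<Rightarrow> 'v \<Rightarrow> 'v) \<Rightarrow> ('k::field \<Rightarrow> complex) \<Rightarrow> ('k^7^7 \<Rightarrow> 'v \<Rightarrow> 'v::ab_group_add) \<Rightarrow> bool"
  where
  "generic_G2 s \<psi> \<rho> \<longleftrightarrow> (\<exists>l\<in>Hom_char s U_max \<rho> (psi_U \<psi>). l \<noteq> (\<lambda>_. 0))"

text \<open>The Whittaker model attached to \<open>l\<close>; its elements are considered as functions on \<open>G2\<close>
  only.\<close>

definition Whittaker ::
  "('k::field^7^7 \<Rightarrow> 'v \<Rightarrow> 'v) \<Rightarrow> ('v \<Rightarrow> complex) \<Rightarrow> ('k^7^7 \<Rightarrow> complex) set" where
  "Whittaker \<rho> l = {(\<lambda>g. l (\<rho> g v)) | v. True}"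

definition N_GL2 :: "('k::field^2^2) set" where
  "N_GL2 = range (\<lambda>x. vector [vector [1, x], vector [0, 1]])"

text \<open>Genericity for \<open>GL\<^sub>2\<close> does not depend on a choice of nontrivial character of \<open>N_GL2\<close>:
  the diagonal torus permutes these characters transitively.\<close>

definition generic_GL2 ::
  "(complex \<Rightarrow> 'v \<Rightarrow> 'v) \<Rightarrow> ('k::field^2^2 \<Rightarrow> 'v \<Rightarrow> 'v::ab_group_add) \<Rightarrow> bool" where
  "generic_GL2 s \<tau> \<longleftrightarrow>
     (\<exists>\<psi>. nontrivial_additive_character \<psi> \<and>
          (\<exists>l\<in>Hom_char s N_GL2 \<tau> (\<lambda>n. \<psi> (n $ 1 $ 2)). l \<noteq> (\<lambda>_. 0)))"


section \<open>Induction from the parabolic subgroup of \<open>SO\<^sub>7(k)\<close>\<close>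

definition Q7 :: "'k::field^7^7" where
  "Q7 = mE 1 7 1 + mE 2 6 1 - mE 3 5 1 + mE 4 4 2 - mE 5 3 1 + mE 6 2 1 + mE 7 1 1"

definition Q3 :: "'k::field^3^3" where
  "Q3 = vector [vector [0, 0, -1], vector [0, 2, 0], vector [-1, 0, 0]]"

definition star :: "'k::field^2^2 \<Rightarrow> 'k^2^2" where
  "star a = (let J = vector [vector [0, 1], vector [1, 0]]
             in J ** transpose (matrix_inv a) ** J)"

definition levi :: "'k::field^2^2 \<Rightarrow> 'k^3^3 \<Rightarrow> 'k^7^7" where
  "levi a b = (let c = star a in vector
    [vector [a$1$1, a$1$2, 0, 0, 0, 0, 0],
     vector [a$2$1, a$2$2, 0, 0, 0, 0, 0],
     vector [0, 0, b$1$1, b$1$2, b$1$3, 0, 0],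
     vector [0, 0, b$2$1, b$2$2, b$2$3, 0, 0],
     vector [0, 0, b$3$1, b$3$2, b$3$3, 0, 0],
     vector [0, 0, 0, 0, 0, c$1$1, c$1$2],
     vector [0, 0, 0, 0, 0, c$2$1, c$2$2]])"

definition block :: "7 \<Rightarrow> nat" where
  "block i = (if i \<in> {1, 2} then 1 else if i \<in> {3, 4, 5} then 2 else 3)"

text \<open>The unipotent radical of the block upper triangular parabolic subgroup with diagonal
  blocks of sizes \<open>2, 3, 2\<close>.\<close>

definition U_tilde :: "('k::field^7^7) set" where
  "U_tilde = {u \<in> SO Q7. \<forall>i j.
     (block j < block i \<longrightarrow> u $ i $ j = 0) \<and>
     (block i = block j \<longrightarrow> u $ i $ j = (if i = j then 1 else 0))}"

text \<open>Functions on \<open>SO Q7\<close> and on \<open>SO Q7 \<times> GL\<^sub>2\<close> are total functions whose values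
  elsewhere are unconstrained and never used.\<close>

definition Ind :: "('k::field^2^2 \<Rightarrow> 'v \<Rightarrow> 'v) \<Rightarrow> ('k^7^7 \<Rightarrow> 'v) set" where
  "Ind \<tau> = {\<xi>. \<forall>a\<in>carrier GL. \<forall>b\<in>SO Q3. \<forall>u\<in>U_tilde. \<forall>g\<in>SO Q7.
     \<xi> (levi a b ** u ** g) = \<tau> a (\<xi> g)}"

definition Ind_Whittaker ::
  "('k::field^2^2 \<Rightarrow> 'v \<Rightarrow> 'v) \<Rightarrow> ('v \<Rightarrow> complex) \<Rightarrow> ('k^7^7 \<Rightarrow> 'k^2^2 \<Rightarrow> complex) set" where
  "Ind_Whittaker \<tau> \<Lambda> = {(\<lambda>g a. \<Lambda> (\<tau> a (\<xi> g))) | \<xi>. \<xi> \<in> Ind \<tau>}"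


section \<open>The zeta sums and the intertwining operator\<close>

text \<open>The sum over \<open>H\<bsol>G\<close> of a function on \<open>G\<close> that is invariant under left translation by
  \<open>H\<close>; it is evaluated on representatives of the right cosets \<open>Hg\<close>.\<close>

definition coset_sum ::
  "('k::field^'n^'n) set \<Rightarrow> ('k^'n^'n) set \<Rightarrow> ('k^'n^'n \<Rightarrow> complex) \<Rightarrow> complex" where
  "coset_sum H G F = (\<Sum>C\<in>rcosets\<^bsub>GL\<lparr>carrier := G\<rparr>\<^esub> H. F (SOME g. g \<in> C))"

definition Psi ::
  "('k::field^7^7 \<Rightarrow> complex) \<Rightarrow> ('k^7^7 \<Rightarrow> 'k^2^2 \<Rightarrow> complex) \<Rightarrow> complex" where
  "Psi W f = coset_sum U_H G2 (\<lambda>g. W g * f g (mat 1))"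

definition w2 :: "'k::field^7^7" where
  "w2 = h_diag 1 (-1) ** w_a ** w_b ** w_a ** matrix_inv w_b ** matrix_inv w_a"

definition d1 :: "'k::field^2^2" where
  "d1 = vector [vector [-1, 0], vector [0, 1]]"

definition M_w2 ::
  "('k::field^7^7 \<Rightarrow> 'k^2^2 \<Rightarrow> complex) \<Rightarrow> 'k^7^7 \<Rightarrow> 'k^2^2 \<Rightarrow> complex" where
  "M_w2 f = (\<lambda>g a. \<Sum>u\<in>U_tilde. f (w2 ** u ** g) (d1 ** star a))"

end

theory Submission
  imports Defs "HOL-Computational_Algebra.Fundamental_Theorem_Algebra"
begin

text \<open>Both sides of the identity are \<open>G2\<close>-invariant bilinear forms on \<open>\<rho> \<times> Ind \<tau>\<close>, so
  it suffices that such forms are multiples of \<open>\<Psi>\<close>. By Mackey theory they are governed by the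
  \<open>G2\<close>-orbits on isotropic planes. On planes where the octonion product vanishes the stabiliser
  is a parabolic subgroup of \<open>G2\<close> whose unipotent radical acts trivially on \<open>\<tau>\<close>, and
  cuspidality gives zero. The other planes form one orbit, and Fourier expansion along
  \<open>V_b\<close> and then along \<open>x_b\<close>, where cuspidality removes the degenerate characters, turns a
  form on that orbit into a sum over \<open>GL\<^sub>2\<close> of a product of Whittaker functionals.
  These are unique up to scalars by the Gelfand--Graev argument, which for \<open>G2\<close> rests on the Bruhat
  decomposition and the anti-involution \<open>theta\<close>.\<close>

section \<open>Matrices acting on vectors\<close>

text \<open>The Mackey step cuts a function on the orthogonal group into its restrictions to single
  cosets of the parabolic subgroup. The form \<open>B\<close> is therefore allowed to take arbitrary
  functions, of which only the values on \<open>SO Q7\<close> count; the intertwining sum makes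
  sense for all of them, and its \<open>G2\<close>-invariance is reindexing by a right translation.
  Coset representatives are avoided: sums run over whole finite groups, and the surplus is a
  cardinality, cancelled at the end. The basis vectors are weight vectors. In the order 5, 1, 2, 4,
  6, 7, 3 their weights are 2\<alpha>+\<beta>, \<alpha>+\<beta>, \<alpha>, 0, -\<alpha>,
  -\<alpha>-\<beta>, -2\<alpha>-\<beta>. The flag respected by \<open>U_max\<close>, the
  representatives of the orbits and the two entries (1,2) and (5,1) that carry the generic character
  are all read off this order. Odd characteristic enters through the quadratic form: its
  coefficients 2 must be invertible for isotropy to clear coordinates and for the middle block
  \<open>Q3\<close> to be nondegenerate.\<close>

lemma exhaust_7:
  fixes x :: 7
  shows "x = 1 \<or> x = 2 \<or> x = 3 \<or> x = 4 \<or> x = 5 \<or> x = 6 \<or> x = 7"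
proof (induct x)
  case (of_int z)
  then have "0 \<le> z" and "z < 7" by simp_all
  then have "z = 0 \<or> z = 1 \<or> z = 2 \<or> z = 3 \<or> z = 4 \<or> z = 5 \<or> z = 6" by arith
  then show ?case by auto
qed

lemma forall_7: "(\<forall>i::7. P i) \<longleftrightarrow> P 1 \<and> P 2 \<and> P 3 \<and> P 4 \<and> P 5 \<and> P 6 \<and> P 7"
  by (metis exhaust_7)

lemma UNIV_7: "(UNIV :: 7 set) = {1, 2, 3, 4, 5, 6, 7}"
  using exhaust_7 by auto

lemma sum_7: "sum f (UNIV::7 set) = f 1 + f 2 + f 3 + f 4 + f 5 + f 6 + f 7"
  unfolding UNIV_7 by (simp add: ac_simps)

definition vec7 :: "'a \<Rightarrow> 'a \<Rightarrow> 'a \<Rightarrow> 'a \<Rightarrow> 'a \<Rightarrow> 'a \<Rightarrow> 'a \<Rightarrow> 'a^7" where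
  "vec7 a1 a2 a3 a4 a5 a6 a7 = (\<chi> i. if i = 1 then a1 else if i = 2 then a2 else if i = 3 then a3
     else if i = 4 then a4 else if i = 5 then a5 else if i = 6 then a6 else a7)"

lemma vec7_nth [simp]:
  "vec7 a1 a2 a3 a4 a5 a6 a7 $ 1 = a1" "vec7 a1 a2 a3 a4 a5 a6 a7 $ 2 = a2"
  "vec7 a1 a2 a3 a4 a5 a6 a7 $ 3 = a3" "vec7 a1 a2 a3 a4 a5 a6 a7 $ 4 = a4"
  "vec7 a1 a2 a3 a4 a5 a6 a7 $ 5 = a5" "vec7 a1 a2 a3 a4 a5 a6 a7 $ 6 = a6"
  "vec7 a1 a2 a3 a4 a5 a6 a7 $ 7 = a7"
  by (simp_all add: vec7_def)

lemma vec7_eta: "vec7 (v$1) (v$2) (v$3) (v$4) (v$5) (v$6) (v$7) = v"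
  by (simp add: vec_eq_iff forall_7)

lemma vec7_eq_iff [simp]:
  "vec7 a1 a2 a3 a4 a5 a6 a7 = vec7 b1 b2 b3 b4 b5 b6 b7 \<longleftrightarrow>
     a1 = b1 \<and> a2 = b2 \<and> a3 = b3 \<and> a4 = b4 \<and> a5 = b5 \<and> a6 = b6 \<and> a7 = b7"
  by (simp add: vec_eq_iff forall_7)

text \<open>Identities between products of group elements are proved by letting both sides act on a
  generic vector: a root element changes only a few coordinates, and what remains is a ring identity
  in each of them.\<close>

lemma matrix_eq_vec7I:
  fixes A B :: "'k::field^7^7"
  assumes "\<And>v1 v2 v3 v4 v5 v6 v7. A *v vec7 v1 v2 v3 v4 v5 v6 v7 = B *v vec7 v1 v2 v3 v4 v5 v6 v7"
  shows "A = B"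
  unfolding matrix_eq by (metis assms vec7_eta)

lemma mE_mult_vec [simp]:
  "(mE i j c :: 'k::field^7^7) *v x = axis i (c * x $ j)"
  by (simp add: mE_def matrix_vector_mult_def vec_eq_iff axis_def if_distrib if_distribR
      sum.delta cong: if_cong)

lemma transpose_mE [simp]: "transpose (mE i j c) = mE j i c"
  by (auto simp: mE_def transpose_def vec_eq_iff)

lemma transpose_add [simp]: "transpose (A + B :: 'k::field^'n^'m) = transpose A + transpose B"
  and transpose_diff [simp]: "transpose (A - B :: 'k::field^'n^'m) = transpose A - transpose B"
  by (simp_all add: transpose_def vec_eq_iff)

lemmas mv_simps = matrix_vector_mult_add_rdistrib matrix_vector_mult_diff_rdistrib
  matrix_vector_mul_lid mE_mult_vec

lemma x_a_vec7 [simp]: "x_a r *v vec7 v1 v2 v3 v4 v5 v6 v7 =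
    vec7 v1 (v2 - 2*r * v4 - r^2 * v6) v3 (v4 + r * v6) (v5 - r * v1) v6 (v7 - r * v3)"
  unfolding x_a_def by (simp add: mv_simps vec_eq_iff forall_7 axis_def)

lemma x_neg_a_vec7 [simp]: "x_neg_a r *v vec7 v1 v2 v3 v4 v5 v6 v7 =
    vec7 (v1 - r * v5) v2 (v3 - r * v7) (v4 - r * v2) v5 (v6 - r^2 * v2 + 2*r * v4) v7"
  unfolding x_neg_a_def by (simp add: mv_simps vec_eq_iff forall_7 axis_def)

lemma x_b_vec7 [simp]: "x_b r *v vec7 v1 v2 v3 v4 v5 v6 v7 =
    vec7 (v1 + r * v2) v2 v3 v4 v5 (v6 - r * v7) v7"
  unfolding x_b_def by (simp add: mv_simps vec_eq_iff forall_7 axis_def)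

lemma x_neg_b_vec7 [simp]: "x_neg_b r *v vec7 v1 v2 v3 v4 v5 v6 v7 =
    vec7 v1 (v2 + r * v1) v3 v4 v5 v6 (v7 - r * v6)"
  unfolding x_neg_b_def x_b_def
  by (simp add: mv_simps vec_eq_iff forall_7 axis_def)

lemma x_ab_vec7 [simp]: "x_ab r *v vec7 v1 v2 v3 v4 v5 v6 v7 =
    vec7 (v1 - 2*r * v4 - r^2 * v7) v2 v3 (v4 + r * v7) (v5 + r * v2) (v6 + r * v3) v7"
  unfolding x_ab_def by (simp add: mv_simps vec_eq_iff forall_7 axis_def)

lemma x_2ab_vec7 [simp]: "x_2ab r *v vec7 v1 v2 v3 v4 v5 v6 v7 =
    vec7 (v1 - r * v6) (v2 + r * v7) v3 (v4 - r * v3) (v5 + r^2 * v3 - 2*r * v4) v6 v7"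
  unfolding x_2ab_def by (simp add: mv_simps vec_eq_iff forall_7 axis_def)

lemma x_3ab_vec7 [simp]: "x_3ab r *v vec7 v1 v2 v3 v4 v5 v6 v7 =
    vec7 v1 (v2 + r * v3) v3 v4 (v5 + r * v6) v6 v7"
  unfolding x_3ab_def by (simp add: mv_simps vec_eq_iff forall_7 axis_def)

lemma x_3a2b_vec7 [simp]: "x_3a2b r *v vec7 v1 v2 v3 v4 v5 v6 v7 =
    vec7 (v1 + r * v3) v2 v3 v4 (v5 + r * v7) v6 v7"
  unfolding x_3a2b_def by (simp add: mv_simps vec_eq_iff forall_7 axis_def)

lemma h_diag_vec7 [simp]: "h_diag a b *v vec7 v1 v2 v3 v4 v5 v6 v7 =
    vec7 (a * v1) (b * v2) (inverse (a*b) * v3) v4 (a*b * v5) (inverse b * v6) (inverse a * v7)"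
  unfolding h_diag_def by (simp add: mv_simps vec_eq_iff forall_7 axis_def)

lemma Q7_vec7 [simp]: "Q7 *v vec7 v1 v2 v3 v4 v5 v6 v7 =
    vec7 v7 v6 (- v5) (2 * v4) (- v3) v2 v1"
  unfolding Q7_def by (simp add: mv_simps vec_eq_iff forall_7 axis_def)

lemma mv_assoc [simp]: "(A ** B) *v (x::'k::field^7) = A *v (B *v x)"
  by (simp add: matrix_vector_mul_assoc)

lemma w_a_vec7 [simp]: "w_a *v vec7 v1 v2 v3 v4 v5 v6 v7 =
    vec7 v5 (- v6) v7 (- v4) (- v1) (- v2) (- v3)"
  unfolding w_a_def by (simp add: algebra_simps power2_eq_square)

lemma w_b_vec7 [simp]: "w_b *v vec7 v1 v2 v3 v4 v5 v6 v7 =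
    vec7 v2 (- v1) v3 v4 v5 (- v7) v6"
  unfolding w_b_def by (simp add: algebra_simps power2_eq_square)

lemma x_add:
  "x_a r ** x_a s = x_a (r + s)" "x_neg_a r ** x_neg_a s = x_neg_a (r + s)"
  "x_b r ** x_b s = x_b (r + s)" "x_neg_b r ** x_neg_b s = x_neg_b (r + s)"
  "x_ab r ** x_ab s = x_ab (r + s)" "x_2ab r ** x_2ab s = x_2ab (r + s)"
  "x_3ab r ** x_3ab s = x_3ab (r + s)" "x_3a2b r ** x_3a2b s = x_3a2b (r + s)"
  by (rule matrix_eq_vec7I; simp add: algebra_simps power2_eq_square)+

lemma x_zero:
  "x_a 0 = mat 1" "x_neg_a 0 = mat 1" "x_b 0 = mat 1" "x_neg_b 0 = mat 1"
  "x_ab 0 = mat 1" "x_2ab 0 = mat 1" "x_3ab 0 = mat 1" "x_3a2b 0 = mat 1"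
  by (rule matrix_eq_vec7I; simp)+

section \<open>Matrix groups\<close>

lemma matrix_inv_left: "invertible A \<Longrightarrow> matrix_inv A ** A = mat 1"
  and matrix_inv_right: "invertible A \<Longrightarrow> A ** matrix_inv A = mat 1"
  for A :: "'k::field^'n^'n"
  unfolding invertible_def matrix_inv_def by (metis (mono_tags, lifting) someI_ex)+

lemma matrix_inv_eqI:
  fixes A B :: "'k::field^'n^'n"
  assumes "A ** B = mat 1"
  shows "matrix_inv A = B"
proof -
  have "B ** A = mat 1" using assms by (simp add: matrix_left_right_inverse)
  then have "invertible A" using assms by (auto simp: invertible_def)
  then have "matrix_inv A ** A = mat 1" by (rule matrix_inv_left)
  then have "matrix_inv A ** A ** B = B" by simp
  then show ?thesis using assms by (metis matrix_mul_assoc matrix_mul_rid)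
qed

lemma invertibleI:
  fixes A B :: "'k::field^'n^'n"
  shows "A ** B = mat 1 \<Longrightarrow> invertible A"
  by (metis invertible_def matrix_left_right_inverse)

lemma matrix_inv_mult:
  fixes A B :: "'k::field^'n^'n"
  assumes "invertible A" "invertible B"
  shows "matrix_inv (A ** B) = matrix_inv B ** matrix_inv A"
  using assms by (intro matrix_inv_eqI)
    (metis matrix_inv_right matrix_mul_assoc matrix_mul_rid)

lemma invertible_matrix_inv:
  fixes A :: "'k::field^'n^'n"
  shows "invertible A \<Longrightarrow> invertible (matrix_inv A)"
  by (rule invertibleI, rule matrix_inv_left)

lemma matrix_inv_matrix_inv:
  fixes A :: "'k::field^'n^'n"
  shows "invertible A \<Longrightarrow> matrix_inv (matrix_inv A) = A"
  by (rule matrix_inv_eqI, rule matrix_inv_left)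

lemma matrix_inv_cancel:
  fixes A B :: "'k::field^'n^'n"
  assumes "invertible A"
  shows "matrix_inv A ** (A ** B) = B" "A ** (matrix_inv A ** B) = B"
    "B ** A ** matrix_inv A = B" "B ** matrix_inv A ** A = B"
  using assms by (simp_all add: matrix_mul_assoc matrix_inv_left matrix_inv_right)
    (simp_all add: matrix_mul_assoc [symmetric] matrix_inv_left matrix_inv_right)

lemma matrix_inv_cancel_vec:
  fixes A :: "'k::field^'n^'n"
  assumes "invertible A"
  shows "matrix_inv A *v (A *v x) = x" "A *v (matrix_inv A *v x) = x"
  using assms by (simp_all add: matrix_vector_mul_assoc matrix_inv_left matrix_inv_right)

lemma invertible_mat_1 [simp]: "invertible (mat 1 :: 'k::field^'n^'n)"
  by (rule invertibleI[of _ "mat 1"]) simp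

lemma carrier_GL: "carrier GL = {A. invertible A}"
  and mult_GL [simp]: "mult GL = (**)"
  and one_GL [simp]: "one GL = mat 1"
  by (simp_all add: GL_def)

lemma group_GL: "group (GL :: ('k::field^'n^'n) monoid)"
proof (rule groupI)
  fix A :: "'k^'n^'n" assume "A \<in> carrier GL"
  then show "\<exists>B\<in>carrier GL. B \<otimes>\<^bsub>GL\<^esub> A = \<one>\<^bsub>GL\<^esub>"
    by (auto simp: carrier_GL intro!: bexI[of _ "matrix_inv A"] matrix_inv_left invertible_matrix_inv)
qed (auto simp: carrier_GL matrix_mul_assoc invertible_mult)

lemma inv_GL:
  fixes A :: "'k::field^'n^'n"
  assumes "invertible A"
  shows "inv\<^bsub>GL\<^esub> A = matrix_inv A"
  using assms by (intro group.inv_equality[OF group_GL])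
    (auto simp: carrier_GL matrix_inv_left invertible_matrix_inv)

definition matrix_group :: "('k::field^'n^'n) set \<Rightarrow> bool" where
  "matrix_group G \<longleftrightarrow> mat 1 \<in> G \<and> (\<forall>g\<in>G. \<forall>g'\<in>G. g ** g' \<in> G) \<and>
     (\<forall>g\<in>G. invertible g \<and> matrix_inv g \<in> G)"

lemma matrix_groupD:
  assumes "matrix_group G"
  shows "mat 1 \<in> G" "g \<in> G \<Longrightarrow> g' \<in> G \<Longrightarrow> g ** g' \<in> G" "g \<in> G \<Longrightarrow> invertible g"
    "g \<in> G \<Longrightarrow> matrix_inv g \<in> G"
  using assms by (auto simp: matrix_group_def)

lemma generate_GL_matrix_group:
  assumes "\<And>s. s \<in> S \<Longrightarrow> invertible s"
  shows "matrix_group (generate GL S)"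
proof -
  have S: "S \<subseteq> carrier GL" using assms by (auto simp: carrier_GL)
  have *: "generate GL S \<subseteq> carrier GL" by (rule group.generate_incl[OF group_GL S])
  show ?thesis unfolding matrix_group_def
  proof (intro conjI ballI)
    show "mat 1 \<in> generate GL S" using generate.one[of GL] by simp
    fix g assume g: "g \<in> generate GL S"
    then show i: "invertible g" using * by (auto simp: carrier_GL)
    show "matrix_inv g \<in> generate GL S"
      using group.generate_m_inv_closed[OF group_GL S g] i by (simp add: inv_GL)
    fix g' assume g': "g' \<in> generate GL S"
    show "g ** g' \<in> generate GL S" using generate.eng[OF g g'] by simp
  qed
qed

lemma generate_GL_subset:
  assumes "matrix_group K" "S \<subseteq> K"
  shows "generate GL S \<subseteq> K"
proof
  fix x assume "x \<in> generate GL S"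
  then show "x \<in> K"
  proof induct
    case (inv h)
    then show ?case using assms by (metis inv_GL matrix_groupD(3,4) subsetD)
  qed (use assms in \<open>auto simp: matrix_group_def\<close>)
qed

lemma matrix_group_conj_preimage:
  fixes m :: "'k::field^'n^'n"
  assumes "matrix_group K" and m: "invertible m"
  shows "matrix_group {u. invertible u \<and> m ** u ** matrix_inv m \<in> K}"
  unfolding matrix_group_def
proof (safe intro!: invertible_mult invertible_matrix_inv)
  show "invertible (mat 1 :: 'k^'n^'n)" by simp
  show "m ** mat 1 ** matrix_inv m \<in> K" using assms by (simp add: matrix_inv_right matrix_groupD)
next
  fix u u' assume *: "m ** u ** matrix_inv m \<in> K" "m ** u' ** matrix_inv m \<in> K"
  have "m ** (u ** u') ** matrix_inv m = (m ** u ** matrix_inv m) ** (m ** u' ** matrix_inv m)"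
    by (simp add: matrix_mul_assoc matrix_inv_cancel[OF m])
  then show "m ** (u ** u') ** matrix_inv m \<in> K" using * assms by (simp add: matrix_groupD)
next
  fix u assume *: "m ** u ** matrix_inv m \<in> K" and u: "invertible u"
  have "m ** matrix_inv u ** matrix_inv m = matrix_inv (m ** u ** matrix_inv m)"
    using m u by (simp add: matrix_inv_mult invertible_mult invertible_matrix_inv
        matrix_inv_matrix_inv matrix_mul_assoc)
  then show "m ** matrix_inv u ** matrix_inv m \<in> K" using * assms by (simp add: matrix_groupD)
qed

text \<open>It is enough to push \<open>m\<close> past each generator. The condition
  \<open>m ** s = k ** m\<close> contains no inverse, which is the shape in which the commutation
  relations are stated.\<close>

lemma generate_GL_conj:
  fixes m :: "'k::field^'n^'n"
  assumes K: "matrix_group K" and m: "invertible m"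
    and S: "\<And>s. s \<in> S \<Longrightarrow> invertible s \<and> (\<exists>k\<in>K. m ** s = k ** m)"
    and u: "u \<in> generate GL S"
  shows "m ** u ** matrix_inv m \<in> K"
proof -
  have "S \<subseteq> {u. invertible u \<and> m ** u ** matrix_inv m \<in> K}"
    using S by (force simp: matrix_inv_cancel[OF m])
  from generate_GL_subset[OF matrix_group_conj_preimage[OF K m] this] u show ?thesis by auto
qed

lemma conj_bij_betw:
  fixes m :: "'k::field^'n^'n"
  assumes "finite K" and m: "invertible m" and "\<And>u. u \<in> K \<Longrightarrow> m ** u ** matrix_inv m \<in> K"
  shows "bij_betw (\<lambda>u. m ** u ** matrix_inv m) K K"
proof -
  have "inj_on (\<lambda>u. m ** u ** matrix_inv m) K"
    by (rule inj_onI) (metis matrix_inv_cancel(1,4)[OF m])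
  then show ?thesis using assms by (simp add: bij_betw_def endo_inj_surj image_subset_iff)
qed

lemma matrix_group_mult_bij:
  assumes "matrix_group G" "h \<in> G"
  shows "bij_betw (\<lambda>g. h ** g) G G" "bij_betw (\<lambda>g. g ** h) G G" "bij_betw matrix_inv G G"
proof -
  have h: "invertible h" "matrix_inv h \<in> G" using assms by (auto simp: matrix_groupD)
  note c = matrix_inv_cancel[OF h(1)]
  show "bij_betw (\<lambda>g. h ** g) G G"
    by (rule bij_betw_byWitness[of _ "\<lambda>g. matrix_inv h ** g"])
      (use assms h c in \<open>auto simp: matrix_groupD\<close>)
  show "bij_betw (\<lambda>g. g ** h) G G"
    by (rule bij_betw_byWitness[of _ "\<lambda>g. g ** matrix_inv h"])
      (use assms h c in \<open>auto simp: matrix_groupD\<close>)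
  show "bij_betw matrix_inv G G"
    by (rule bij_betw_byWitness[of _ matrix_inv])
      (use assms in \<open>auto simp: matrix_groupD matrix_inv_matrix_inv\<close>)
qed

section \<open>Root subgroups of \<open>G2\<close>\<close>

lemma matrix_inv_x [simp]:
  "matrix_inv (x_a r) = x_a (- r)" "matrix_inv (x_neg_a r) = x_neg_a (- r)"
  "matrix_inv (x_b r) = x_b (- r)" "matrix_inv (x_neg_b r) = x_neg_b (- r)"
  "matrix_inv (x_ab r) = x_ab (- r)" "matrix_inv (x_2ab r) = x_2ab (- r)"
  "matrix_inv (x_3ab r) = x_3ab (- r)" "matrix_inv (x_3a2b r) = x_3a2b (- r)"
  by (rule matrix_inv_eqI; simp add: x_add x_zero)+

lemma invertible_x [simp]:
  "invertible (x_a r)" "invertible (x_neg_a r)" "invertible (x_b r)" "invertible (x_neg_b r)"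
  "invertible (x_ab r)" "invertible (x_2ab r)" "invertible (x_3ab r)" "invertible (x_3a2b r)"
  using x_add[of r "- r"] by (auto simp: x_zero intro: invertibleI)

lemma invertible_w [simp]: "invertible w_a" "invertible w_b"
  by (simp_all add: w_a_def w_b_def invertible_mult)

lemma h_diag_mult: "h_diag a b ** h_diag c d = h_diag (a * c) (b * d)"
  by (rule matrix_eq_vec7I) (simp add: algebra_simps)

lemma h_diag_1: "h_diag 1 1 = mat 1"
  by (rule matrix_eq_vec7I) simp

lemma invertible_h_diag [simp]: "a \<noteq> 0 \<Longrightarrow> b \<noteq> 0 \<Longrightarrow> invertible (h_diag a b)"
  and matrix_inv_h_diag [simp]: "a \<noteq> 0 \<Longrightarrow> b \<noteq> 0 \<Longrightarrow> matrix_inv (h_diag a b) = h_diag (inverse a) (inverse b)"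
  using h_diag_mult[of a b "inverse a" "inverse b"]
  by (auto simp: h_diag_1 intro: invertibleI matrix_inv_eqI)

lemma matrix_group_G2: "matrix_group G2"
  and matrix_group_U_max: "matrix_group U_max"
  and matrix_group_U_H: "matrix_group U_H"
  and matrix_group_V_a: "matrix_group V_a"
  and matrix_group_V_b: "matrix_group V_b"
  unfolding G2_def U_max_def U_H_def V_a_def V_b_def
  by (rule generate_GL_matrix_group; auto)+

lemma x_in_G2 [simp]: "x_a r \<in> G2" "x_neg_a r \<in> G2" "x_b r \<in> G2" "x_neg_b r \<in> G2"
  by (auto simp: G2_def intro!: generate.incl)

lemma mult_G2 [simp]: "g \<in> G2 \<Longrightarrow> g' \<in> G2 \<Longrightarrow> g ** g' \<in> G2"
  and inv_G2 [simp]: "g \<in> G2 \<Longrightarrow> matrix_inv g \<in> G2"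
  and one_G2 [simp]: "mat 1 \<in> G2"
  and invertible_G2: "g \<in> G2 \<Longrightarrow> invertible g"
  using matrix_groupD[OF matrix_group_G2] by blast+

lemma w_in_G2 [simp]: "w_a \<in> G2" "w_b \<in> G2"
  by (simp_all add: w_a_def w_b_def)

text \<open>Rank one identities give the values of the simple coroots:
  \<open>h_diag y (inverse y)\<close> for \<beta> and \<open>h_diag (inverse y) (y^2)\<close> for
  \<alpha>. These coroots span the cocharacter lattice; the parameters \<open>a*(a*b)\<close> and
  \<open>a*b\<close> solve for an arbitrary torus element.\<close>

lemma h_diag_in_G2:
  fixes a b :: "'k::field"
  assumes "a \<noteq> 0" "b \<noteq> 0"
  shows "h_diag a b \<in> G2"
proof -
  have B: "h_diag y (inverse y) = x_b y ** x_neg_b (- inverse y) ** x_b y ** matrix_inv w_b"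
    if "y \<noteq> 0" for y :: 'k
  proof -
    have "h_diag y (inverse y) ** w_b = x_b y ** x_neg_b (- inverse y) ** x_b y"
      by (rule matrix_eq_vec7I) (use that in \<open>simp add: field_simps\<close>)
    then show ?thesis by (metis matrix_inv_cancel(3) invertible_w(2))
  qed
  have A: "h_diag (inverse y) (y^2) = x_a y ** x_neg_a (- inverse y) ** x_a y ** matrix_inv w_a"
    if "y \<noteq> 0" for y :: 'k
  proof -
    have "h_diag (inverse y) (y^2) ** w_a = x_a y ** x_neg_a (- inverse y) ** x_a y"
      by (rule matrix_eq_vec7I) (use that in \<open>simp add: field_simps power2_eq_square\<close>)
    then show ?thesis by (metis matrix_inv_cancel(3) invertible_w(1))
  qed
  have "h_diag a b = h_diag (a*(a*b)) (inverse (a*(a*b))) ** h_diag (inverse (a*b)) ((a*b)^2)"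
    unfolding h_diag_mult using assms by (simp add: field_simps power2_eq_square)
  also have "\<dots> \<in> G2"
    using A[of "a*b"] B[of "a*(a*b)"] assms by (auto simp del: inverse_mult_distrib)
  finally show ?thesis .
qed

lemma w_a_conj: "w_a ** x_b r = x_3ab r ** w_a" "w_a ** x_ab r = x_2ab r ** w_a"
  and w_b_conj: "w_b ** x_a r = x_ab r ** w_b" "w_b ** x_3ab r = x_3a2b r ** w_b"
  by (rule matrix_eq_vec7I; simp add: algebra_simps)+

lemma conj_in_G2: "m ** x = y ** m \<Longrightarrow> m \<in> G2 \<Longrightarrow> x \<in> G2 \<Longrightarrow> y \<in> G2"
  by (metis inv_G2 invertible_G2 matrix_inv_cancel(3) mult_G2)

lemma x_in_G2' [simp]: "x_ab r \<in> G2" "x_2ab r \<in> G2" "x_3ab r \<in> G2" "x_3a2b r \<in> G2"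
proof -
  show 1: "x_ab r \<in> G2" for r by (rule conj_in_G2[OF w_b_conj(1)]) auto
  show 2: "x_3ab r \<in> G2" for r by (rule conj_in_G2[OF w_a_conj(1)]) auto
  show "x_2ab r \<in> G2" by (rule conj_in_G2[OF w_a_conj(2)]) (auto simp: 1)
  show "x_3a2b r \<in> G2" by (rule conj_in_G2[OF w_b_conj(2)]) (auto simp: 2)
qed

lemma subgroups_subset_G2: "U_max \<subseteq> G2" "U_H \<subseteq> G2" "V_a \<subseteq> G2" "V_b \<subseteq> G2"
  unfolding U_max_def U_H_def V_a_def V_b_def
  by (rule generate_GL_subset[OF matrix_group_G2]; auto)+

lemma x_in_U_max [simp]: "x_a r \<in> U_max" "x_b r \<in> U_max" "x_ab r \<in> U_max" "x_2ab r \<in> U_max"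
  "x_3ab r \<in> U_max" "x_3a2b r \<in> U_max"
  by (auto simp: U_max_def intro!: generate.incl)

lemma x_in_V_a [simp]: "x_b r \<in> V_a" "x_ab r \<in> V_a" "x_2ab r \<in> V_a" "x_3ab r \<in> V_a" "x_3a2b r \<in> V_a"
  by (auto simp: V_a_def intro!: generate.incl)

lemma x_in_V_b [simp]: "x_a r \<in> V_b" "x_ab r \<in> V_b" "x_2ab r \<in> V_b" "x_3ab r \<in> V_b" "x_3a2b r \<in> V_b"
  by (auto simp: V_b_def intro!: generate.incl)

lemma radicals_subset_U_max: "V_a \<subseteq> U_max" "V_b \<subseteq> U_max" "U_H \<subseteq> U_max"
  unfolding U_H_def V_a_def V_b_def
  by (rule generate_GL_subset[OF matrix_group_U_max]; auto)+

text \<open>Here and in the next three lemmas: Chevalley's commutator relations for the simple roots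
  and their negatives. Apart from the conjugating element every factor lies in \<open>V_a\<close>,
  respectively \<open>V_b\<close>, so the Levi factors normalise these radicals.\<close>

lemma x_a_conj:
  "x_a s ** x_b r = x_b r ** x_ab (- (s*r)) ** x_2ab (s^2*r) ** x_3ab (s^3*r) ** x_3a2b (s^3*r^2) ** x_a s"
  "x_a s ** x_ab r = x_ab r ** x_2ab (- (2 * s*r)) ** x_3ab (- (3 * s^2*r)) ** x_3a2b (3 * s*r^2) ** x_a s"
  "x_a s ** x_2ab r = x_2ab r ** x_3ab (3 * s*r) ** x_a s"
  "x_a s ** x_3ab r = x_3ab r ** x_a s"
  "x_a s ** x_3a2b r = x_3a2b r ** x_a s"
  by (rule matrix_eq_vec7I; simp add: algebra_simps power2_eq_square power3_eq_cube)+

lemma x_neg_a_conj: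
  "x_neg_a s ** x_b r = x_b r ** x_neg_a s"
  "x_neg_a s ** x_ab r = x_ab r ** x_b (- (3 * s*r)) ** x_neg_a s"
  "x_neg_a s ** x_2ab r = x_2ab r ** x_b (3 * s^2*r) ** x_ab (- (2 * s*r)) ** x_3a2b (- (3 * s*r^2)) ** x_neg_a s"
  "x_neg_a s ** x_3ab r = x_3ab r ** x_b (s^3*r) ** x_ab (- (s^2*r)) ** x_2ab (s*r) ** x_3a2b (2 * s^3*r^2) ** x_neg_a s"
  "x_neg_a s ** x_3a2b r = x_3a2b r ** x_neg_a s"
  by (rule matrix_eq_vec7I; simp add: algebra_simps power2_eq_square power3_eq_cube)+

lemma x_b_conj:
  "x_b s ** x_a r = x_a r ** x_ab (s*r) ** x_2ab (s*r^2) ** x_3ab (- (s*r^3)) ** x_3a2b (- (2 * s^2*r^3)) ** x_b s"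
  "x_b s ** x_ab r = x_ab r ** x_b s"
  "x_b s ** x_2ab r = x_2ab r ** x_b s"
  "x_b s ** x_3ab r = x_3ab r ** x_3a2b (s*r) ** x_b s"
  "x_b s ** x_3a2b r = x_3a2b r ** x_b s"
  by (rule matrix_eq_vec7I; simp add: algebra_simps power2_eq_square power3_eq_cube)+

lemma x_neg_b_conj:
  "x_neg_b s ** x_a r = x_a r ** x_neg_b s"
  "x_neg_b s ** x_ab r = x_ab r ** x_a (s*r) ** x_2ab (- (s*r^2)) ** x_3ab (2 * s^2*r^3) ** x_3a2b (s*r^3) ** x_neg_b s"
  "x_neg_b s ** x_2ab r = x_2ab r ** x_neg_b s"
  "x_neg_b s ** x_3ab r = x_3ab r ** x_neg_b s"
  "x_neg_b s ** x_3a2b r = x_3a2b r ** x_3ab (s*r) ** x_neg_b s"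
  by (rule matrix_eq_vec7I; simp add: algebra_simps power2_eq_square power3_eq_cube)+

lemma h_diag_conj:
  assumes "a \<noteq> 0" "b \<noteq> 0"
  shows "h_diag a b ** x_a r = x_a (b*r) ** h_diag a b"
    "h_diag a b ** x_b r = x_b (a*inverse b*r) ** h_diag a b"
    "h_diag a b ** x_ab r = x_ab (a*r) ** h_diag a b"
    "h_diag a b ** x_2ab r = x_2ab (a*b*r) ** h_diag a b"
    "h_diag a b ** x_3ab r = x_3ab (a*b^2*r) ** h_diag a b"
    "h_diag a b ** x_3a2b r = x_3a2b (a^2*b*r) ** h_diag a b"
  by (rule matrix_eq_vec7I; use assms in \<open>simp add: field_simps power2_eq_square power3_eq_cube\<close>)+

section \<open>Normalisers of the unipotent radicals\<close>

definition normalizes :: "'k::field^'n^'n \<Rightarrow> ('k^'n^'n) set \<Rightarrow> bool" where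
  "normalizes m K \<longleftrightarrow> invertible m \<and> (\<forall>u\<in>K. m ** u ** matrix_inv m \<in> K)"

lemma normalizes_mult: "normalizes m K \<Longrightarrow> normalizes m' K \<Longrightarrow> normalizes (m ** m') K"
  unfolding normalizes_def
  by (auto simp: invertible_mult matrix_inv_mult) (metis matrix_mul_assoc)

lemma normalizes_x_a:
  fixes r :: "'k::field"
  shows "normalizes (x_a r) V_a" "normalizes (x_neg_a r) V_a"
proof -
  note m = matrix_groupD[OF matrix_group_V_a]
  have "x_a r ** u ** matrix_inv (x_a r) \<in> V_a" if u: "u \<in> V_a" for u :: "'k^7^7"
    by (rule generate_GL_conj[OF matrix_group_V_a _ _ u[unfolded V_a_def]])
      (auto, (rule bexI, rule x_a_conj, auto intro!: m(2))+)
  then show "normalizes (x_a r) V_a" by (simp add: normalizes_def)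
  have "x_neg_a r ** u ** matrix_inv (x_neg_a r) \<in> V_a" if u: "u \<in> V_a" for u :: "'k^7^7"
    by (rule generate_GL_conj[OF matrix_group_V_a _ _ u[unfolded V_a_def]])
      (auto, (rule bexI, rule x_neg_a_conj, auto intro!: m(2))+)
  then show "normalizes (x_neg_a r) V_a" by (simp add: normalizes_def)
qed

lemma normalizes_x_b:
  fixes r :: "'k::field"
  shows "normalizes (x_b r) V_b" "normalizes (x_neg_b r) V_b"
proof -
  note m = matrix_groupD[OF matrix_group_V_b]
  have "x_b r ** u ** matrix_inv (x_b r) \<in> V_b" if u: "u \<in> V_b" for u :: "'k^7^7"
    by (rule generate_GL_conj[OF matrix_group_V_b _ _ u[unfolded V_b_def]])
      (auto, (rule bexI, rule x_b_conj, auto intro!: m(2))+)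
  then show "normalizes (x_b r) V_b" by (simp add: normalizes_def)
  have "x_neg_b r ** u ** matrix_inv (x_neg_b r) \<in> V_b" if u: "u \<in> V_b" for u :: "'k^7^7"
    by (rule generate_GL_conj[OF matrix_group_V_b _ _ u[unfolded V_b_def]])
      (auto, (rule bexI, rule x_neg_b_conj, auto intro!: m(2))+)
  then show "normalizes (x_neg_b r) V_b" by (simp add: normalizes_def)
qed

lemma normalizes_w: "normalizes w_a V_a" "normalizes w_b V_b"
  unfolding w_a_def w_b_def
  by (intro normalizes_mult normalizes_x_a normalizes_x_b)+

lemma normalizes_h_diag:
  fixes a b :: "'k::field"
  assumes "a \<noteq> 0" "b \<noteq> 0"
  shows "normalizes (h_diag a b) U_max" "normalizes (h_diag a b) V_b"
  unfolding normalizes_def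
proof (safe)
  fix u :: "'k^7^7"
  show "h_diag a b ** u ** matrix_inv (h_diag a b) \<in> U_max" if u: "u \<in> U_max"
    by (rule generate_GL_conj[OF matrix_group_U_max _ _ u[unfolded U_max_def]])
      (use assms in auto, (rule bexI, rule h_diag_conj, auto)+)
  show "h_diag a b ** u ** matrix_inv (h_diag a b) \<in> V_b" if u: "u \<in> V_b"
    by (rule generate_GL_conj[OF matrix_group_V_b _ _ u[unfolded V_b_def]])
      (use assms in auto, (rule bexI, rule h_diag_conj, auto)+)
qed (use assms in auto)

lemma generate_GL_induct_left [consumes 2, case_names one step]:
  assumes inv: "\<And>s. s \<in> S \<Longrightarrow> invertible s \<and> matrix_inv s \<in> S"
    and x: "x \<in> generate GL S"
    and one: "P (mat 1)"
    and step: "\<And>s u. s \<in> S \<Longrightarrow> u \<in> generate GL S \<Longrightarrow> P u \<Longrightarrow> P (s ** u)"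
  shows "P x"
proof -
  have G: "matrix_group (generate GL S)" using inv by (intro generate_GL_matrix_group) auto
  \<comment> \<open>Generation splits an element into two arbitrary factors; carrying a free right
    factor \<open>u\<close> turns this into steps by one generator at a time.\<close>
  have "\<forall>u\<in>generate GL S. P u \<longrightarrow> P (x ** u)" using x
  proof induct
    case (inv h)
    then show ?case using assms(1) step by (simp add: inv_GL)
  next
    case (eng h1 h2)
    then show ?case by (auto simp: matrix_mul_assoc [symmetric] matrix_groupD[OF G])
  qed (use step in auto)
  then show ?thesis using one matrix_groupD(1)[OF G] by force
qed

lemma generate_GL_induct_right [consumes 2, case_names one step]:
  assumes inv: "\<And>s. s \<in> S \<Longrightarrow> invertible s \<and> matrix_inv s \<in> S"
    and x: "x \<in> generate GL S"
    and one: "P (mat 1)"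
    and step: "\<And>s u. s \<in> S \<Longrightarrow> P u \<Longrightarrow> P (u ** s)"
  shows "P x"
proof -
  have "\<forall>u. P u \<longrightarrow> P (u ** x)" using x
  proof induct
    case (inv h)
    then show ?case using assms(1) step by (simp add: inv_GL)
  next
    case (eng h1 h2)
    then show ?case by (auto simp: matrix_mul_assoc)
  qed (use step in auto)
  then show ?thesis using one by force
qed

lemma U_max_induct [consumes 1, case_names one x_a x_b x_ab x_2ab x_3ab x_3a2b]:
  assumes "u \<in> U_max" "P (mat 1)"
    "\<And>r u. u \<in> U_max \<Longrightarrow> P u \<Longrightarrow> P (x_a r ** u)" "\<And>r u. u \<in> U_max \<Longrightarrow> P u \<Longrightarrow> P (x_b r ** u)"
    "\<And>r u. u \<in> U_max \<Longrightarrow> P u \<Longrightarrow> P (x_ab r ** u)" "\<And>r u. u \<in> U_max \<Longrightarrow> P u \<Longrightarrow> P (x_2ab r ** u)"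
    "\<And>r u. u \<in> U_max \<Longrightarrow> P u \<Longrightarrow> P (x_3ab r ** u)" "\<And>r u. u \<in> U_max \<Longrightarrow> P u \<Longrightarrow> P (x_3a2b r ** u)"
  shows "P u"
  by (rule generate_GL_induct_left[OF _ assms(1)[unfolded U_max_def]])
    (use assms in \<open>auto simp: U_max_def\<close>)

section \<open>Coordinates on \<open>U_max\<close> and the generic character\<close>

abbreviation "e1 \<equiv> vec7 1 0 0 0 0 0 (0::'k::field)"
abbreviation "e2 \<equiv> vec7 0 1 0 0 0 0 (0::'k::field)"
abbreviation "e5 \<equiv> vec7 0 0 0 0 1 0 (0::'k::field)"

lemma mult_vec7_basis [simp]:
  fixes A :: "'k::field^7^7"
  shows "(A *v e1) $ i = A $ i $ 1" "(A *v e2) $ i = A $ i $ 2" "(A *v e5) $ i = A $ i $ 5"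
  by (simp_all add: matrix_vector_mult_def sum_7)

text \<open>The vectors \<open>e5\<close>, \<open>e1\<close>, \<open>e2\<close> have the three
  highest weights 2\<alpha>+\<beta>, \<alpha>+\<beta>, \<alpha>, so \<open>U_max\<close> acts
  unitriangularly on the flag they span. Hence the entries (1,2) and (5,1) are additive; they are
  the coordinates of \<beta> and, up to sign, of \<alpha>, and stand in for a normal form of
  unipotent elements.\<close>

lemma U_max_columns:
  assumes "u \<in> U_max"
  shows "u *v e1 = vec7 1 0 0 0 (u$5$1) 0 0" "u *v e2 = vec7 (u$1$2) 1 0 0 (u$5$2) 0 0"
    "u *v e5 = e5"
proof -
  have "(\<exists>x. u *v e1 = vec7 1 0 0 0 x 0 0) \<and> (\<exists>y z. u *v e2 = vec7 y 1 0 0 z 0 0) \<and> u *v e5 = e5"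
    using assms by (induct rule: U_max_induct) auto
  then obtain x y z where *: "u *v e1 = vec7 1 0 0 0 x 0 0" "u *v e2 = vec7 y 1 0 0 z 0 0"
    and e5: "u *v e5 = e5" by blast
  from *(1) have "x = u$5$1" by (metis mult_vec7_basis(1) vec7_nth(5))
  with *(1) show "u *v e1 = vec7 1 0 0 0 (u$5$1) 0 0" by simp
  from *(2) have "y = u$1$2" "z = u$5$2" by (metis mult_vec7_basis(2) vec7_nth(1,5))+
  with *(2) show "u *v e2 = vec7 (u$1$2) 1 0 0 (u$5$2) 0 0" by simp
  show "u *v e5 = e5" by (rule e5)
qed

lemma U_max_entries:
  assumes "u \<in> U_max"
  shows "u$1$1 = 1" "u$2$1 = 0" "u$3$1 = 0" "u$4$1 = 0" "u$6$1 = 0" "u$7$1 = 0"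
    "u$2$2 = 1" "u$3$2 = 0" "u$4$2 = 0" "u$6$2 = 0" "u$7$2 = 0"
    "u$1$5 = 0" "u$2$5 = 0" "u$3$5 = 0" "u$4$5 = 0" "u$5$5 = 1" "u$6$5 = 0" "u$7$5 = 0"
  using U_max_columns[OF assms]
  by (metis mult_vec7_basis(1) vec7_nth, metis mult_vec7_basis(1) vec7_nth,
      metis mult_vec7_basis(1) vec7_nth, metis mult_vec7_basis(1) vec7_nth,
      metis mult_vec7_basis(1) vec7_nth, metis mult_vec7_basis(1) vec7_nth,
      metis mult_vec7_basis(2) vec7_nth, metis mult_vec7_basis(2) vec7_nth,
      metis mult_vec7_basis(2) vec7_nth, metis mult_vec7_basis(2) vec7_nth,
      metis mult_vec7_basis(2) vec7_nth, (metis mult_vec7_basis(3) vec7_nth)+)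

lemma x_entries [simp]:
  "x_a r $ 5 $ 1 = - r" "x_b r $ 5 $ 1 = 0" "x_ab r $ 5 $ 1 = 0" "x_2ab r $ 5 $ 1 = 0"
  "x_3ab r $ 5 $ 1 = 0" "x_3a2b r $ 5 $ 1 = 0"
  "x_a r $ 1 $ 2 = 0" "x_b r $ 1 $ 2 = r" "x_ab r $ 1 $ 2 = 0" "x_2ab r $ 1 $ 2 = 0"
  "x_3ab r $ 1 $ 2 = 0" "x_3a2b r $ 1 $ 2 = 0"
  by (simp_all flip: mult_vec7_basis)

lemma mat_1_entries [simp]: "(mat 1 :: 'k::field^7^7) $ 5 $ 1 = 0" "(mat 1 :: 'k::field^7^7) $ 1 $ 2 = 0"
  by (simp_all add: mat_def)

lemma U_max_mult_entries:
  assumes "u \<in> U_max" "u' \<in> U_max"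
  shows "(u ** u') $ 5 $ 1 = u $ 5 $ 1 + u' $ 5 $ 1" "(u ** u') $ 1 $ 2 = u $ 1 $ 2 + u' $ 1 $ 2"
    "(u ** u') $ 5 $ 2 = u $ 5 $ 2 + u $ 5 $ 1 * u' $ 1 $ 2 + u' $ 5 $ 2"
  by (simp_all add: matrix_matrix_mult_def sum_7 U_max_entries[OF assms(1)] U_max_entries[OF assms(2)])

text \<open>\<open>psi_U\<close> is given by a choice. The explicit character shows that there is
  something to choose, and induction over generators shows that all choices agree on
  \<open>U_max\<close>. The minus sign reflects the entry \<open>- r\<close> of
  \<open>x_a r\<close>.\<close>

lemma psi_U_eq:
  assumes \<psi>: "nontrivial_additive_character \<psi>" and u: "u \<in> U_max"
  shows "psi_U \<psi> u = \<psi> (u $ 1 $ 2 - u $ 5 $ 1)"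
proof -
  let ?P = "\<lambda>\<omega>. \<omega> (mat 1) = 1 \<and> (\<forall>u\<in>U_max. \<forall>u'\<in>U_max. \<omega> (u ** u') = \<omega> u * \<omega> u') \<and>
     (\<forall>r. \<omega> (x_a r) = \<psi> r \<and> \<omega> (x_b r) = \<psi> r \<and>
          \<omega> (x_ab r) = 1 \<and> \<omega> (x_2ab r) = 1 \<and> \<omega> (x_3ab r) = 1 \<and> \<omega> (x_3a2b r) = 1)"
  have \<psi>_add: "\<psi> (x + y) = \<psi> x * \<psi> y" "\<psi> 0 = 1" for x y
    using \<psi> by (auto simp: nontrivial_additive_character_def)
  have *: "?P (\<lambda>u. \<psi> (u $ 1 $ 2 - u $ 5 $ 1))"
    by (auto simp: U_max_mult_entries \<psi>_add(2) add_diff_add simp flip: \<psi>_add(1))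
  have P: "?P (psi_U \<psi>)" unfolding psi_U_def by (rule someI[of ?P, OF *])
  show ?thesis using u
  proof (induct rule: U_max_induct)
  qed (use P * in auto)
qed

lemma psi_U_mult:
  assumes \<psi>: "nontrivial_additive_character \<psi>" and u: "u \<in> U_max" "u' \<in> U_max"
  shows "psi_U \<psi> (u ** u') = psi_U \<psi> u * psi_U \<psi> u'"
proof -
  have "\<psi> (x + y) = \<psi> x * \<psi> y" for x y
    using \<psi> by (auto simp: nontrivial_additive_character_def)
  then show ?thesis using u
    by (simp add: psi_U_eq[OF \<psi>] U_max_mult_entries add_diff_add matrix_groupD(2)[OF matrix_group_U_max])
qed

lemma psi_U_x:
  assumes \<psi>: "nontrivial_additive_character \<psi>"
  shows "psi_U \<psi> (x_a r) = \<psi> r" "psi_U \<psi> (x_b r) = \<psi> r" "psi_U \<psi> (x_ab r) = 1"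
    "psi_U \<psi> (x_2ab r) = 1" "psi_U \<psi> (x_3ab r) = 1" "psi_U \<psi> (x_3a2b r) = 1" "psi_U \<psi> (mat 1) = 1"
  using \<psi>
  by (simp_all add: psi_U_eq[OF \<psi>] matrix_groupD(1)[OF matrix_group_U_max]) (simp_all add: nontrivial_additive_character_def)

lemma V_a_entry:
  assumes "u \<in> V_a"
  shows "u $ 5 $ 1 = 0"
proof -
  have "u \<in> U_max \<and> u $ 5 $ 1 = 0"
    by (rule generate_GL_induct_left[OF _ assms[unfolded V_a_def]])
      (auto simp: matrix_groupD[OF matrix_group_U_max] U_max_mult_entries)
  then show ?thesis by simp
qed

lemma V_b_entry:
  assumes "u \<in> V_b"
  shows "u $ 1 $ 2 = 0"
proof -
  have "u \<in> U_max \<and> u $ 1 $ 2 = 0"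
    by (rule generate_GL_induct_left[OF _ assms[unfolded V_b_def]])
      (auto simp: matrix_groupD[OF matrix_group_U_max] U_max_mult_entries)
  then show ?thesis by simp
qed

text \<open>Since \<open>x_a\<close> normalises \<open>V_a\<close>, all \<alpha>-factors can be
  collected on the left.\<close>

lemma U_max_factor_x_a:
  fixes u :: "'k::field^7^7"
  assumes "u \<in> U_max"
  shows "\<exists>r. \<exists>v\<in>V_a. u = x_a r ** v"
proof -
  note V = matrix_groupD[OF matrix_group_V_a]
  have step: "\<exists>r'. \<exists>v'\<in>V_a. y ** (x_a r ** v) = x_a r' ** v'" if "y \<in> V_a" "v \<in> V_a" for y v :: "'k^7^7" and r
  proof (intro exI bexI)
    show "y ** (x_a r ** v) = x_a r ** (x_a (- r) ** y ** matrix_inv (x_a (- r)) ** v)"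
      using matrix_inv_cancel(2)[of "x_a r"] by (simp add: matrix_mul_assoc [symmetric])
    show "x_a (- r) ** y ** matrix_inv (x_a (- r)) ** v \<in> V_a"
      using normalizes_x_a(1)[of "- r"] that by (simp only: V normalizes_def)
  qed
  from assms show ?thesis
  proof (induct rule: U_max_induct)
    case one
    then show ?case using V(1) by (intro exI[of _ 0] bexI[of _ "mat 1"]) (auto simp: x_zero)
  next
    case (x_a r u)
    then show ?case by (metis matrix_mul_assoc x_add(1))
  qed (use step x_in_V_a in blast)+
qed

lemma U_max_factor_x_b:
  fixes u :: "'k::field^7^7"
  assumes "u \<in> U_max"
  shows "\<exists>v\<in>V_b. u = x_b (u $ 1 $ 2) ** v"
proof -
  note V = matrix_groupD[OF matrix_group_V_b]
  have step: "\<exists>r'. \<exists>v'\<in>V_b. y ** (x_b r ** v) = x_b r' ** v'" if "y \<in> V_b" "v \<in> V_b" for y v :: "'k^7^7" and r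
  proof (intro exI bexI)
    show "y ** (x_b r ** v) = x_b r ** (x_b (- r) ** y ** matrix_inv (x_b (- r)) ** v)"
      using matrix_inv_cancel(2)[of "x_b r"] by (simp add: matrix_mul_assoc [symmetric])
    show "x_b (- r) ** y ** matrix_inv (x_b (- r)) ** v \<in> V_b"
      using normalizes_x_b(1)[of "- r"] that by (simp only: V normalizes_def)
  qed
  from assms have "\<exists>r. \<exists>v\<in>V_b. u = x_b r ** v"
  proof (induct rule: U_max_induct)
    case one
    then show ?case using V(1) by (intro exI[of _ 0] bexI[of _ "mat 1"]) (auto simp: x_zero)
  next
    case (x_b r u)
    then show ?case by (metis matrix_mul_assoc x_add(3))
  qed (use step x_in_V_b in blast)+
  then obtain r v where rv: "v \<in> V_b" "u = x_b r ** v" by blast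
  then have "u $ 1 $ 2 = r" using V_b_entry[OF rv(1)] radicals_subset_U_max(2) by (auto simp: U_max_mult_entries)
  with rv show ?thesis by metis
qed

text \<open>\<open>V_b\<close> is the kernel of the \<beta>-coordinate. In the Fourier expansion
  along \<open>x_b\<close>, orthogonality of characters leaves exactly the elements with this entry
  zero, and the sum over \<open>U_max\<close> becomes one over \<open>V_b\<close>.\<close>

lemma V_b_iff: "u \<in> V_b \<longleftrightarrow> u \<in> U_max \<and> u $ 1 $ 2 = 0"
  using U_max_factor_x_b[of u] V_b_entry[of u] radicals_subset_U_max(2) by (auto simp: x_zero)

section \<open>The Bruhat decomposition\<close>

text \<open>Reduced words for the dihedral Weyl group of order 12. The longest element has two
  reduced words, of which only one is listed; the braid relation in \<open>weyl_mult_w_a\<close>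
  accounts for the other.\<close>

definition weyl_words :: "('k::field^7^7) set" where
  "weyl_words = {mat 1,
     w_a,
     w_b,
     w_a ** w_b,
     w_b ** w_a,
     w_a ** w_b ** w_a,
     w_b ** w_a ** w_b,
     w_a ** w_b ** w_a ** w_b,
     w_b ** w_a ** w_b ** w_a,
     w_a ** w_b ** w_a ** w_b ** w_a,
     w_b ** w_a ** w_b ** w_a ** w_b,
     w_a ** w_b ** w_a ** w_b ** w_a ** w_b}"

text \<open>Exactly one of w(\<alpha>) and -w(\<alpha>) is positive; each row records that one
  together with its structure constant. The rows also show whether the image is simple, which later
  decides how a word is treated in the multiplicity argument.\<close>

lemma weyl_x_a:
  "mat 1 ** x_a r = x_a r ** (mat 1)"
  "w_a ** x_neg_a r = x_a (- r) ** (w_a)"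
  "w_b ** x_a r = x_ab r ** (w_b)"
  "w_a ** w_b ** x_a r = x_2ab r ** (w_a ** w_b)"
  "w_b ** w_a ** x_neg_a r = x_ab (- r) ** (w_b ** w_a)"
  "w_a ** w_b ** w_a ** x_neg_a r = x_2ab (- r) ** (w_a ** w_b ** w_a)"
  "w_b ** w_a ** w_b ** x_a r = x_2ab r ** (w_b ** w_a ** w_b)"
  "w_a ** w_b ** w_a ** w_b ** x_a r = x_ab (- r) ** (w_a ** w_b ** w_a ** w_b)"
  "w_b ** w_a ** w_b ** w_a ** x_neg_a r = x_2ab (- r) ** (w_b ** w_a ** w_b ** w_a)"
  "w_a ** w_b ** w_a ** w_b ** w_a ** x_neg_a r = x_ab r ** (w_a ** w_b ** w_a ** w_b ** w_a)"
  "w_b ** w_a ** w_b ** w_a ** w_b ** x_a r = x_a r ** (w_b ** w_a ** w_b ** w_a ** w_b)"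
  "w_a ** w_b ** w_a ** w_b ** w_a ** w_b ** x_neg_a r = x_a (- r) ** (w_a ** w_b ** w_a ** w_b ** w_a ** w_b)"
  by (rule matrix_eq_vec7I; simp add: algebra_simps)+

lemma weyl_x_b:
  "mat 1 ** x_b r = x_b r ** (mat 1)"
  "w_a ** x_b r = x_3ab r ** (w_a)"
  "w_b ** x_neg_b r = x_b (- r) ** (w_b)"
  "w_a ** w_b ** x_neg_b r = x_3ab (- r) ** (w_a ** w_b)"
  "w_b ** w_a ** x_b r = x_3a2b r ** (w_b ** w_a)"
  "w_a ** w_b ** w_a ** x_b r = x_3a2b r ** (w_a ** w_b ** w_a)"
  "w_b ** w_a ** w_b ** x_neg_b r = x_3a2b (- r) ** (w_b ** w_a ** w_b)"
  "w_a ** w_b ** w_a ** w_b ** x_neg_b r = x_3a2b (- r) ** (w_a ** w_b ** w_a ** w_b)"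
  "w_b ** w_a ** w_b ** w_a ** x_b r = x_3ab (- r) ** (w_b ** w_a ** w_b ** w_a)"
  "w_a ** w_b ** w_a ** w_b ** w_a ** x_b r = x_b r ** (w_a ** w_b ** w_a ** w_b ** w_a)"
  "w_b ** w_a ** w_b ** w_a ** w_b ** x_neg_b r = x_3ab r ** (w_b ** w_a ** w_b ** w_a ** w_b)"
  "w_a ** w_b ** w_a ** w_b ** w_a ** w_b ** x_neg_b r = x_b (- r) ** (w_a ** w_b ** w_a ** w_b ** w_a ** w_b)"
  by (rule matrix_eq_vec7I; simp add: algebra_simps)+

text \<open>Right multiplication by a simple reflection permutes the words up to the torus: when a
  word gets shorter, the square of \<open>w_a\<close>, a torus element, is moved to the
  front.\<close>

lemma weyl_mult_w_a:
  "mat 1 ** w_a = h_diag 1 1 ** (w_a)"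
  "w_a ** w_a = h_diag (- 1) 1 ** (mat 1)"
  "w_b ** w_a = h_diag 1 1 ** (w_b ** w_a)"
  "w_a ** w_b ** w_a = h_diag 1 1 ** (w_a ** w_b ** w_a)"
  "w_b ** w_a ** w_a = h_diag 1 (- 1) ** (w_b)"
  "w_a ** w_b ** w_a ** w_a = h_diag (- 1) (- 1) ** (w_a ** w_b)"
  "w_b ** w_a ** w_b ** w_a = h_diag 1 1 ** (w_b ** w_a ** w_b ** w_a)"
  "w_a ** w_b ** w_a ** w_b ** w_a = h_diag 1 1 ** (w_a ** w_b ** w_a ** w_b ** w_a)"
  "w_b ** w_a ** w_b ** w_a ** w_a = h_diag (- 1) (- 1) ** (w_b ** w_a ** w_b)"
  "w_a ** w_b ** w_a ** w_b ** w_a ** w_a = h_diag 1 (- 1) ** (w_a ** w_b ** w_a ** w_b)"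
  "w_b ** w_a ** w_b ** w_a ** w_b ** w_a = h_diag 1 1 ** (w_a ** w_b ** w_a ** w_b ** w_a ** w_b)"
  "w_a ** w_b ** w_a ** w_b ** w_a ** w_b ** w_a = h_diag (- 1) 1 ** (w_b ** w_a ** w_b ** w_a ** w_b)"
  by (rule matrix_eq_vec7I; simp)+

lemma weyl_mult_w_b:
  "mat 1 ** w_b = h_diag 1 1 ** (w_b)"
  "w_a ** w_b = h_diag 1 1 ** (w_a ** w_b)"
  "w_b ** w_b = h_diag (- 1) (- 1) ** (mat 1)"
  "w_a ** w_b ** w_b = h_diag 1 (- 1) ** (w_a)"
  "w_b ** w_a ** w_b = h_diag 1 1 ** (w_b ** w_a ** w_b)"
  "w_a ** w_b ** w_a ** w_b = h_diag 1 1 ** (w_a ** w_b ** w_a ** w_b)"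
  "w_b ** w_a ** w_b ** w_b = h_diag (- 1) 1 ** (w_b ** w_a)"
  "w_a ** w_b ** w_a ** w_b ** w_b = h_diag (- 1) 1 ** (w_a ** w_b ** w_a)"
  "w_b ** w_a ** w_b ** w_a ** w_b = h_diag 1 1 ** (w_b ** w_a ** w_b ** w_a ** w_b)"
  "w_a ** w_b ** w_a ** w_b ** w_a ** w_b = h_diag 1 1 ** (w_a ** w_b ** w_a ** w_b ** w_a ** w_b)"
  "w_b ** w_a ** w_b ** w_a ** w_b ** w_b = h_diag 1 (- 1) ** (w_b ** w_a ** w_b ** w_a)"
  "w_a ** w_b ** w_a ** w_b ** w_a ** w_b ** w_b = h_diag (- 1) (- 1) ** (w_a ** w_b ** w_a ** w_b ** w_a)"
  by (rule matrix_eq_vec7I; simp)+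

lemma weyl_cases_a:
  assumes "w \<in> weyl_words"
  shows "(\<forall>r. \<exists>y\<in>U_max. w ** x_a r = y ** w) \<or> (\<forall>r. \<exists>y\<in>U_max. w ** x_neg_a r = y ** w)"
  using assms unfolding weyl_words_def
  by (elim insertE emptyE; hypsubst)
    (((rule disjI1, rule allI, rule bexI, rule weyl_x_a, simp; fail) |
      (rule disjI2, rule allI, rule bexI, rule weyl_x_a, simp; fail))+)

lemma weyl_cases_b:
  assumes "w \<in> weyl_words"
  shows "(\<forall>r. \<exists>y\<in>U_max. w ** x_b r = y ** w) \<or> (\<forall>r. \<exists>y\<in>U_max. w ** x_neg_b r = y ** w)"
  using assms unfolding weyl_words_def
  by (elim insertE emptyE; hypsubst)
    (((rule disjI1, rule allI, rule bexI, rule weyl_x_b, simp; fail) |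
      (rule disjI2, rule allI, rule bexI, rule weyl_x_b, simp; fail))+)

lemma weyl_mult_a:
  assumes "w \<in> weyl_words"
  shows "\<exists>a b w'. w ** w_a = h_diag a b ** w' \<and> a \<noteq> 0 \<and> b \<noteq> 0 \<and> w' \<in> weyl_words"
  using assms
  by (subst (asm) weyl_words_def, elim insertE emptyE; hypsubst)
    (((rule exI)+, rule conjI, rule weyl_mult_w_a, simp add: weyl_words_def; fail)+)

lemma weyl_mult_b:
  assumes "w \<in> weyl_words"
  shows "\<exists>a b w'. w ** w_b = h_diag a b ** w' \<and> a \<noteq> 0 \<and> b \<noteq> 0 \<and> w' \<in> weyl_words"
  using assms
  by (subst (asm) weyl_words_def, elim insertE emptyE; hypsubst)
    (((rule exI)+, rule conjI, rule weyl_mult_w_b, simp add: weyl_words_def; fail)+)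

definition torus_stable :: "'k::field^7^7 \<Rightarrow> bool" where
  "torus_stable w \<longleftrightarrow> (\<forall>a b. a \<noteq> 0 \<longrightarrow> b \<noteq> 0 \<longrightarrow>
     (\<exists>a' b'. a' \<noteq> 0 \<and> b' \<noteq> 0 \<and> w ** h_diag a b = h_diag a' b' ** w))"

lemma torus_stable_mult: "torus_stable w \<Longrightarrow> torus_stable w' \<Longrightarrow> torus_stable (w ** w')"
  unfolding torus_stable_def by (metis matrix_mul_assoc)

lemma torus_stable_weyl:
  fixes w :: "'a::field^7^7"
  shows "w \<in> weyl_words \<Longrightarrow> torus_stable w"
proof -
  have "w_a ** h_diag a b = h_diag (a*b) (inverse b) ** w_a"
    "w_b ** h_diag a b = h_diag b a ** w_b" if "a \<noteq> 0" "b \<noteq> 0" for a b :: 'a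
    by (rule matrix_eq_vec7I; use that in simp)+
  then have "torus_stable (w_a :: 'a^7^7)" "torus_stable (w_b :: 'a^7^7)"
    unfolding torus_stable_def by (metis mult_eq_0_iff inverse_nonzero_iff_nonzero)+
  moreover have "torus_stable (mat 1 :: 'a^7^7)" unfolding torus_stable_def by auto
  ultimately show "w \<in> weyl_words \<Longrightarrow> torus_stable w"
    unfolding weyl_words_def by (elim insertE emptyE; hypsubst) (simp_all add: torus_stable_mult)
qed

definition bruhat_cell :: "'k::field^7^7 \<Rightarrow> bool" where
  "bruhat_cell g \<longleftrightarrow> (\<exists>u\<in>U_max. \<exists>a b. \<exists>w\<in>weyl_words. \<exists>u'\<in>U_max.
     a \<noteq> 0 \<and> b \<noteq> 0 \<and> g = u ** h_diag a b ** w ** u')"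

lemma bruhat_cellI:
  "u \<in> U_max \<Longrightarrow> a \<noteq> 0 \<Longrightarrow> b \<noteq> 0 \<Longrightarrow> w \<in> weyl_words \<Longrightarrow> u' \<in> U_max \<Longrightarrow>
     bruhat_cell (u ** h_diag a b ** w ** u')"
  unfolding bruhat_cell_def by blast

lemma bruhat_cell_mult_right:
  assumes "bruhat_cell g" "y \<in> U_max"
  shows "bruhat_cell (g ** y)"
proof -
  obtain u a b w u' where g: "u \<in> U_max" "w \<in> weyl_words" "u' \<in> U_max" "a \<noteq> 0" "b \<noteq> 0"
    "g = u ** h_diag a b ** w ** u'" using assms unfolding bruhat_cell_def by blast
  with bruhat_cellI[of u a b w "u' ** y"] matrix_groupD(2)[OF matrix_group_U_max g(3) assms(2)]
  show ?thesis by (simp add: matrix_mul_assoc)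
qed

lemma bruhat_cell_mult_left:
  assumes "bruhat_cell g" "y \<in> U_max"
  shows "bruhat_cell (y ** g)"
proof -
  obtain u a b w u' where g: "u \<in> U_max" "w \<in> weyl_words" "u' \<in> U_max" "a \<noteq> 0" "b \<noteq> 0"
    "g = u ** h_diag a b ** w ** u'" using assms unfolding bruhat_cell_def by blast
  with bruhat_cellI[of "y ** u" a b w u'] matrix_groupD(2)[OF matrix_group_U_max assms(2) g(1)]
  show ?thesis by (simp add: matrix_mul_assoc)
qed

lemma bruhat_cell_torus_weyl:
  assumes "a \<noteq> 0" "b \<noteq> 0" "w \<in> weyl_words"
  shows "bruhat_cell (h_diag a b ** w)"
  using bruhat_cellI[of "mat 1" a b w "mat 1"] assms matrix_groupD(1)[OF matrix_group_U_max] by simp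

text \<open>A rank one identity: for nonzero r the product lies in the big cell that starts with the
  negative root. It serves the words that send \<alpha> to a negative root, where
  \<open>x_a r\<close> itself cannot cross into \<open>U_max\<close>.\<close>

lemma x_a_w_a:
  assumes "r \<noteq> 0"
  shows "x_a r ** w_a = x_neg_a (inverse r) ** h_diag (- inverse r) (r^2) ** x_a (- inverse r)"
  by (rule matrix_eq_vec7I) (use assms in \<open>simp add: field_simps power2_eq_square\<close>)

lemma x_b_w_b:
  assumes "r \<noteq> 0"
  shows "x_b r ** w_b = x_neg_b (inverse r) ** h_diag (- r) (- inverse r) ** x_b (- inverse r)"
  by (rule matrix_eq_vec7I) (use assms in \<open>simp add: field_simps power2_eq_square\<close>)

text \<open>The exchange step of the Bruhat decomposition: whichever of \<open>w\<gamma>\<close>, \<open>-w\<gamma>\<close> is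
  positive, the corresponding root element moves across \<open>w\<close> into \<open>U_max\<close>.\<close>

lemma bruhat_cell_exchange:
  fixes s :: "'k::field^7^7"
  assumes x: "\<And>r. x r \<in> U_max"
    and cases: "(\<forall>r. \<exists>y\<in>U_max. w ** x r = y ** w) \<or> (\<forall>r. \<exists>y\<in>U_max. w ** x' r = y ** w)"
    and swap: "\<And>r. r \<noteq> 0 \<Longrightarrow> \<exists>r' a b r''. a \<noteq> 0 \<and> b \<noteq> 0 \<and> x r ** s = x' r' ** h_diag a b ** x r''"
    and zero: "x 0 = mat 1"
    and ws: "\<exists>a b w'. w ** s = h_diag a b ** w' \<and> a \<noteq> 0 \<and> b \<noteq> 0 \<and> w' \<in> weyl_words"
    and w: "w \<in> weyl_words" and ab: "a \<noteq> 0" "b \<noteq> 0"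
  shows "bruhat_cell (h_diag a b ** w ** x r ** s)"
proof -
  have move: "bruhat_cell (h_diag a b ** y ** g)"
    if "y \<in> U_max" "bruhat_cell (h_diag a b ** g)" for y g
  proof -
    have "h_diag a b ** y ** matrix_inv (h_diag a b) \<in> U_max"
      using normalizes_h_diag(1)[OF ab] that by (auto simp: normalizes_def)
    from bruhat_cell_mult_left[OF that(2) this]
    show ?thesis using matrix_inv_cancel(4)[of "h_diag a b"] ab by (simp add: matrix_mul_assoc)
  qed
  have hws: "bruhat_cell (h_diag a b ** (w ** s))"
  proof -
    obtain c d w' where *: "c \<noteq> 0" "d \<noteq> 0" "w' \<in> weyl_words" "w ** s = h_diag c d ** w'"
      using ws by blast
    show ?thesis unfolding *(4) matrix_mul_assoc h_diag_mult
      by (rule bruhat_cell_torus_weyl) (use * ab in auto)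
  qed
  from cases show ?thesis
  proof
    assume "\<forall>r. \<exists>y\<in>U_max. w ** x r = y ** w"
    then obtain y where y: "y \<in> U_max" "w ** x r = y ** w" by blast
    have "h_diag a b ** w ** x r ** s = h_diag a b ** y ** (w ** s)"
      using y(2) by (metis matrix_mul_assoc)
    then show ?thesis using move[OF y(1) hws] by simp
  next
    assume *: "\<forall>r. \<exists>y\<in>U_max. w ** x' r = y ** w"
    show ?thesis
    proof (cases "r = 0")
      case True
      then show ?thesis using hws by (simp add: zero matrix_mul_assoc)
    next
      case False
      then obtain r' c d r'' where cd: "c \<noteq> 0" "d \<noteq> 0"
        and eq: "x r ** s = x' r' ** h_diag c d ** x r''" using swap by blast
      obtain y where y: "y \<in> U_max" "w ** x' r' = y ** w" using * by blast
      obtain c' d' where cd': "c' \<noteq> 0" "d' \<noteq> 0" "w ** h_diag c d = h_diag c' d' ** w"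
        using torus_stable_weyl[OF w] cd unfolding torus_stable_def by blast
      have "h_diag a b ** w ** x r ** s = h_diag a b ** (w ** x' r') ** h_diag c d ** x r''"
        using eq by (metis matrix_mul_assoc)
      also have "\<dots> = h_diag a b ** y ** (w ** h_diag c d ** x r'')"
        unfolding y(2) by (simp add: matrix_mul_assoc)
      finally have e: "h_diag a b ** w ** x r ** s = h_diag a b ** y ** (w ** h_diag c d ** x r'')" .
      show ?thesis unfolding e
      proof (rule move[OF y(1)])
        show "bruhat_cell (h_diag a b ** (w ** h_diag c d ** x r''))"
          unfolding cd'(3) matrix_mul_assoc h_diag_mult
          by (intro bruhat_cell_mult_right bruhat_cell_torus_weyl) (use cd' ab w x in auto)
      qed
    qed
  qed
qed

text \<open>Split the simple root factor off u'. The remaining factor lies in a radical normalised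
  by the reflection and can be moved to its right, so a single root element stands between w and the
  reflection, and the exchange step applies.\<close>

lemma bruhat_cell_mult_w:
  fixes g :: "'a::field^7^7"
  assumes "bruhat_cell g"
  shows "bruhat_cell (g ** w_a)" "bruhat_cell (g ** w_b)"
proof -
  obtain u a b w u' where g: "u \<in> U_max" "w \<in> weyl_words" "u' \<in> U_max" "a \<noteq> 0" "b \<noteq> 0"
    "g = u ** h_diag a b ** w ** u'" using assms unfolding bruhat_cell_def by blast
  \<comment> \<open>The fourth powers of \<open>w_a\<close> and \<open>w_b\<close> are 1. With the
    inverse written as a positive power, \<open>normalizes_mult\<close> covers conjugation by the
    inverse too.\<close>
  have inv: "matrix_inv w_a = w_a ** w_a ** (w_a :: 'a^7^7)" "matrix_inv w_b = w_b ** w_b ** (w_b :: 'a^7^7)"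
    by (rule matrix_inv_eqI, rule matrix_eq_vec7I, simp)+
  have main: "bruhat_cell (g ** y)"
    if v: "v \<in> V" "u' = x ** v" and y: "normalizes y V" "matrix_inv y = y ** y ** y" and V: "V \<subseteq> U_max"
      and cell: "bruhat_cell (h_diag a b ** w ** x ** y)" for y x v :: "'a^7^7" and V
  proof -
    have yi: "invertible y" using y(1) by (simp add: normalizes_def)
    have "normalizes (matrix_inv y) V" unfolding y(2) by (intro normalizes_mult y(1))
    then have "matrix_inv y ** v ** y \<in> V"
      using v(1) yi by (auto simp: normalizes_def matrix_inv_matrix_inv)
    then have "bruhat_cell (u ** (h_diag a b ** w ** x ** y) ** (matrix_inv y ** v ** y))"
      using V by (intro bruhat_cell_mult_right[OF bruhat_cell_mult_left[OF cell g(1)]]) blast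
    then show ?thesis unfolding g v(2) by (simp add: matrix_mul_assoc matrix_inv_cancel[OF yi])
  qed
  show "bruhat_cell (g ** w_a)"
  proof -
    obtain r v where v: "v \<in> V_a" "u' = x_a r ** v" using U_max_factor_x_a[OF g(3)] by blast
    show ?thesis
    proof (rule main[OF v normalizes_w(1) inv(1)])
      show "bruhat_cell (h_diag a b ** w ** x_a r ** w_a)"
      proof (rule bruhat_cell_exchange[of x_a w x_neg_a])
        show "\<exists>r' a b r''. a \<noteq> 0 \<and> b \<noteq> 0 \<and> x_a r ** w_a = x_neg_a r' ** h_diag a b ** x_a r''"
          if "r \<noteq> 0" for r :: 'a
          by (intro exI conjI, rule_tac[3] x_a_w_a) (use that in auto)
      qed (use g weyl_cases_a weyl_mult_a in \<open>auto simp: x_zero\<close>)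
    qed (use radicals_subset_U_max in auto)
  qed
  show "bruhat_cell (g ** w_b)"
  proof -
    obtain r v where v: "v \<in> V_b" "u' = x_b r ** v" using U_max_factor_x_b[OF g(3)] by blast
    show ?thesis
    proof (rule main[OF v normalizes_w(2) inv(2)])
      show "bruhat_cell (h_diag a b ** w ** x_b r ** w_b)"
      proof (rule bruhat_cell_exchange[of x_b w x_neg_b])
        show "\<exists>r' a b r''. a \<noteq> 0 \<and> b \<noteq> 0 \<and> x_b r ** w_b = x_neg_b r' ** h_diag a b ** x_b r''"
          if "r \<noteq> 0" for r :: 'a
          by (intro exI conjI, rule_tac[3] x_b_w_b) (use that in auto)
      qed (use g weyl_cases_b weyl_mult_b in \<open>auto simp: x_zero\<close>)
    qed (use radicals_subset_U_max in auto)
  qed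
qed

theorem bruhat_decomposition:
  fixes g :: "'a::field^7^7"
  assumes "g \<in> G2"
  shows "bruhat_cell g"
proof (rule generate_GL_induct_right[OF _ assms[unfolded G2_def]])
  show "bruhat_cell (mat 1 :: 'a^7^7)"
    using bruhat_cell_torus_weyl[of "1::'a" 1 "mat 1"] by (simp add: h_diag_1 weyl_words_def)
next
  fix s g :: "'a^7^7" assume g: "bruhat_cell g"
    and s: "s \<in> range x_a \<union> range x_neg_a \<union> range x_b \<union> range x_neg_b"
  \<comment> \<open>A negative root element is a positive one conjugated by the simple reflection,
    whose inverse is its cube.\<close>
  have "x_neg_a r = w_a ** w_a ** w_a ** x_a (- r) ** w_a"
    "x_neg_b r = w_b ** w_b ** w_b ** x_b (- r) ** w_b" for r :: 'a
    by (rule matrix_eq_vec7I; simp add: algebra_simps)+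
  note neg = this
  have "bruhat_cell (g ** x_a r)" "bruhat_cell (g ** x_b r)" for r
    using g by (auto intro: bruhat_cell_mult_right)
  moreover have "bruhat_cell (g ** x_neg_a r)" "bruhat_cell (g ** x_neg_b r)" for r
    unfolding neg matrix_mul_assoc
    by (intro bruhat_cell_mult_w bruhat_cell_mult_right g x_in_U_max)+
  ultimately show "bruhat_cell (g ** s)" using s by auto
qed auto

section \<open>Uniqueness of Whittaker functionals\<close>

text \<open>\<open>multiplicity_cond N \<omega> \<theta> g\<close>: the double coset of \<open>g\<close> either is fixed by \<open>\<theta>\<close>,
  compatibly with \<open>\<omega>\<close>, or carries no \<open>(\<omega>, \<omega>)\<close>-equivariant function.\<close>

definition multiplicity_cond ::
  "('k::field^'n^'n) set \<Rightarrow> ('k^'n^'n \<Rightarrow> complex) \<Rightarrow> ('k^'n^'n \<Rightarrow> 'k^'n^'n) \<Rightarrow> 'k^'n^'n \<Rightarrow> bool" where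
  "multiplicity_cond N \<omega> \<theta> g \<longleftrightarrow>
     (\<exists>u\<in>N. \<exists>u'\<in>N. \<theta> g = u ** g ** u' \<and> \<omega> u * \<omega> u' = 1) \<or>
     (\<exists>u\<in>N. \<exists>u'\<in>N. u ** g = g ** u' \<and> \<omega> u \<noteq> \<omega> u')"

lemma mult_U_max [simp]: "u \<in> U_max \<Longrightarrow> u' \<in> U_max \<Longrightarrow> u ** u' \<in> U_max"
  and inv_U_max [simp]: "u \<in> U_max \<Longrightarrow> matrix_inv u \<in> U_max"
  and one_U_max [simp]: "mat 1 \<in> U_max"
  and invertible_U_max: "u \<in> U_max \<Longrightarrow> invertible u"
  using matrix_groupD[OF matrix_group_U_max] by blast+

text \<open>\<open>h_diag 1 (- 1)\<close> negates both simple roots, so \<open>theta\<close> fixes the simple root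
  subgroups pointwise.\<close>

definition theta :: "'k::field^7^7 \<Rightarrow> 'k^7^7" where
  "theta g = h_diag 1 (- 1) ** matrix_inv g ** h_diag 1 (- 1)"

lemma h_sq: "h_diag 1 (- 1) ** h_diag 1 (- 1) = mat 1"
  by (simp add: h_diag_mult h_diag_1)

lemma theta_mult:
  assumes "invertible g" "invertible g'"
  shows "theta (g ** g') = theta g' ** theta g"
proof -
  have "theta g' ** theta g =
      h_diag 1 (- 1) ** matrix_inv g' ** (h_diag 1 (- 1) ** h_diag 1 (- 1)) ** matrix_inv g ** h_diag 1 (- 1)"
    unfolding theta_def by (simp only: matrix_mul_assoc)
  then show ?thesis unfolding h_sq using assms by (simp add: theta_def matrix_inv_mult matrix_mul_assoc)
qed

lemma h_diag_inv_conj: "h_diag 1 (- 1) ** u ** h_diag 1 (- 1) =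
    h_diag 1 (- 1) ** u ** matrix_inv (h_diag 1 (- 1))"
  by simp

lemma theta_G2: "g \<in> G2 \<Longrightarrow> theta g \<in> G2"
  using h_diag_in_G2[of "1::'a" "- 1"] by (simp add: theta_def)

lemma theta_U_max:
  fixes u :: "'k::field^7^7"
  assumes "u \<in> U_max"
  shows "theta u \<in> U_max"
  using normalizes_h_diag(1)[of "1::'k" "- 1"] inv_U_max[OF assms]
  unfolding theta_def h_diag_inv_conj by (simp add: normalizes_def)

lemma h_diag_entries:
  "(h_diag 1 (- 1) ** u ** h_diag 1 (- 1)) $ 5 $ 1 = - (u $ 5 $ 1)"
  "(h_diag 1 (- 1) ** u ** h_diag 1 (- 1)) $ 1 $ 2 = - (u $ 1 $ 2)"
proof -
  have e: "h_diag 1 (- 1) *v v = vec7 (v$1) (- (v$2)) (- (v$3)) (v$4) (- (v$5)) (- (v$6)) (v$7)" for v :: "'a^7"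
    by (subst vec7_eta[symmetric], subst h_diag_vec7) simp
  have "(u *v vec7 0 (- 1) 0 0 0 0 0) $ 1 = - (u$1$2)"
    by (simp add: matrix_vector_mult_def sum_7)
  then show "(h_diag 1 (- 1) ** u ** h_diag 1 (- 1)) $ 1 $ 2 = - (u $ 1 $ 2)"
    by (subst mult_vec7_basis(2)[symmetric]) (simp add: e)
  show "(h_diag 1 (- 1) ** u ** h_diag 1 (- 1)) $ 5 $ 1 = - (u $ 5 $ 1)"
    by (subst mult_vec7_basis(1)[symmetric]) (simp add: e)
qed

lemma U_max_inv_entries:
  assumes u: "u \<in> U_max"
  shows "matrix_inv u $ 5 $ 1 = - (u $ 5 $ 1)" "matrix_inv u $ 1 $ 2 = - (u $ 1 $ 2)"
proof -
  have "matrix_inv u \<in> U_max" and i: "u ** matrix_inv u = mat 1"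
    using u by (simp_all add: matrix_inv_right invertible_U_max)
  from U_max_mult_entries[OF u this(1)] show "matrix_inv u $ 5 $ 1 = - (u $ 5 $ 1)"
    "matrix_inv u $ 1 $ 2 = - (u $ 1 $ 2)"
    unfolding i by (simp_all add: eq_neg_iff_add_eq_0 add.commute)
qed

lemma psi_U_theta:
  assumes "nontrivial_additive_character \<psi>" "u \<in> U_max"
  shows "psi_U \<psi> (theta u) = psi_U \<psi> u"
  using psi_U_eq[OF assms(1) theta_U_max[OF assms(2)]] psi_U_eq[OF assms]
  unfolding theta_def h_diag_entries U_max_inv_entries[OF assms(2)] by simp

text \<open>The condition depends only on the double coset of g, so it can be checked on Bruhat
  representatives. Because \<open>\<theta>\<close> reverses products, the two outer factors change
  sides, and preservation of \<open>\<omega>\<close> makes their contributions cancel.\<close>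

lemma multiplicity_cond_cong:
  fixes N :: "('k::field^'n^'n) set"
  assumes N: "matrix_group N"
    and mult: "\<And>u u'. u \<in> N \<Longrightarrow> u' \<in> N \<Longrightarrow> \<omega> (u ** u') = \<omega> u * \<omega> u'"
    and \<theta>: "\<And>u. u \<in> N \<Longrightarrow> \<theta> u \<in> N \<and> \<omega> (\<theta> u) = \<omega> u"
    and \<theta>_mult: "\<And>g g'. invertible g \<Longrightarrow> invertible g' \<Longrightarrow> \<theta> (g ** g') = \<theta> g' ** \<theta> g"
    and \<omega>1: "\<omega> (mat 1) = 1"
    and g: "multiplicity_cond N \<omega> \<theta> g" "invertible g"
    and u: "u1 \<in> N" "u2 \<in> N"
  shows "multiplicity_cond N \<omega> \<theta> (u1 ** g ** u2)"
proof -
  note Nd = matrix_groupD[OF N]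
  have c: "matrix_inv x ** x = mat 1" "x ** matrix_inv x = mat 1" if "x \<in> N" for x
    using that Nd(3) by (auto simp: matrix_inv_left matrix_inv_right)
  have inv: "\<omega> (matrix_inv x) * \<omega> x = 1" if "x \<in> N" for x
    using mult[of "matrix_inv x" x] that Nd(4)[OF that] by (simp add: c \<omega>1)
  have can: "matrix_inv x ** (x ** y) = y" "x ** (matrix_inv x ** y) = y" if "x \<in> N" for x y :: "'k^'n^'n"
  proof -
    show "matrix_inv x ** (x ** y) = y" by (rule matrix_inv_cancel(1)[OF Nd(3)[OF that]])
    show "x ** (matrix_inv x ** y) = y" by (rule matrix_inv_cancel(2)[OF Nd(3)[OF that]])
  qed
  from g(1) consider
    (stable) u u' where "u \<in> N" "u' \<in> N" "\<theta> g = u ** g ** u'" "\<omega> u * \<omega> u' = 1"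
    | (kill) u u' where "u \<in> N" "u' \<in> N" "u ** g = g ** u'" "\<omega> u \<noteq> \<omega> u'"
    unfolding multiplicity_cond_def by blast
  then show ?thesis
  proof cases
    case stable
    let ?a = "\<theta> u2 ** u ** matrix_inv u1" and ?b = "matrix_inv u2 ** u' ** \<theta> u1"
    have "\<theta> (u1 ** g ** u2) = \<theta> u2 ** (\<theta> g ** \<theta> u1)"
      using g(2) u Nd(3) by (simp add: \<theta>_mult invertible_mult)
    also have "\<dots> = ?a ** (u1 ** g ** u2) ** ?b"
      unfolding stable(3) by (simp add: matrix_mul_assoc [symmetric] can u)
    finally have "\<theta> (u1 ** g ** u2) = ?a ** (u1 ** g ** u2) ** ?b" .
    moreover have ab: "?a \<in> N" "?b \<in> N" using u stable \<theta> by (auto intro!: Nd)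
    moreover have "\<omega> ?a * \<omega> ?b = (\<omega> u * \<omega> u') * (\<omega> (matrix_inv u1) * \<omega> u1) * (\<omega> (matrix_inv u2) * \<omega> u2)"
      using u stable \<theta> by (simp add: mult Nd)
    then have "\<omega> ?a * \<omega> ?b = 1" by (simp add: inv u stable)
    ultimately show ?thesis unfolding multiplicity_cond_def by blast
  next
    case kill
    let ?a = "u1 ** u ** matrix_inv u1" and ?b = "matrix_inv u2 ** u' ** u2"
    have "?a ** (u1 ** g ** u2) = u1 ** (u ** g) ** u2"
      by (simp add: matrix_mul_assoc [symmetric] can u)
    also have "\<dots> = (u1 ** g ** u2) ** ?b"
      unfolding kill(3) by (simp add: matrix_mul_assoc [symmetric] can u)
    finally have "?a ** (u1 ** g ** u2) = (u1 ** g ** u2) ** ?b" .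
    moreover have ab: "?a \<in> N" "?b \<in> N" using u kill \<theta> by (auto intro!: Nd)
    moreover have "\<omega> ?a = \<omega> u * (\<omega> (matrix_inv u1) * \<omega> u1)" "\<omega> ?b = \<omega> u' * (\<omega> (matrix_inv u2) * \<omega> u2)"
      using u kill by (simp_all add: mult Nd)
    then have "\<omega> ?a \<noteq> \<omega> ?b" using kill by (simp add: inv u)
    ultimately show ?thesis unfolding multiplicity_cond_def by blast
  qed
qed

text \<open>For each Weyl word outside \<open>{1, w_0 w_\<beta>, w_0 w_\<alpha>, w_0}\<close> some simple root is sent to
  a positive root that is not simple.\<close>

lemma weyl_nonsimple_image:
  assumes w: "w \<in> weyl_words" and ab: "a \<noteq> 0" "b \<noteq> 0"
    and special: "w \<noteq> mat 1" "w \<noteq> w_a ** w_b ** w_a ** w_b ** w_a"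
      "w \<noteq> w_b ** w_a ** w_b ** w_a ** w_b" "w \<noteq> w_a ** w_b ** w_a ** w_b ** w_a ** w_b"
  defines "N \<equiv> range x_ab \<union> range x_2ab \<union> range x_3ab \<union> range x_3a2b"
  shows "\<exists>x\<in>{x_a, x_b}. \<forall>r. \<exists>y\<in>N. y ** (h_diag a b ** w) = (h_diag a b ** w) ** x r"
proof -
  have *: "(\<forall>r. \<exists>y\<in>N. w ** x_a r = y ** w) \<or> (\<forall>r. \<exists>y\<in>N. w ** x_b r = y ** w)"
    using w special unfolding weyl_words_def
    by (elim insertE emptyE; hypsubst)
      (((erule notE, rule refl; fail) |
        (rule disjI1, rule allI, rule bexI, rule weyl_x_a, simp add: N_def; fail) |
        (rule disjI2, rule allI, rule bexI, rule weyl_x_b, simp add: N_def; fail))+)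
  then obtain x where x: "x \<in> {x_a, x_b}" and xy: "\<And>r. \<exists>y\<in>N. w ** x r = y ** w" by blast
  have y': "\<exists>y'\<in>N. y' ** h_diag a b = h_diag a b ** y" if "y \<in> N" for y
    using that unfolding N_def by (elim UnE rangeE) (simp add: h_diag_conj[OF ab], blast)+
  have "\<exists>y\<in>N. y ** (h_diag a b ** w) = (h_diag a b ** w) ** x r" for r
    using xy[of r] y' by (metis matrix_mul_assoc)
  then show ?thesis using x by blast
qed

text \<open>\<open>n\<close> is fixed by \<open>theta\<close> once
  \<open>n ** h_diag 1 (- 1)\<close> squares to 1; in this form no long Weyl word has to be
  inverted.\<close>

lemma theta_eqI:
  assumes "n ** h_diag 1 (- 1) ** n ** h_diag 1 (- 1) = mat 1"
  shows "theta n = n"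
proof -
  have "matrix_inv n = h_diag 1 (- 1) ** n ** h_diag 1 (- 1)"
    by (rule matrix_inv_eqI) (use assms in \<open>simp add: matrix_mul_assoc\<close>)
  then have "theta n = (h_diag 1 (- 1) ** h_diag 1 (- 1)) ** n ** (h_diag 1 (- 1) ** h_diag 1 (- 1))"
    by (simp add: theta_def matrix_mul_assoc)
  then show ?thesis by (simp add: h_sq)
qed

lemma character_separates:
  assumes "nontrivial_additive_character \<psi>" "c \<noteq> 1"
  shows "\<exists>r. \<psi> (c * r) \<noteq> \<psi> (r::'k::field)"
proof -
  have \<psi>: "\<psi> (x + y) = \<psi> x * \<psi> y" "\<psi> 0 = 1" for x y
    using assms by (auto simp: nontrivial_additive_character_def)
  obtain x where x: "\<psi> x \<noteq> 1" using assms by (auto simp: nontrivial_additive_character_def)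
  \<comment> \<open>The argument r solves c r - r = x, where x is a point at which
    \<open>\<psi>\<close> is not 1.\<close>
  have "\<psi> (c * (x / (c - 1))) = \<psi> (x / (c - 1) + x)"
    using assms(2) by (intro arg_cong[of _ _ \<psi>]) (simp add: field_simps)
  moreover have "\<psi> (x / (c - 1)) \<noteq> 0" using \<psi>(1)[of "x / (c - 1)" "- (x / (c - 1))"] \<psi>(2) by auto
  ultimately show ?thesis using x by (intro exI[of _ "x / (c - 1)"]) (simp add: \<psi>)
qed

text \<open>Each special word fixes the simple roots that it does not make negative. If the torus
  part has a value other than 1 on such a root, the character separates the two sides; otherwise the
  representative is fixed by \<open>theta\<close>. For the longest word no simple root is left and
  every torus part gives a fixed element. Any other word moves some simple root to a positive root
  on which \<open>psi_U\<close> is trivial.\<close>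

lemma multiplicity_cond_weyl:
  fixes \<psi> :: "'k::field \<Rightarrow> complex"
  assumes \<psi>: "nontrivial_additive_character \<psi>" and w: "w \<in> weyl_words" and ab: "a \<noteq> 0" "b \<noteq> 0"
  shows "multiplicity_cond U_max (psi_U \<psi>) theta (h_diag a b ** w)"
proof -
  let ?n = "h_diag a b ** w"
  have fixed: ?thesis if "theta ?n = ?n"
    unfolding multiplicity_cond_def using that
    by (intro disjI1 bexI[of _ "mat 1"]) (auto simp: psi_U_x[OF \<psi>])
  have kill: ?thesis if "u ** ?n = ?n ** u'" "u \<in> U_max" "u' \<in> U_max" "psi_U \<psi> u \<noteq> psi_U \<psi> u'" for u u'
    using that unfolding multiplicity_cond_def by blast
  consider "w = mat 1" | "w = w_a ** w_b ** w_a ** w_b ** w_a" | "w = w_b ** w_a ** w_b ** w_a ** w_b"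
    | "w = w_a ** w_b ** w_a ** w_b ** w_a ** w_b"
    | "w \<noteq> mat 1" "w \<noteq> w_a ** w_b ** w_a ** w_b ** w_a"
      "w \<noteq> w_b ** w_a ** w_b ** w_a ** w_b" "w \<noteq> w_a ** w_b ** w_a ** w_b ** w_a ** w_b" by blast
  then show ?thesis
  proof cases
    case 1
    show ?thesis
    proof (cases "b = 1")
      case False
      then obtain r where "\<psi> (b * r) \<noteq> \<psi> r" using character_separates[OF \<psi>] by blast
      then show ?thesis using 1 h_diag_conj(1)[OF ab, of r]
        by (intro kill[of "x_a (b*r)" "x_a r"]) (auto simp: psi_U_x[OF \<psi>])
    next
      case b: True
      show ?thesis
      proof (cases "a = 1")
        case False
        then obtain r where "\<psi> (a * r) \<noteq> \<psi> r" using character_separates[OF \<psi>] by blast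
        then show ?thesis using 1 b h_diag_conj(2)[OF ab, of r]
          by (intro kill[of "x_b (a*r)" "x_b r"]) (auto simp: psi_U_x[OF \<psi>])
      next
        case True
        then show ?thesis using b 1 by (intro fixed theta_eqI) (simp add: h_diag_1 h_sq)
      qed
    qed
  next
    case 2
    show ?thesis
    proof (cases "a = b")
      case False
      then have "a * inverse b \<noteq> 1" using ab by (simp add: field_simps)
      then obtain r where r: "\<psi> (a * inverse b * r) \<noteq> \<psi> r" using character_separates[OF \<psi>] by blast
      have "w ** x_b r = x_b r ** w" unfolding 2 by (rule weyl_x_b)
      then have "x_b (a * inverse b * r) ** ?n = ?n ** x_b r"
        using h_diag_conj(2)[OF ab, of r] by (metis matrix_mul_assoc)
      then show ?thesis using r by (intro kill[of "x_b (a * inverse b * r)" "x_b r"]) (auto simp: psi_U_x[OF \<psi>])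
    next
      case True
      then show ?thesis unfolding 2
        by (intro fixed[unfolded 2] theta_eqI matrix_eq_vec7I) (use ab in \<open>simp add: field_simps\<close>)
    qed
  next
    case 3
    show ?thesis
    proof (cases "b = 1")
      case False
      then obtain r where r: "\<psi> (b * r) \<noteq> \<psi> r" using character_separates[OF \<psi>] by blast
      have "w ** x_a r = x_a r ** w" unfolding 3 by (rule weyl_x_a)
      then have "x_a (b * r) ** ?n = ?n ** x_a r"
        using h_diag_conj(1)[OF ab, of r] by (metis matrix_mul_assoc)
      then show ?thesis using r by (intro kill[of "x_a (b * r)" "x_a r"]) (auto simp: psi_U_x[OF \<psi>])
    next
      case True
      then show ?thesis unfolding 3
        by (intro fixed[unfolded 3] theta_eqI matrix_eq_vec7I) (use ab in simp)
    qed
  next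
    case 4
    show ?thesis unfolding 4
      by (intro fixed[unfolded 4] theta_eqI matrix_eq_vec7I) (use ab in \<open>simp add: field_simps\<close>)
  next
    case 5
    from weyl_nonsimple_image[OF w ab 5] obtain x where x: "x \<in> {x_a, x_b}"
      and xy: "\<And>r. \<exists>y\<in>range x_ab \<union> range x_2ab \<union> range x_3ab \<union> range x_3a2b. y ** ?n = ?n ** x r" by (elim bexE) blast
    obtain r where r: "\<psi> r \<noteq> 1" using \<psi> by (auto simp: nontrivial_additive_character_def)
    obtain y where y: "y \<in> range x_ab \<union> range x_2ab \<union> range x_3ab \<union> range x_3a2b" "y ** ?n = ?n ** x r"
      using xy[of r] by (elim bexE)
    have "y \<in> U_max" "psi_U \<psi> y = 1" using y(1) by (auto simp: psi_U_x[OF \<psi>])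
    moreover have "x r \<in> U_max" "psi_U \<psi> (x r) = \<psi> r" using x by (auto simp: psi_U_x[OF \<psi>])
    ultimately show ?thesis using y(2) r by (intro kill[of y "x r"]) auto
  qed
qed

theorem multiplicity_cond_G2:
  fixes \<psi> :: "'k::field \<Rightarrow> complex"
  assumes \<psi>: "nontrivial_additive_character \<psi>" and g: "g \<in> G2"
  shows "multiplicity_cond U_max (psi_U \<psi>) theta g"
proof -
  from bruhat_decomposition[OF g] obtain u a b w u' where *: "u \<in> U_max" "u' \<in> U_max" "w \<in> weyl_words"
    "a \<noteq> 0" "b \<noteq> 0" "g = u ** (h_diag a b ** w) ** u'"
    unfolding bruhat_cell_def by (metis matrix_mul_assoc)
  have iu: "invertible u" "invertible u'"
    using * by (simp_all add: invertible_U_max)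
  have "h_diag a b ** w = matrix_inv u ** g ** matrix_inv u'"
    unfolding *(6) by (simp add: matrix_mul_assoc matrix_inv_cancel[OF iu(2)] matrix_inv_left[OF iu(1)])
  then have i: "invertible (h_diag a b ** w)"
    using iu invertible_G2[OF g] by (simp add: invertible_mult invertible_matrix_inv)
  show ?thesis unfolding *(6)
    by (rule multiplicity_cond_cong[OF matrix_group_U_max])
      (use * i \<psi> in \<open>simp_all add: psi_U_mult theta_U_max psi_U_theta theta_mult psi_U_x multiplicity_cond_weyl\<close>)
qed

section \<open>Eigenvectors of an operator on a stable subspace\<close>

context finite_dimensional_vector_space
begin

text \<open>Among \<open>dimension + 1\<close> iterates either two coincide, and their difference is
  the relation, or they are too many to be independent.\<close>

lemma polynomial_relation:
  fixes f :: "'b \<Rightarrow> 'b"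
  shows "\<exists>c n. (\<exists>i\<le>n. c i \<noteq> 0) \<and> (\<Sum>i\<le>n. c i *s (f ^^ i) w) = 0"
proof (cases "inj_on (\<lambda>i. (f ^^ i) w) {..dimension}")
  case True
  let ?S = "(\<lambda>i. (f ^^ i) w) ` {..dimension}"
  have "card ?S = Suc dimension" using True by (simp add: card_image)
  then have "dim ?S < card ?S" using dim_subset_UNIV[of ?S] by linarith
  then have "dependent ?S" by (intro dependent_biggerset_general) auto
  then obtain u where u: "\<exists>v\<in>?S. u v \<noteq> 0" "(\<Sum>v\<in>?S. u v *s v) = 0"
    by (auto simp: dependent_finite)
  then have "(\<Sum>i\<le>dimension. u ((f ^^ i) w) *s (f ^^ i) w) = 0"
    by (simp add: sum.reindex[OF True] o_def)
  with u(1) show ?thesis by (intro exI[of _ "\<lambda>i. u ((f ^^ i) w)"] exI[of _ dimension]) auto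
next
  case False
  then obtain i j where ij: "i < j" "(f ^^ i) w = (f ^^ j) w"
    by (auto simp: inj_on_def) (metis nat_neq_iff)
  let ?c = "\<lambda>k. if k = i then 1 else if k = j then - 1 else 0"
  have "(\<Sum>k\<le>j. ?c k *s (f ^^ k) w) = (\<Sum>k\<in>{i, j}. ?c k *s (f ^^ k) w)"
    by (rule sum.mono_neutral_right) (use ij in auto)
  also have "\<dots> = 0" using ij by simp
  finally show ?thesis using ij by (intro exI[of _ ?c] exI[of _ j]) auto
qed

end

text \<open>\<open>F p\<close> is p(f) w. For an annihilating p of least degree and a root z of p,
  the quotient q of p by X - z gives the eigenvector \<open>F q\<close>: it is nonzero by
  minimality, and it lies in \<open>E\<close> because \<open>E\<close> is stable.\<close>

lemma eigenvector_exists: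
  fixes s :: "complex \<Rightarrow> 'v::ab_group_add \<Rightarrow> 'v"
  assumes fd: "finite_dimensional_vector_space s B" and f: "Vector_Spaces.linear s s f"
    and E: "module.subspace s E" "\<And>v. v \<in> E \<Longrightarrow> f v \<in> E" and w: "w \<in> E" "w \<noteq> 0"
  shows "\<exists>c x. x \<in> E \<and> x \<noteq> 0 \<and> f x = s c x"
proof -
  interpret finite_dimensional_vector_space s B by (rule fd)
  interpret f: Vector_Spaces.linear s s f by (rule f)
  define F where "F p = (\<Sum>i\<le>degree p. s (coeff p i) ((f ^^ i) w))" for p
  have F: "F p = (\<Sum>i\<le>n. s (coeff p i) ((f ^^ i) w))" if "degree p \<le> n" for p n
    unfolding F_def using that
    by (intro sum.mono_neutral_left) (auto simp: coeff_eq_0)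
  have fE: "(f ^^ i) w \<in> E" for i by (induct i) (auto simp: w E)
  have FE: "F p \<in> E" for p unfolding F_def
    by (intro subspace_sum subspace_scale E fE)
  obtain c n where c: "\<exists>i\<le>n. c i \<noteq> 0" "(\<Sum>i\<le>n. s (c i) ((f ^^ i) w)) = 0"
    using polynomial_relation by blast
  define p0 where "p0 = (\<Sum>i\<le>n. monom (c i) i)"
  have cp0: "coeff p0 i = (if i \<le> n then c i else 0)" for i
    by (auto simp: p0_def coeff_sum)
  have "degree p0 \<le> n" by (rule degree_le) (auto simp: cp0)
  then have "F p0 = 0" using c(2) by (simp add: F cp0)
  moreover have "p0 \<noteq> 0" using c(1) cp0 by (metis coeff_0)
  ultimately obtain p where p: "F p = 0" "p \<noteq> 0"
    and min: "\<And>q. F q = 0 \<Longrightarrow> q \<noteq> 0 \<Longrightarrow> degree p \<le> degree q"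
    using ex_has_least_nat[of "\<lambda>p. F p = 0 \<and> p \<noteq> 0" p0 degree] by blast
  have "degree p \<noteq> 0"
  proof
    assume "degree p = 0"
    then obtain a where "p = [:a:]" by (metis degree_eq_zeroE)
    with p show False using w by (auto simp: F_def)
  qed
  then obtain z where "poly p z = 0"
    using fundamental_theorem_of_algebra[of p] by (auto simp: constant_degree)
  then obtain q where q: "p = [:- z, 1:] * q" by (auto simp: poly_eq_0_iff_dvd dvd_def)
  have q0: "q \<noteq> 0" using p q by auto
  have "degree p = Suc (degree q)" unfolding q using q0 by (subst degree_mult_eq) auto
  then have Fq: "F q \<noteq> 0" using min[of q] q0 by auto
  have sumS: "(\<Sum>i\<le>Suc n. g i) = g 0 + (\<Sum>i\<le>n. g (Suc i))" for g :: "nat \<Rightarrow> 'v" and n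
    by (rule sum.atMost_Suc_shift)
  have "F p = (\<Sum>i\<le>Suc (degree q). s (coeff (pCons 0 q) i - z * coeff q i) ((f ^^ i) w))"
    unfolding F[OF eq_refl[OF \<open>degree p = Suc (degree q)\<close>]] by (simp add: q)
  also have "\<dots> = (\<Sum>i\<le>Suc (degree q). s (coeff (pCons 0 q) i) ((f ^^ i) w)) -
      (\<Sum>i\<le>Suc (degree q). s z (s (coeff q i) ((f ^^ i) w)))"
    by (simp add: scale_left_diff_distrib sum_subtractf)
  also have "(\<Sum>i\<le>Suc (degree q). s (coeff (pCons 0 q) i) ((f ^^ i) w)) = f (F q)"
    unfolding sumS F_def by (simp add: f.sum f.scale)
  also have "(\<Sum>i\<le>Suc (degree q). s z (s (coeff q i) ((f ^^ i) w))) = s z (F q)"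
    by (simp add: F[of q "Suc (degree q)"] scale_sum_right del: sum.atMost_Suc)
  finally have "f (F q) = s z (F q)" using p by simp
  then show ?thesis using Fq FE by blast
qed

lemma matrix_group_finite_sum_left:
  fixes F :: "'k::{field,finite}^'n^'n \<Rightarrow> 'a::comm_monoid_add"
  assumes "matrix_group N" "h \<in> N"
  shows "(\<Sum>u\<in>N. F (h ** u)) = (\<Sum>u\<in>N. F u)" "(\<Sum>u\<in>N. F (u ** h)) = (\<Sum>u\<in>N. F u)"
  using matrix_group_mult_bij(1,2)[OF assms] by (auto intro: sum.reindex_bij_betw)

text \<open>The Gelfand--Kazhdan argument, at the level of operators. With \<open>e\<close> the (unnormalised)
  projector onto the \<open>(N, \<omega>)\<close>-isotypic vectors, \<open>e g e = e (\<theta> g) e\<close> for all \<open>g\<close>; since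
  \<open>\<theta>\<close> reverses products, these operators commute, and by irreducibility their
  common eigenvectors fill a line.\<close>

lemma multiplicity_one:
  fixes s :: "complex \<Rightarrow> 'v::ab_group_add \<Rightarrow> 'v"
    and \<rho> :: "'k::{field,finite}^'n^'n \<Rightarrow> 'v \<Rightarrow> 'v"
  assumes irr: "irreducible_representation s G \<rho>" and G: "matrix_group G"
    and N: "matrix_group N" "N \<subseteq> G"
    and \<omega>: "\<And>u u'. u \<in> N \<Longrightarrow> u' \<in> N \<Longrightarrow> \<omega> (u ** u') = \<omega> u * \<omega> u'" "\<omega> (mat 1) = 1"
    and \<theta>G: "\<And>g. g \<in> G \<Longrightarrow> \<theta> g \<in> G"
    and \<theta>N: "\<And>u. u \<in> N \<Longrightarrow> \<theta> u \<in> N" "\<And>u. u \<in> N \<Longrightarrow> \<omega> (\<theta> u) = \<omega> u"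
      "\<And>u. u \<in> N \<Longrightarrow> \<theta> (\<theta> u) = u"
    and \<theta>_mult: "\<And>g g'. g \<in> G \<Longrightarrow> g' \<in> G \<Longrightarrow> \<theta> (g ** g') = \<theta> g' ** \<theta> g"
    and cond: "\<And>g. g \<in> G \<Longrightarrow> multiplicity_cond N \<omega> \<theta> g"
    and l: "l \<in> Hom_char s N \<rho> \<omega>" "l \<noteq> (\<lambda>_. 0)" and l': "l' \<in> Hom_char s N \<rho> \<omega>"
  shows "\<exists>c. \<forall>v. l' v = c * l v"
proof -
  have rep: "representation s G \<rho>"
    and sub': "\<forall>S. module.subspace s S \<and> (\<forall>g\<in>G. \<forall>v\<in>S. \<rho> g v \<in> S) \<longrightarrow> S = {0} \<or> S = UNIV"
    using irr by (simp_all add: irreducible_representation_def)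
  from rep obtain B where fd: "finite_dimensional_vector_space s B"
    by (auto simp: representation_def)
  have lin: "Vector_Spaces.linear s s (\<rho> g)" if "g \<in> G" for g
    using rep that by (simp add: representation_def)
  have \<rho>1: "\<rho> (mat 1) = id" using rep by (simp add: representation_def)
  have \<rho>m: "\<rho> (g ** g') = \<rho> g \<circ> \<rho> g'" if "g \<in> G" "g' \<in> G" for g g'
    using rep that by (simp add: representation_def)
  have sub: "S = {0} \<or> S = UNIV"
    if "module.subspace s S" "\<And>g v. g \<in> G \<Longrightarrow> v \<in> S \<Longrightarrow> \<rho> g v \<in> S" for S
    using sub'[rule_format, of S] that by simp
  interpret finite_dimensional_vector_space s B by (rule fd)
  note Gd = matrix_groupD[OF G] and Nd = matrix_groupD[OF N(1)]
  have NG: "u \<in> G" if "u \<in> N" for u using that N(2) by blast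
  have \<rho>_simps: "\<rho> g (v + w) = \<rho> g v + \<rho> g w" "\<rho> g (s c v) = s c (\<rho> g v)" "\<rho> g 0 = 0"
    "\<rho> g (sum F A) = (\<Sum>i\<in>A. \<rho> g (F i))" if "g \<in> G" for g v w c F and A :: "('k^'n^'n) set"
  proof -
    interpret Vector_Spaces.linear s s "\<rho> g" by (rule lin[OF that])
    show "\<rho> g (v + w) = \<rho> g v + \<rho> g w" "\<rho> g (s c v) = s c (\<rho> g v)" "\<rho> g 0 = 0"
      "\<rho> g (sum F A) = (\<Sum>i\<in>A. \<rho> g (F i))" by (simp_all add: add scale zero sum)
  qed
  have \<omega>0: "\<omega> u \<noteq> 0" if "u \<in> N" for u
    using \<omega>(1)[of u "matrix_inv u"] that Nd(3,4)[OF that] \<omega>(2) by (auto simp: matrix_inv_right)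
  define e where "e v = (\<Sum>u\<in>N. s (inverse (\<omega> u)) (\<rho> u v))" for v
  have e_\<rho>: "e (\<rho> h v) = s (\<omega> h) (e v)" if h: "h \<in> N" for h v
  proof -
    have "s (\<omega> h) (e v) = (\<Sum>u\<in>N. s (\<omega> h) (s (inverse (\<omega> (u ** h))) (\<rho> (u ** h) v)))"
      unfolding e_def scale_sum_right [symmetric]
      by (rule arg_cong[of _ _ "s _"], rule sym,
        rule matrix_group_finite_sum_left(2)[OF N(1) h, of "\<lambda>u. s (inverse (\<omega> u)) (\<rho> u v)"])
    also have "\<dots> = e (\<rho> h v)" unfolding e_def
      by (rule sum.cong) (use h \<omega>0[OF h] in \<open>auto simp: \<omega> \<rho>m NG\<close>)
    finally show ?thesis by simp
  qed
  have \<rho>_e: "\<rho> h (e v) = s (\<omega> h) (e v)" if h: "h \<in> N" for h v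
  proof -
    have "s (\<omega> h) (e v) = (\<Sum>u\<in>N. s (\<omega> h) (s (inverse (\<omega> (h ** u))) (\<rho> (h ** u) v)))"
      unfolding e_def scale_sum_right [symmetric]
      by (rule arg_cong[of _ _ "s _"], rule sym,
        rule matrix_group_finite_sum_left(1)[OF N(1) h, of "\<lambda>u. s (inverse (\<omega> u)) (\<rho> u v)"])
    also have "\<dots> = \<rho> h (e v)" unfolding e_def \<rho>_simps(4)[OF NG[OF h]]
      by (rule sum.cong) (use h \<omega>0[OF h] in \<open>auto simp: \<omega> \<rho>m NG \<rho>_simps\<close>)
    finally show ?thesis by simp
  qed
  have e_simps: "e (v + w) = e v + e w" "e (s c v) = s c (e v)" "e 0 = 0" for v w c
    unfolding e_def
    by (simp_all add: \<rho>_simps NG scale_right_distrib sum.distrib scale_sum_right mult.commute)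
  have e_sum: "e (sum F A) = (\<Sum>i\<in>A. e (F i))" for F and A :: "('k^'n^'n) set"
    by (induct A rule: infinite_finite_induct) (simp_all add: e_simps)
  define q where "q = (of_nat (card N) :: complex)"
  have q0: "q \<noteq> 0" using Nd(1) by (auto simp: q_def card_eq_0_iff)
  have ee: "e (e v) = s q (e v)" for v
  proof -
    have "e (e v) = (\<Sum>u\<in>N. s (inverse (\<omega> u)) (s (\<omega> u) (e v)))"
      unfolding e_def[of "e v"] by (rule sum.cong) (simp_all add: \<rho>_e)
    also have "\<dots> = (\<Sum>u\<in>N. e v)" by (rule sum.cong) (simp_all add: \<omega>0)
    finally show ?thesis by (simp add: q_def sum_constant_scale)
  qed
  define T where "T g v = e (\<rho> g (e v))" for g v
  have T_left: "T (u ** g) v = s (\<omega> u) (T g v)" and T_right: "T (g ** u) v = s (\<omega> u) (T g v)"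
    if "u \<in> N" "g \<in> G" for u g v
    using that by (simp_all add: T_def \<rho>m NG e_\<rho> \<rho>_e \<rho>_simps e_simps)
  have T0: "T g v = 0" if "u \<in> N" "u' \<in> N" "u ** g = g ** u'" "\<omega> u \<noteq> \<omega> u'" "g \<in> G" for g u u' v
  proof -
    have "s (\<omega> u) (T g v) = s (\<omega> u') (T g v)"
      using that by (metis T_left T_right)
    then show ?thesis using that(4) by auto
  qed
  have T\<theta>: "T (\<theta> g) v = T g v" if g: "g \<in> G" for g v
  proof -
    from cond[OF g] consider
      (stable) u u' where "u \<in> N" "u' \<in> N" "\<theta> g = u ** g ** u'" "\<omega> u * \<omega> u' = 1"
      | (kill) u u' where "u \<in> N" "u' \<in> N" "u ** g = g ** u'" "\<omega> u \<noteq> \<omega> u'"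
      unfolding multiplicity_cond_def by blast
    then show ?thesis
    proof cases
      case stable
      then show ?thesis using g NG by (simp add: T_left T_right Gd mult.commute)
    next
      case kill
      \<comment> \<open>\<open>\<theta>\<close> turns the relation that kills \<open>T g\<close>
        into one of the same kind for \<open>\<theta> g\<close>, so both operators vanish.\<close>
      have "\<theta> u' ** \<theta> g = \<theta> g ** \<theta> u" using kill g NG by (metis \<theta>_mult)
      then have "T (\<theta> g) v = 0" using kill g \<theta>N \<theta>G by (intro T0[of "\<theta> u'" "\<theta> u"]) auto
      moreover have "T g v = 0" using kill g by (intro T0[of u u'])
      ultimately show ?thesis by simp
    qed
  qed
  have T_simps: "T g (v + w) = T g v + T g w" "T g (s c v) = s c (T g v)" if "g \<in> G" for g v w c
    using that by (simp_all add: T_def e_simps \<rho>_simps)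
  have TT: "T g (T h v) = s q (\<Sum>u\<in>N. s (inverse (\<omega> u)) (T (g ** u ** h) v))"
    if gh: "g \<in> G" "h \<in> G" for g h v
  proof -
    have "T g (T h v) = e (\<rho> g (s q (e (\<rho> h (e v)))))"
      unfolding T_def ee ..
    also have "\<dots> = s q (\<Sum>u\<in>N. s (inverse (\<omega> u)) (T (g ** u ** h) v))"
      unfolding e_def[of "\<rho> h (e v)"] T_def using gh
      by (simp add: \<rho>_simps e_simps e_sum \<rho>m NG Gd)
    finally show ?thesis .
  qed
  \<comment> \<open>By \<open>TT\<close> the product is a combination of the operators of the
    elements g u h. Replacing each by its image under \<open>\<theta>\<close>, which reverses the
    order and permutes N, gives the combination for the opposite product.\<close>
  have comm: "T g (T h v) = T h (T g v)" if gh: "g \<in> G" "h \<in> G" for g h v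
  proof -
    have bij: "bij_betw \<theta> N N" by (rule bij_betw_byWitness[of _ \<theta>]) (use \<theta>N in auto)
    have "(\<Sum>u\<in>N. s (inverse (\<omega> u)) (T (g ** u ** h) v)) =
        (\<Sum>u\<in>N. s (inverse (\<omega> (\<theta> u))) (T (\<theta> h ** \<theta> u ** \<theta> g) v))"
    proof (rule sum.cong[OF refl])
      fix u assume u: "u \<in> N"
      have "\<theta> (g ** u ** h) = \<theta> h ** \<theta> u ** \<theta> g"
        using gh u NG by (simp add: \<theta>_mult Gd matrix_mul_assoc)
      then have "T (g ** u ** h) v = T (\<theta> h ** \<theta> u ** \<theta> g) v"
        using T\<theta>[of "g ** u ** h" v] gh u NG by (simp add: Gd)
      then show "s (inverse (\<omega> u)) (T (g ** u ** h) v) =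
          s (inverse (\<omega> (\<theta> u))) (T (\<theta> h ** \<theta> u ** \<theta> g) v)"
        using u by (simp add: \<theta>N)
    qed
    also have "\<dots> = (\<Sum>u\<in>N. s (inverse (\<omega> u)) (T (\<theta> h ** u ** \<theta> g) v))"
      by (rule sum.reindex_bij_betw[OF bij, of "\<lambda>u. s (inverse (\<omega> u)) (T (\<theta> h ** u ** \<theta> g) v)"])
    finally have "T g (T h v) = T (\<theta> h) (T (\<theta> g) v)"
      using gh by (simp add: TT \<theta>G)
    then show ?thesis using gh by (simp add: T\<theta>)
  qed
  define E where "E = range e"
  have E_iff: "v \<in> E \<longleftrightarrow> e v = s q v" for v
  proof
    assume "v \<in> E" then show "e v = s q v" by (auto simp: E_def ee)
  next
    assume "e v = s q v"
    then have "e (s (inverse q) v) = v" using q0 by (simp add: e_simps)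
    then show "v \<in> E" unfolding E_def by (metis rangeI)
  qed
  have subE: "subspace E"
    by (rule subspaceI) (simp_all add: E_iff e_simps scale_right_distrib mult.commute)
  have TE: "T g v \<in> E" for g v by (simp add: T_def E_def)
  have span_orbit: "span {\<rho> h x |h. h \<in> G} = UNIV" if "x \<noteq> 0" for x
  proof -
    let ?W = "span {\<rho> h x |h. h \<in> G}"
    have "\<rho> g v \<in> ?W" if "g \<in> G" "v \<in> ?W" for g v
      using that(2)
    proof (induct rule: span_induct_alt)
      case base
      then show ?case using that by (simp add: \<rho>_simps span_zero)
    next
      case (step c y z)
      then obtain h where "h \<in> G" "y = \<rho> h x" by blast
      then have "\<rho> g y = \<rho> (g ** h) x" "g ** h \<in> G" using that by (simp_all add: \<rho>m Gd)
      then have "\<rho> g y \<in> ?W" by (auto intro: span_base)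
      then show ?case using step that by (simp add: \<rho>_simps span_add span_scale)
    qed
    with sub[of ?W] have "?W = {0} \<or> ?W = UNIV" by simp
    moreover have "x \<in> ?W" by (rule span_base) (use \<rho>1 Gd(1) in \<open>force intro!: exI[of _ "mat 1"]\<close>)
    ultimately show ?thesis using that by auto
  qed
  \<comment> \<open>By irreducibility the translates of x span the whole space; applying
    \<open>e\<close> shows that the vectors \<open>T h x\<close> span \<open>E\<close>.\<close>
  have generate_E: "v \<in> S" if S: "subspace S" and x: "x \<in> E" "x \<noteq> 0"
    and inv: "\<And>h. h \<in> G \<Longrightarrow> T h x \<in> S" and v: "v \<in> E" for S x v
  proof -
    have *: "e (\<rho> h x) \<in> S" if "h \<in> G" for h
    proof -
      have "T h x = s q (e (\<rho> h x))" using x(1) that by (simp add: T_def E_iff \<rho>_simps e_simps)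
      then have "e (\<rho> h x) = s (inverse q) (T h x)" using q0 by simp
      then show ?thesis using inv[OF that] S by (simp add: subspace_scale)
    qed
    have "e y \<in> S" if "y \<in> span {\<rho> h x |h. h \<in> G}" for y
      using that
    proof (induct rule: span_induct_alt)
      case base
      then show ?case using S by (simp add: e_simps subspace_0)
    next
      case (step c y z)
      then show ?case using S * by (auto simp: e_simps intro!: subspace_add subspace_scale)
    qed
    then have "e v \<in> S" using span_orbit[OF x(2)] by auto
    then have "s (inverse q) (e v) \<in> S" using S by (simp add: subspace_scale)
    then show ?thesis using v q0 by (simp add: E_iff)
  qed
  \<comment> \<open>An eigenspace of \<open>T g\<close> is stable under the commuting operators
    \<open>T h\<close>, so by \<open>generate_E\<close> it contains all of \<open>E\<close>.\<close>
  have scalar: "\<exists>c. \<forall>v\<in>E. T g v = s c v" if g: "g \<in> G" and w: "w \<in> E" "w \<noteq> 0" for g w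
  proof -
    have "Vector_Spaces.linear s s (T g)"
      unfolding Vector_Spaces.linear_iff using vector_space_axioms by (simp add: T_simps g)
    from eigenvector_exists[OF fd this subE TE w] obtain c x where x: "x \<in> E" "x \<noteq> 0" "T g x = s c x"
      by blast
    have "v \<in> {v. T g v = s c v}" if "v \<in> E" for v
    proof (rule generate_E[OF _ x(1,2) _ that])
      show "subspace {v. T g v = s c v}"
        using T_simps(2)[OF g, of 0 0]
        by (intro subspaceI) (auto simp: T_simps g scale_right_distrib mult.commute)
      fix h assume h: "h \<in> G"
      have "T g (T h x) = T h (T g x)" by (rule comm[OF g h])
      then show "T h x \<in> {v. T g v = s c v}" using x(3) h by (simp add: T_simps)
    qed
    then show ?thesis by auto
  qed
  have lp: "k (e v) = q * k v" "k (s c v) = c * k v" if k: "k \<in> Hom_char s N \<rho> \<omega>" for k v c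
  proof -
    have "Vector_Spaces.linear s (*) k" using k by (simp add: Hom_char_def)
    then interpret k: Vector_Spaces.linear s "(*)" k .
    show "k (s c v) = c * k v" by (rule k.scale)
    have "k (e v) = (\<Sum>u\<in>N. inverse (\<omega> u) * (\<omega> u * k v))"
      using k by (simp add: e_def k.sum k.scale Hom_char_def)
    also have "\<dots> = (\<Sum>u\<in>N. k v)" by (rule sum.cong) (simp_all add: \<omega>0)
    finally show "k (e v) = q * k v" by (simp add: q_def)
  qed
  obtain v0 where v0: "l v0 \<noteq> 0" using l(2) by auto
  let ?x = "e v0"
  have lx: "l ?x \<noteq> 0" using v0 q0 by (simp add: lp[OF l(1)])
  have x: "?x \<in> E" "?x \<noteq> 0" using lx lp(2)[OF l(1), of 0 0] by (auto simp: E_def)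
  \<comment> \<open>Since all \<open>T h\<close> are scalars on \<open>E\<close>, the span of one
    nonzero vector already contains the vectors that generate \<open>E\<close>.\<close>
  have line: "\<exists>c. v = s c ?x" if "v \<in> E" for v
  proof -
    have "v \<in> span {?x}"
      by (rule generate_E[OF subspace_span x _ that])
        (metis scalar[OF _ x] x(1) span_base span_scale singletonI)
    then show ?thesis by (auto simp: span_singleton)
  qed
  \<comment> \<open>A functional k of this type satisfies k (e v) = q k v, so its value at v is
    determined by \<open>e v\<close>, which lies on the line of \<open>?x\<close>.\<close>
  have "l' v = (l' ?x / l ?x) * l v" for v
  proof -
    obtain c where c: "e v = s c ?x" using line[of "e v"] by (auto simp: E_def)
    have "q * l' v = c * l' ?x" using lp(1)[OF l', of v] unfolding c lp(2)[OF l'] by simp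
    moreover have "q * l v = c * l ?x" using lp(1)[OF l(1), of v] unfolding c lp(2)[OF l(1)] by simp
    ultimately have "q * l' v * l ?x = l' ?x * (q * l v)" by (simp add: algebra_simps)
    then show ?thesis using q0 lx by (simp add: field_simps)
  qed
  then show ?thesis by blast
qed

section \<open>The parabolic subgroup of \<open>SO Q7\<close>\<close>

text \<open>Triangularity is measured by a rank function because the order of the index type is not
  the one wanted. A nontrivial permutation with nonzero product would raise the rank at some index
  and lower it nowhere, although the total rank is invariant under permutations.\<close>

lemma det_unitriangular_rank:
  fixes A :: "'k::comm_ring_1^'n^'n" and rk :: "'n \<Rightarrow> nat"
  assumes off: "\<And>i j. i \<noteq> j \<Longrightarrow> \<not> rk i < rk j \<Longrightarrow> A $ i $ j = 0" and diag: "\<And>i. A $ i $ i = 1"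
  shows "det A = 1"
proof -
  have "(\<Prod>i\<in>UNIV. A $ i $ p i) = 0" if p: "p permutes UNIV" "p \<noteq> id" for p
  proof (rule ccontr)
    assume "(\<Prod>i\<in>UNIV. A $ i $ p i) \<noteq> 0"
    then have nz: "A $ i $ p i \<noteq> 0" for i using prod_zero[of UNIV "\<lambda>i. A $ i $ p i"] by auto
    have rk: "p i = i \<or> rk i < rk (p i)" for i using off[of i "p i"] nz[of i] by (cases "i = p i") auto
    obtain i where "p i \<noteq> i" using p(2) by (auto simp: fun_eq_iff)
    with rk[of i] have "(\<Sum>i\<in>UNIV. rk i) < (\<Sum>i\<in>UNIV. rk (p i))"
      by (intro sum_strict_mono_ex1 ballI bexI[of _ i] finite) (metis rk le_refl less_imp_le, simp_all)
    moreover have "(\<Sum>i\<in>UNIV. rk (p i)) = (\<Sum>i\<in>UNIV. rk i)"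
      by (rule sum.reindex_bij_betw[OF permutes_imp_bij[OF p(1)]])
    ultimately show False by simp
  qed
  then have "det A = (\<Sum>p\<in>{id}. of_int (sign p) * (\<Prod>i\<in>UNIV. A $ i $ p i))"
    unfolding det_def by (intro sum.mono_neutral_right) (auto simp: permutes_id)
  then show ?thesis by (simp add: diag)
qed

text \<open>The rows outside the block are those of the identity, so only permutations of the image
  of \<open>\<iota>\<close> survive in the Leibniz sum.\<close>

lemma det_block:
  fixes A :: "'k::comm_ring_1^'n^'n" and b :: "'k^'m^'m"
  assumes \<iota>: "inj \<iota>" and b: "\<And>i j. A $ \<iota> i $ \<iota> j = b $ i $ j"
    and one: "\<And>i j. i \<notin> range \<iota> \<Longrightarrow> A $ i $ j = (if i = j then 1 else 0)"
  shows "det A = det b"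
proof -
  let ?T = "\<lambda>p. of_int (sign p) * (\<Prod>i\<in>UNIV. A $ i $ p i)"
  have bij: "bij_betw \<iota> UNIV (range \<iota>)" using \<iota> by (simp add: bij_betw_def)
  have "?T p = 0" if p: "p permutes UNIV" "\<not> p permutes range \<iota>" for p
  proof -
    have "\<exists>i. i \<notin> range \<iota> \<and> p i \<noteq> i"
      using permutes_superset[OF p(1), of "range \<iota>"] p(2) by blast
    then obtain i where "i \<notin> range \<iota>" "p i \<noteq> i" by blast
    then have "A $ i $ p i = 0" using one[of i "p i"] by auto
    then have "(\<Prod>i\<in>UNIV. A $ i $ p i) = 0" by (intro prod_zero) auto
    then show ?thesis by simp
  qed
  then have "det A = (\<Sum>p\<in>{p. p permutes range \<iota>}. ?T p)"
    unfolding det_def by (intro sum.mono_neutral_right)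
      (auto simp: finite_permutations intro: permutes_subset)
  also have "\<dots> = (\<Sum>p\<in>{p. p permutes (UNIV::'m set)}. ?T (map_permutation UNIV \<iota> p))"
  proof (rule sum.reindex_bij_betw[symmetric])
    have "map_permutation UNIV \<iota> = (\<lambda>\<pi> x. if x \<in> range \<iota> then \<iota> (\<pi> (inv_into UNIV \<iota> x)) else x)"
      by (simp add: map_permutation_def restrict_id_def fun_eq_iff)
    then show "bij_betw (map_permutation UNIV \<iota>) {p. p permutes UNIV} {p. p permutes range \<iota>}"
      using bij_betw_permutations[OF bij] by simp
  qed
  also have "\<dots> = det b" unfolding det_def
  proof (rule sum.cong[OF refl])
    fix p :: "'m \<Rightarrow> 'm" assume "p \<in> {p. p permutes UNIV}"
    then have p: "p permutes UNIV" by simp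
    let ?p = "map_permutation UNIV \<iota> p"
    have out: "?p i = i" if "i \<notin> range \<iota>" for i
      using that by (simp add: map_permutation_def restrict_id_def)
    have "(\<Prod>i\<in>UNIV. A $ i $ ?p i) = (\<Prod>i\<in>range \<iota>. A $ i $ ?p i)"
      by (rule prod.mono_neutral_right) (auto simp: out one)
    also have "\<dots> = (\<Prod>i\<in>UNIV. A $ \<iota> i $ ?p (\<iota> i))"
      by (rule prod.reindex[OF \<iota>, unfolded o_def])
    also have "\<dots> = (\<Prod>i\<in>UNIV. b $ i $ p i)"
      using \<iota> by (simp add: map_permutation_apply b)
    finally show "?T ?p = of_int (sign p) * (\<Prod>i\<in>UNIV. b $ i $ p i)"
      using sign_map_permutation[OF \<iota> p] by simp
  qed
  finally show ?thesis .
qed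

section \<open>The quadratic form and the inclusion of \<open>G2\<close> in
  \<open>SO Q7\<close>\<close>

definition q7 :: "'k::field^7 \<Rightarrow> 'k^7 \<Rightarrow> 'k" where
  "q7 x y = x$1*y$7 + x$2*y$6 - x$3*y$5 + 2*x$4*y$4 - x$5*y$3 + x$6*y$2 + x$7*y$1"

lemma q7_eq_sum: "q7 x y = (\<Sum>i\<in>UNIV. x $ i * (Q7 *v y) $ i)"
  by (subst vec7_eta[of y, symmetric], subst Q7_vec7) (simp add: q7_def sum_7 algebra_simps)

lemma sum_mult_transpose:
  fixes g :: "'k::field^'n^'m"
  shows "(\<Sum>i\<in>UNIV. (g *v x) $ i * z $ i) = (\<Sum>j\<in>UNIV. x $ j * (transpose g *v z) $ j)"
  unfolding matrix_vector_mult_def transpose_def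
  by (simp add: sum_distrib_left sum_distrib_right mult_ac) (rule sum.swap)

lemma sum_axis: "(\<Sum>j\<in>UNIV. axis i 1 $ j * z $ j) = (z $ i :: 'k::field)"
  by (simp add: axis_def if_distrib[of "\<lambda>x. x * _"] cong: if_cong)

lemma Q7_invariant_iff:
  "transpose g ** Q7 ** g = Q7 \<longleftrightarrow> (\<forall>x y. q7 (g *v x) (g *v y) = q7 x y)"
proof -
  have *: "q7 (g *v x) (g *v y) = (\<Sum>j\<in>UNIV. x $ j * ((transpose g ** Q7 ** g) *v y) $ j)" for x y
    by (simp add: q7_eq_sum sum_mult_transpose)
  have "transpose g ** Q7 ** g = Q7" if q: "\<And>x y. q7 (g *v x) (g *v y) = q7 x y"
    unfolding matrix_eq
  proof (intro allI vec_eq_iff[THEN iffD2])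
    fix y i
    have "(\<Sum>j\<in>UNIV. axis i 1 $ j * ((transpose g ** Q7 ** g) *v y) $ j) =
        (\<Sum>j\<in>UNIV. axis i 1 $ j * (Q7 *v y) $ j)"
      using q[of "axis i 1" y] *[of "axis i 1" y] q7_eq_sum[of "axis i 1" y] by (simp only:)
    then show "((transpose g ** Q7 ** g) *v y) $ i = (Q7 *v y) $ i"
      by (simp only: sum_axis)
  qed
  moreover have "q7 (g *v x) (g *v y) = q7 x y" if "transpose g ** Q7 ** g = Q7" for x y
    unfolding * that by (rule q7_eq_sum[symmetric])
  ultimately show ?thesis by blast
qed

lemma SO_Q7_iff: "g \<in> SO Q7 \<longleftrightarrow> (\<forall>x y. q7 (g *v x) (g *v y) = q7 x y) \<and> det g = 1"
  unfolding SO_def Q7_invariant_iff by simp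

lemma SO_Q7_q7: "g \<in> SO Q7 \<Longrightarrow> q7 (g *v x) (g *v y) = q7 x y"
  by (simp add: SO_Q7_iff)

lemma SO_det: "g \<in> SO S \<Longrightarrow> det g = 1"
  by (simp add: SO_def)

lemma matrix_group_SO: "matrix_group (SO (S :: 'k::field^'n^'n))"
  unfolding matrix_group_def
proof (intro conjI ballI)
  show "mat 1 \<in> SO S" by (simp add: SO_def transpose_mat)
next
  fix g g' assume g: "g \<in> SO S" "g' \<in> SO S"
  have "transpose (g ** g') ** S ** (g ** g') = transpose g' ** (transpose g ** S ** g) ** g'"
    by (simp add: matrix_transpose_mul matrix_mul_assoc)
  then show "g ** g' \<in> SO S" using g by (simp add: SO_def det_mul)
next
  fix g assume g: "g \<in> SO S"
  then show i: "invertible g" by (simp add: SO_def invertible_det_nz)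
  have t: "transpose (matrix_inv g) ** transpose g = mat 1"
    using i by (metis matrix_inv_right matrix_transpose_mul transpose_mat)
  have "transpose (matrix_inv g) ** (transpose g ** S ** g) ** matrix_inv g
      = (transpose (matrix_inv g) ** transpose g) ** S ** (g ** matrix_inv g)"
    by (simp add: matrix_mul_assoc)
  also have "\<dots> = S" using i by (simp add: t matrix_inv_right)
  finally have "transpose (matrix_inv g) ** S ** matrix_inv g = S" using g by (simp add: SO_def)
  moreover have "det (matrix_inv g) * det g = 1"
    using i by (metis det_I det_mul matrix_inv_left)
  ultimately show "matrix_inv g \<in> SO S" using g by (simp add: SO_def)
qed

lemma mult_SO [simp]: "g \<in> SO S \<Longrightarrow> g' \<in> SO S \<Longrightarrow> g ** g' \<in> SO (S :: 'k::field^'n^'n)"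
  and inv_SO [simp]: "g \<in> SO S \<Longrightarrow> matrix_inv g \<in> SO S"
  and one_SO [simp]: "mat 1 \<in> SO S"
  and invertible_SO: "g \<in> SO S \<Longrightarrow> invertible g"
  using matrix_groupD[OF matrix_group_SO] by blast+

text \<open>Position of the weight of each basis vector, counted from the highest. In this order the
  positive root elements are upper unitriangular.\<close>

definition rk7 :: "7 \<Rightarrow> nat" where
  "rk7 i = (if i = 5 then 0 else if i = 1 then 1 else if i = 2 then 2 else if i = 4 then 3
     else if i = 6 then 4 else if i = 7 then 5 else 6)"

lemma rk7_simps: "rk7 1 = 1" "rk7 2 = 2" "rk7 3 = 6" "rk7 4 = 3" "rk7 5 = 0" "rk7 6 = 4" "rk7 7 = 5"
  by (simp_all add: rk7_def)

lemma G2_subset_SO: "G2 \<subseteq> SO (Q7 :: 'k::field^7^7)"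
  unfolding G2_def
proof (rule generate_GL_subset[OF matrix_group_SO])
  have det: "det g = 1" if "\<forall>i j. i \<noteq> j \<longrightarrow> \<not> rk i < rk j \<longrightarrow> g $ i $ j = 0" "\<forall>i. g $ i $ i = 1"
    for g :: "'k^7^7" and rk :: "7 \<Rightarrow> nat"
    by (rule det_unitriangular_rank[of rk]) (use that in auto)
  have det_x: "det (x_a r) = 1" "det (x_b r) = 1" for r :: 'k
    by (rule det[of rk7], simp only: forall_7 rk7_simps, simp, simp add: x_a_def x_b_def mE_def mat_def,
        simp add: forall_7 x_a_def x_b_def mE_def mat_def)+
  \<comment> \<open>Reversing the order of weights makes the negative root elements upper
    unitriangular.\<close>
  have det_x': "det (x_neg_a r) = 1" "det (x_neg_b r) = 1" for r :: 'k
    by (rule det[of "\<lambda>i. 6 - rk7 i"], simp only: forall_7 rk7_simps, simp,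
        simp add: x_neg_a_def x_neg_b_def x_b_def mE_def mat_def transpose_def,
        simp add: forall_7 x_neg_a_def x_neg_b_def x_b_def mE_def mat_def transpose_def)+
  have vec7I: "\<forall>x y. q7 (g *v x) (g *v y) = q7 x y"
    if "\<And>v1 v2 v3 v4 v5 v6 v7 w1 w2 w3 w4 w5 w6 w7.
      q7 (g *v vec7 v1 v2 v3 v4 v5 v6 v7) (g *v vec7 w1 w2 w3 w4 w5 w6 w7) =
      q7 (vec7 v1 v2 v3 v4 v5 v6 v7) (vec7 w1 w2 w3 w4 w5 w6 w7)" for g :: "'k^7^7"
  proof (intro allI)
    fix x y
    show "q7 (g *v x) (g *v y) = q7 x y"
      using that[of "x$1" "x$2" "x$3" "x$4" "x$5" "x$6" "x$7" "y$1" "y$2" "y$3" "y$4" "y$5" "y$6" "y$7"]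
      by (simp only: vec7_eta)
  qed
  have "x_a r \<in> SO Q7" for r :: 'k
    unfolding SO_Q7_iff det_x
    by (rule conjI[OF vec7I refl], unfold x_a_vec7 q7_def vec7_nth, algebra)
  moreover have "x_neg_a r \<in> SO Q7" for r :: 'k
    unfolding SO_Q7_iff det_x'
    by (rule conjI[OF vec7I refl], unfold x_neg_a_vec7 q7_def vec7_nth, algebra)
  moreover have "x_b r \<in> SO Q7" for r :: 'k
    unfolding SO_Q7_iff det_x
    by (rule conjI[OF vec7I refl], unfold x_b_vec7 q7_def vec7_nth, algebra)
  moreover have "x_neg_b r \<in> SO Q7" for r :: 'k
    unfolding SO_Q7_iff det_x'
    by (rule conjI[OF vec7I refl], unfold x_neg_b_vec7 q7_def vec7_nth, algebra)
  ultimately show "range x_a \<union> range x_neg_a \<union> range x_b \<union> range x_neg_b \<subseteq> SO (Q7 :: 'k^7^7)" by auto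
qed

lemma vector_7 [simp]:
  "(vector [a1,a2,a3,a4,a5,a6,a7] :: 'a::zero^7) $ 1 = a1" "(vector [a1,a2,a3,a4,a5,a6,a7] :: 'a^7) $ 2 = a2"
  "(vector [a1,a2,a3,a4,a5,a6,a7] :: 'a^7) $ 3 = a3" "(vector [a1,a2,a3,a4,a5,a6,a7] :: 'a^7) $ 4 = a4"
  "(vector [a1,a2,a3,a4,a5,a6,a7] :: 'a^7) $ 5 = a5" "(vector [a1,a2,a3,a4,a5,a6,a7] :: 'a^7) $ 6 = a6"
  "(vector [a1,a2,a3,a4,a5,a6,a7] :: 'a^7) $ 7 = a7"
  by (simp_all add: vector_def)

text \<open>The shape of \<open>levi\<close> with a free last block, so that products, inverses and
  determinants can be taken block by block.\<close>

definition diag_blocks :: "'k::field^2^2 \<Rightarrow> 'k^3^3 \<Rightarrow> 'k^2^2 \<Rightarrow> 'k^7^7" where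
  "diag_blocks a b c = vector
    [vector [a$1$1, a$1$2, 0, 0, 0, 0, 0],
     vector [a$2$1, a$2$2, 0, 0, 0, 0, 0],
     vector [0, 0, b$1$1, b$1$2, b$1$3, 0, 0],
     vector [0, 0, b$2$1, b$2$2, b$2$3, 0, 0],
     vector [0, 0, b$3$1, b$3$2, b$3$3, 0, 0],
     vector [0, 0, 0, 0, 0, c$1$1, c$1$2],
     vector [0, 0, 0, 0, 0, c$2$1, c$2$2]]"

lemma levi_eq: "levi a b = diag_blocks a b (star a)"
  by (simp add: levi_def diag_blocks_def Let_def)

lemma diag_blocks_vec7 [simp]: "diag_blocks a b c *v vec7 v1 v2 v3 v4 v5 v6 v7 =
    vec7 (a$1$1 * v1 + a$1$2 * v2) (a$2$1 * v1 + a$2$2 * v2)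
      (b$1$1 * v3 + b$1$2 * v4 + b$1$3 * v5) (b$2$1 * v3 + b$2$2 * v4 + b$2$3 * v5)
      (b$3$1 * v3 + b$3$2 * v4 + b$3$3 * v5) (c$1$1 * v6 + c$1$2 * v7) (c$2$1 * v6 + c$2$2 * v7)"
  by (simp add: vec_eq_iff forall_7 matrix_vector_mult_def sum_7 diag_blocks_def)

lemma mat_1_small [simp]:
  "(mat 1 :: 'k::field^2^2) $ 1 $ 1 = 1" "(mat 1 :: 'k^2^2) $ 1 $ 2 = 0"
  "(mat 1 :: 'k^2^2) $ 2 $ 1 = 0" "(mat 1 :: 'k^2^2) $ 2 $ 2 = 1"
  "(mat 1 :: 'k^3^3) $ 1 $ 1 = 1" "(mat 1 :: 'k^3^3) $ 1 $ 2 = 0" "(mat 1 :: 'k^3^3) $ 1 $ 3 = 0"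
  "(mat 1 :: 'k^3^3) $ 2 $ 1 = 0" "(mat 1 :: 'k^3^3) $ 2 $ 2 = 1" "(mat 1 :: 'k^3^3) $ 2 $ 3 = 0"
  "(mat 1 :: 'k^3^3) $ 3 $ 1 = 0" "(mat 1 :: 'k^3^3) $ 3 $ 2 = 0" "(mat 1 :: 'k^3^3) $ 3 $ 3 = 1"
  by (simp_all add: mat_def)

lemma det_diag_blocks:
  fixes a c :: "'k::field^2^2" and b :: "'k^3^3"
  shows "det (diag_blocks a b c) = det a * det b * det c"
proof -
  \<comment> \<open>With one nontrivial block per factor, \<open>det_block\<close> applies to each
    factor.\<close>
  have eq: "diag_blocks a b c =
      diag_blocks a (mat 1) (mat 1) ** diag_blocks (mat 1) b (mat 1) ** diag_blocks (mat 1) (mat 1) c"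
    by (rule matrix_eq_vec7I) simp
  have inj2: "inj f \<longleftrightarrow> f 1 \<noteq> f 2" for f :: "2 \<Rightarrow> 7" by (auto simp: inj_def forall_2)
  have inj3: "inj f \<longleftrightarrow> f 1 \<noteq> f 2 \<and> f 1 \<noteq> f 3 \<and> f 2 \<noteq> f 3" for f :: "3 \<Rightarrow> 7" by (auto simp: inj_def forall_3)
  have ran2: "x \<notin> range f \<longleftrightarrow> x \<noteq> f 1 \<and> x \<noteq> f 2" for f :: "2 \<Rightarrow> 7" and x
    by (auto simp: image_iff forall_2)
  have ran3: "x \<notin> range f \<longleftrightarrow> x \<noteq> f 1 \<and> x \<noteq> f 2 \<and> x \<noteq> f 3" for f :: "3 \<Rightarrow> 7" and x
    by (auto simp: image_iff forall_3)
  have block2: "det A = det d" if "f 1 \<noteq> f 2" "\<forall>i j. A $ f i $ f j = d $ i $ j"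
    "\<forall>i j. i \<noteq> f 1 \<longrightarrow> i \<noteq> f 2 \<longrightarrow> A $ i $ j = (if i = j then 1 else 0)"
    for f :: "2 \<Rightarrow> 7" and A :: "'k^7^7" and d
    by (rule det_block[of f]) (use that in \<open>auto simp: inj2 ran2 simp del: rangeI\<close>)
  have block3: "det A = det d" if "f 1 \<noteq> f 2 \<and> f 1 \<noteq> f 3 \<and> f 2 \<noteq> f 3" "\<forall>i j. A $ f i $ f j = d $ i $ j"
    "\<forall>i j. i \<noteq> f 1 \<longrightarrow> i \<noteq> f 2 \<longrightarrow> i \<noteq> f 3 \<longrightarrow> A $ i $ j = (if i = j then 1 else 0)"
    for f :: "3 \<Rightarrow> 7" and A :: "'k^7^7" and d
    by (rule det_block[of f]) (use that in \<open>auto simp: inj3 ran3 simp del: rangeI\<close>)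
  have "det (diag_blocks a (mat 1) (mat 1)) = det a"
    by (rule block2[of "\<lambda>i. if i = 1 then 1 else 2"]) (simp_all add: forall_2 forall_7 diag_blocks_def)
  moreover have "det (diag_blocks (mat 1) (mat 1) c) = det c"
    by (rule block2[of "\<lambda>i. if i = 1 then 6 else 7"]) (simp_all add: forall_2 forall_7 diag_blocks_def)
  moreover have "det (diag_blocks (mat 1) b (mat 1)) = det b"
    by (rule block3[of "\<lambda>i. if i = 1 then 3 else if i = 2 then 4 else 5"])
      (simp_all add: forall_3 forall_7 diag_blocks_def)
  ultimately show ?thesis by (subst eq) (simp add: det_mul)
qed

lemma diag_blocks_mult: "diag_blocks a b c ** diag_blocks a' b' c' = diag_blocks (a ** a') (b ** b') (c ** c')"
  by (rule matrix_eq_vec7I, simp only: mv_assoc diag_blocks_vec7)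
    (simp add: matrix_matrix_mult_def sum_2 sum_3 algebra_simps)

lemma diag_blocks_1: "diag_blocks (mat 1) (mat 1) (mat 1) = mat 1"
  by (rule matrix_eq_vec7I) simp

definition J2 :: "'k::field^2^2" where
  "J2 = vector [vector [0, 1], vector [1, 0]]"

lemma star_eq: "star a = J2 ** transpose (matrix_inv a) ** J2"
  by (simp add: star_def J2_def Let_def)

lemma J2_J2: "J2 ** J2 = mat 1"
  by (simp add: vec_eq_iff forall_2 matrix_matrix_mult_def sum_2 J2_def)

lemma Q7_diag_blocks:
  assumes "transpose a ** J2 ** c = J2" "transpose b ** Q3 ** b = Q3"
  shows "transpose (diag_blocks a b c) ** Q7 ** diag_blocks a b c = Q7"
proof -
  have 2: "a$1$1 * c$2$1 + a$2$1 * c$1$1 = 0" "a$1$1 * c$2$2 + a$2$1 * c$1$2 = 1"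
    "a$1$2 * c$2$1 + a$2$2 * c$1$1 = 1" "a$1$2 * c$2$2 + a$2$2 * c$1$2 = 0"
    using assms(1)
    by (simp_all add: vec_eq_iff forall_2 matrix_matrix_mult_def sum_2 J2_def transpose_def add.commute)
  have 3: "2 * b$2$i * b$2$j - b$1$i * b$3$j - b$3$i * b$1$j = Q3 $ i $ j" for i j
    using arg_cong[OF assms(2), of "\<lambda>M. M $ i $ j"]
    by (simp add: matrix_matrix_mult_def sum_3 Q3_def transpose_def algebra_simps)
  have q: "q7 (diag_blocks a b c *v vec7 v1 v2 v3 v4 v5 v6 v7) (diag_blocks a b c *v vec7 w1 w2 w3 w4 w5 w6 w7) =
      q7 (vec7 v1 v2 v3 v4 v5 v6 v7) (vec7 w1 w2 w3 w4 w5 w6 w7)" for v1 v2 v3 v4 v5 v6 v7 w1 w2 w3 w4 w5 w6 w7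
  proof -
    let ?B = "\<lambda>i j. 2 * b$2$i * b$2$j - b$1$i * b$3$j - b$3$i * b$1$j"
    have "q7 (diag_blocks a b c *v vec7 v1 v2 v3 v4 v5 v6 v7) (diag_blocks a b c *v vec7 w1 w2 w3 w4 w5 w6 w7) =
      (v1 * w6 + w1 * v6) * (a$1$1 * c$2$1 + a$2$1 * c$1$1) + (v1 * w7 + w1 * v7) * (a$1$1 * c$2$2 + a$2$1 * c$1$2) +
      (v2 * w6 + w2 * v6) * (a$1$2 * c$2$1 + a$2$2 * c$1$1) + (v2 * w7 + w2 * v7) * (a$1$2 * c$2$2 + a$2$2 * c$1$2) +
      (v3 * w3 * ?B 1 1 + v3 * w4 * ?B 1 2 + v3 * w5 * ?B 1 3 + v4 * w3 * ?B 2 1 + v4 * w4 * ?B 2 2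
       + v4 * w5 * ?B 2 3 + v5 * w3 * ?B 3 1 + v5 * w4 * ?B 3 2 + v5 * w5 * ?B 3 3)"
      unfolding diag_blocks_vec7 q7_def vec7_nth by algebra
    then show ?thesis unfolding 2 3 by (simp add: Q3_def q7_def algebra_simps)
  qed
  have "q7 (diag_blocks a b c *v x) (diag_blocks a b c *v y) = q7 x y" for x y
    using q[of "x$1" "x$2" "x$3" "x$4" "x$5" "x$6" "x$7" "y$1" "y$2" "y$3" "y$4" "y$5" "y$6" "y$7"]
    by (simp only: vec7_eta)
  then show ?thesis unfolding Q7_invariant_iff by blast
qed

lemma Q7_levi:
  assumes "invertible a" "b \<in> SO Q3"
  shows "levi a b \<in> SO Q7" "matrix_inv (levi a b) = diag_blocks (matrix_inv a) (matrix_inv b) (matrix_inv (star a))"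
proof -
  have iT: "transpose a ** transpose (matrix_inv a) = mat 1"
    using assms(1) by (metis matrix_inv_left matrix_transpose_mul transpose_mat)
  have "transpose a ** J2 ** star a = transpose a ** (J2 ** J2) ** transpose (matrix_inv a) ** J2"
    by (simp only: star_eq matrix_mul_assoc)
  also have "\<dots> = J2" by (simp add: J2_J2 iT)
  finally have a: "transpose a ** J2 ** star a = J2" .
  have "transpose (levi a b) ** Q7 ** levi a b = Q7"
    unfolding levi_eq by (rule Q7_diag_blocks[OF a]) (use assms in \<open>simp add: SO_def\<close>)
  moreover have "det (matrix_inv a) * det a = 1"
    using assms(1) by (metis det_I det_mul matrix_inv_left)
  moreover have "det (J2 :: 'a^2^2) = - 1" by (simp add: det_2 J2_def)
  ultimately show "levi a b \<in> SO Q7"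
    unfolding SO_def levi_eq using SO_det[OF assms(2)]
    by (simp add: det_diag_blocks star_eq det_mul mult.commute)
  have "star a ** (J2 ** transpose a ** J2) = J2 ** (transpose (matrix_inv a) ** (J2 ** J2) ** transpose a) ** J2"
    by (simp only: star_eq matrix_mul_assoc)
  also have "\<dots> = mat 1" using assms(1)
    by (simp add: J2_J2) (metis J2_J2 matrix_inv_right matrix_mul_rid matrix_transpose_mul transpose_mat)
  finally have "invertible (star a)" by (rule invertibleI)
  then show "matrix_inv (levi a b) = diag_blocks (matrix_inv a) (matrix_inv b) (matrix_inv (star a))"
    using assms invertible_SO[OF assms(2)]
    by (intro matrix_inv_eqI) (simp add: levi_eq diag_blocks_mult matrix_inv_right diag_blocks_1)
qed

section \<open>Block upper triangular matrices and the stabiliser of a plane\<close>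

definition block_strict :: "'k::field^7^7 \<Rightarrow> bool" where
  "block_strict A \<longleftrightarrow> (\<forall>i j. \<not> block i < block j \<longrightarrow> A $ i $ j = 0)"

definition block_upper :: "'k::field^7^7 \<Rightarrow> bool" where
  "block_upper A \<longleftrightarrow> (\<forall>i j. \<not> block i \<le> block j \<longrightarrow> A $ i $ j = 0)"

text \<open>Strictly block upper matrices absorb block upper ones on both sides. As
  \<open>U_tilde\<close> consists of the orthogonal matrices in 1 plus this ideal, its stability
  under Levi conjugation and translation becomes formal.\<close>

lemma block_strict_mult:
  assumes "block_upper A"
  shows "block_strict N \<Longrightarrow> block_strict (A ** N)" "block_strict N \<Longrightarrow> block_strict (N ** A)"
proof -
  show "block_strict (A ** N)" if N: "block_strict N" unfolding block_strict_def
  proof (intro allI impI)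
    fix i j assume ij: "\<not> block i < block j"
    have "A $ i $ k * N $ k $ j = 0" for k
      using N assms ij unfolding block_strict_def block_upper_def
      by (cases "block i \<le> block k") auto
    then have "(\<Sum>k\<in>UNIV. A $ i $ k * N $ k $ j) = 0" by (intro sum.neutral) blast
    then show "(A ** N) $ i $ j = 0" by (simp only: matrix_matrix_mult_def vec_lambda_beta)
  qed
  show "block_strict (N ** A)" if N: "block_strict N" unfolding block_strict_def
  proof (intro allI impI)
    fix i j assume ij: "\<not> block i < block j"
    have "N $ i $ k * A $ k $ j = 0" for k
      using N assms ij unfolding block_strict_def block_upper_def
      by (cases "block k \<le> block j") auto
    then have "(\<Sum>k\<in>UNIV. N $ i $ k * A $ k $ j) = 0" by (intro sum.neutral) blast
    then show "(N ** A) $ i $ j = 0" by (simp only: matrix_matrix_mult_def vec_lambda_beta)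
  qed
qed

lemma U_tilde_iff: "u \<in> U_tilde \<longleftrightarrow> u \<in> SO Q7 \<and> block_strict (u - mat 1)"
proof -
  have "(block j < block i \<longrightarrow> u $ i $ j = 0) \<and> (block i = block j \<longrightarrow> u $ i $ j = (if i = j then 1 else 0))
    \<longleftrightarrow> (\<not> block i < block j \<longrightarrow> (u - mat 1) $ i $ j = 0)" for i j
    by (cases "block j < block i") (auto simp: mat_def)
  then show ?thesis unfolding U_tilde_def block_strict_def by simp
qed

lemma block_upper_add: "block_upper A \<Longrightarrow> block_upper B \<Longrightarrow> block_upper (A + B)"
  by (simp add: block_upper_def)

lemma U_tilde_upper:
  assumes "u \<in> U_tilde"
  shows "block_upper u"
proof -
  have "block_strict (u - mat 1)" using assms by (simp add: U_tilde_iff)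
  then have "block_upper (u - mat 1)" by (auto simp: block_strict_def block_upper_def)
  moreover have "block_upper (mat 1 :: 'a^7^7)" by (auto simp: block_upper_def mat_def)
  ultimately have "block_upper ((u - mat 1) + mat 1)" by (rule block_upper_add)
  then show ?thesis by simp
qed

lemma block_strict_add: "block_strict A \<Longrightarrow> block_strict B \<Longrightarrow> block_strict (A + B)"
  by (simp add: block_strict_def)

lemma matrix_diff_mult:
  fixes A B C :: "'k::field^'n^'n"
  shows "(A - B) ** C = A ** C - B ** C" "C ** (A - B) = C ** A - C ** B"
  by (simp_all add: matrix_matrix_mult_def vec_eq_iff left_diff_distrib right_diff_distrib sum_subtractf)

lemma block_upper_diag_blocks: "block_upper (diag_blocks a b c)"
  unfolding block_upper_def by (simp only: forall_7) (simp add: block_def diag_blocks_def)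

text \<open>\<open>P_tilde\<close> is the stabiliser in \<open>SO Q7\<close> of the isotropic plane spanned by the first two
  basis vectors, and \<open>res2\<close> is its action on that plane.\<close>

definition P_tilde :: "('k::field^7^7) set" where
  "P_tilde = {p \<in> SO Q7. \<forall>i. i \<noteq> 1 \<longrightarrow> i \<noteq> 2 \<longrightarrow> p $ i $ 1 = 0 \<and> p $ i $ 2 = 0}"

definition res2 :: "'k::field^7^7 \<Rightarrow> 'k^2^2" where
  "res2 p = vector [vector [p $ 1 $ 1, p $ 1 $ 2], vector [p $ 2 $ 1, p $ 2 $ 2]]"

lemma vector_mat_1: "vector [vector [1, 0], vector [0, 1]] = (mat 1 :: 'k::field^2^2)"
  by (simp add: vec_eq_iff forall_2)

lemma P_tildeI:
  assumes "p \<in> SO Q7" "p *v e1 = vec7 a b 0 0 0 0 0" "p *v e2 = vec7 c d 0 0 0 0 0"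
  shows "p \<in> P_tilde" "res2 p = vector [vector [a, c], vector [b, d]]"
proof -
  have "p $ i $ 1 = vec7 a b 0 0 0 0 0 $ i" "p $ i $ 2 = vec7 c d 0 0 0 0 0 $ i" for i
    using assms(2,3) by (metis mult_vec7_basis(1), metis mult_vec7_basis(2))
  then show "p \<in> P_tilde" "res2 p = vector [vector [a, c], vector [b, d]]"
    using assms(1) by (simp_all add: P_tilde_def forall_7 res2_def)
qed

lemma P_tilde_entries:
  assumes "p \<in> P_tilde"
  shows "p$3$1 = 0" "p$4$1 = 0" "p$5$1 = 0" "p$6$1 = 0" "p$7$1 = 0"
    "p$3$2 = 0" "p$4$2 = 0" "p$5$2 = 0" "p$6$2 = 0" "p$7$2 = 0"
  using assms by (simp_all add: P_tilde_def)

text \<open>An isometry that preserves the plane also preserves its orthogonal complement, so p is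
  block upper triangular. The form pairs the first block with the last, which must then be
  \<open>star\<close> of the first, and the middle block preserves \<open>Q3\<close>. Dividing by
  the block diagonal part leaves u.\<close>

lemma P_tilde_levi:
  fixes p :: "'k::field^7^7"
  assumes "p \<in> P_tilde" and char: "(2::'k) \<noteq> 0"
  shows "invertible (res2 p)" "\<exists>b\<in>SO Q3. \<exists>u\<in>U_tilde. p = levi (res2 p) b ** u"
proof -
  note z = P_tilde_entries[OF assms(1)]
  have SO: "p \<in> SO Q7" using assms by (simp add: P_tilde_def)
  let ?a = "res2 p"
  let ?c = "vector [vector [p$6$6, p$6$7], vector [p$7$6, p$7$7]] :: 'k^2^2"
  let ?b = "vector [vector [p$3$3, p$3$4, p$3$5], vector [p$4$3, p$4$4, p$4$5], vector [p$5$3, p$5$4, p$5$5]] :: 'k^3^3"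
  have orth: "q7 (\<chi> k. p $ k $ i) (\<chi> k. p $ k $ j) = (Q7 :: 'k^7^7) $ i $ j" for i j
  proof -
    have col: "p *v axis i 1 = (\<chi> k. p $ k $ i)" for i
      by (simp add: vec_eq_iff matrix_vector_mult_def axis_def if_distrib cong: if_cong)
    have "q7 (p *v axis i 1) (p *v axis j 1) = q7 (axis i 1) (axis j (1::'k))" by (rule SO_Q7_q7[OF SO])
    also have "\<dots> = (Q7 :: 'k^7^7) $ i $ j" unfolding q7_eq_sum sum_axis
      by (simp add: matrix_vector_mult_def axis_def if_distrib cong: if_cong)
    finally show ?thesis unfolding col .
  qed
  have Q7_row: "(Q7 :: 'k^7^7) $ 1 $ j = (if j = 7 then 1 else 0)" "(Q7 :: 'k^7^7) $ 2 $ j = (if j = 6 then 1 else 0)" for j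
    by (simp_all add: Q7_def mE_def)
  have r1: "p$1$1 * p$7$j + p$2$1 * p$6$j = (if j = 7 then 1 else 0)" for j
    using orth[of 1 j] by (simp add: q7_def z Q7_row)
  have r2: "p$1$2 * p$7$j + p$2$2 * p$6$j = (if j = 6 then 1 else 0)" for j
    using orth[of 2 j] by (simp add: q7_def z Q7_row)
  have ac: "transpose ?a ** J2 ** ?c = J2"
    using r1[of 6] r1[of 7] r2[of 6] r2[of 7]
    by (simp add: vec_eq_iff forall_2 matrix_matrix_mult_def sum_2 J2_def transpose_def res2_def algebra_simps)
  have "transpose ?a ** (J2 ** ?c ** J2) = mat 1"
    by (simp add: matrix_mul_assoc ac J2_J2)
  then have "(J2 ** ?c ** J2) ** transpose ?a = mat 1" by (simp add: matrix_left_right_inverse)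
  then have "transpose ((J2 ** ?c ** J2) ** transpose ?a) = mat 1" by (simp add: transpose_mat)
  then have ai: "?a ** transpose (J2 ** ?c ** J2) = mat 1" by (simp add: matrix_transpose_mul)
  show ia: "invertible ?a" by (rule invertibleI[OF ai])
  have inva: "matrix_inv ?a = transpose (J2 ** ?c ** J2)" by (rule matrix_inv_eqI[OF ai])
  have c: "?c = star ?a"
  proof -
    have "star ?a = (J2 ** J2) ** ?c ** (J2 ** J2)" by (simp add: star_eq inva matrix_mul_assoc)
    then show ?thesis by (simp add: J2_J2)
  qed
  \<comment> \<open>For each column j, \<open>r1\<close> and \<open>r2\<close> are linear equations
    for the entries (6,j) and (7,j). Up to sign their determinant is that of \<open>res2 p\<close>,
    and they are homogeneous unless j is 6 or 7.\<close>
  have low: "p$6$j = 0" "p$7$j = 0" if "j \<noteq> 6" "j \<noteq> 7" for j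
  proof -
    have "det ?a \<noteq> 0" using ia by (simp add: invertible_det_nz)
    then have d: "p$1$1 * p$2$2 - p$1$2 * p$2$1 \<noteq> 0" by (simp add: det_2 res2_def)
    have "(p$1$1 * p$2$2 - p$1$2 * p$2$1) * p$6$j =
        p$1$1 * (p$1$2 * p$7$j + p$2$2 * p$6$j) - p$1$2 * (p$1$1 * p$7$j + p$2$1 * p$6$j)"
      by (simp add: algebra_simps)
    also have "\<dots> = 0" using that by (simp add: r1 r2)
    finally show "p$6$j = 0" using d by simp
    have "(p$1$1 * p$2$2 - p$1$2 * p$2$1) * p$7$j =
        p$2$2 * (p$1$1 * p$7$j + p$2$1 * p$6$j) - p$2$1 * (p$1$2 * p$7$j + p$2$2 * p$6$j)"
      by (simp add: algebra_simps)
    also have "\<dots> = 0" using that by (simp add: r1 r2)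
    finally show "p$7$j = 0" using d by simp
  qed
  have b: "transpose ?b ** Q3 ** ?b = Q3"
    using orth[of 3 3] orth[of 3 4] orth[of 3 5] orth[of 4 3] orth[of 4 4] orth[of 4 5]
      orth[of 5 3] orth[of 5 4] orth[of 5 5]
    by (simp add: vec_eq_iff forall_3 matrix_matrix_mult_def sum_3 Q3_def transpose_def q7_def low
        Q7_def mE_def algebra_simps)
  have "det ?b * det (Q3 :: 'k^3^3) * det ?b = det (Q3 :: 'k^3^3)"
    using arg_cong[OF b, of det] by (simp add: det_mul del: vector_3)
  moreover have "det (Q3 :: 'k^3^3) \<noteq> 0" using char by (simp add: det_3 Q3_def)
  ultimately have ib: "invertible ?b" unfolding invertible_det_nz by auto
  have ic: "invertible ?c"
    using ac by (metis c det_I det_mul invertible_det_nz J2_J2 mult_eq_0_iff one_neq_zero)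
  let ?L = "diag_blocks ?a ?b ?c" and ?K = "diag_blocks (matrix_inv ?a) (matrix_inv ?b) (matrix_inv ?c)"
  have KL: "?K ** ?L = mat 1" and LK: "?L ** ?K = mat 1"
    by (simp_all only: diag_blocks_mult matrix_inv_left matrix_inv_right ia ib ic diag_blocks_1)
  define u where "u = ?K ** p"
  have Lu: "p = ?L ** u" unfolding u_def matrix_mul_assoc LK matrix_mul_lid ..
  have bl: "block 1 = 1" "block 2 = 1" "block 3 = 2" "block 4 = 2" "block 5 = 2" "block 6 = 3" "block 7 = 3"
    by (simp_all add: block_def)
  have low': "p$6$3 = 0" "p$6$4 = 0" "p$6$5 = 0" "p$7$3 = 0" "p$7$4 = 0" "p$7$5 = 0"
    by (rule low; simp)+
  have "block_strict (p - ?L)"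
    unfolding block_strict_def by (simp only: forall_7 bl) (simp add: z low' diag_blocks_def res2_def)
  then have "block_strict (?K ** (p - ?L))" by (rule block_strict_mult(1)[OF block_upper_diag_blocks])
  then have strict: "block_strict (u - mat 1)" by (simp only: matrix_diff_mult u_def KL)
  have "det u = 1"
  proof (rule det_unitriangular_rank[of block])
    have u1: "(u - mat 1) $ i $ j = 0" if "\<not> block i < block j" for i j
      using strict that by (simp add: block_strict_def)
    show "u $ i $ j = 0" if "i \<noteq> j" "\<not> block i < block j" for i j
      using u1[OF that(2)] that(1) by (simp add: mat_def)
    show "u $ i $ i = 1" for i using u1[of i i] by (simp add: mat_def)
  qed
  \<comment> \<open>Preserving \<open>Q3\<close> determines the determinant of the middle block only
    up to sign; comparison with det p = 1 fixes the sign.\<close>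
  then have "det ?a * det ?b * det ?c = 1"
    using SO_det[OF SO] arg_cong[OF Lu, of det] by (simp only: det_mul det_diag_blocks mult_1_right)
  moreover have "det ?a * det ?c = 1"
  proof -
    have J: "det (J2 :: 'k^2^2) = - 1" by (simp add: det_2 J2_def)
    have "det ?a * det (J2 :: 'k^2^2) * det ?c = det (J2 :: 'k^2^2)"
      using arg_cong[OF ac, of det] by (simp only: det_mul det_transpose)
    moreover have "x * (- 1) * y = - 1 \<Longrightarrow> x * y = 1" for x y :: 'k by simp
    ultimately show ?thesis unfolding J by blast
  qed
  moreover have "x * y * z = 1 \<Longrightarrow> x * z = 1 \<Longrightarrow> y = 1" for x y z :: 'k
    by (metis mult.commute mult.left_commute mult_1_right)
  ultimately have "det ?b = 1" by blast
  then have bSO: "?b \<in> SO Q3" using b unfolding SO_def by blast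
  have p_eq: "p = levi ?a ?b ** u" using Lu unfolding levi_eq c .
  have "u = matrix_inv (levi ?a ?b) ** p"
    using arg_cong[OF p_eq, of "\<lambda>x. matrix_inv (levi ?a ?b) ** x"]
      matrix_inv_cancel(1)[OF invertible_SO[OF Q7_levi(1)[OF ia bSO]], of u] by (simp only:)
  then have "u \<in> SO Q7" using Q7_levi(1)[OF ia bSO] SO by simp
  with strict have "u \<in> U_tilde" by (simp add: U_tilde_iff)
  with p_eq bSO show "\<exists>b\<in>SO Q3. \<exists>u\<in>U_tilde. p = levi ?a b ** u" by blast
qed

lemma P_tilde_mult:
  assumes "p \<in> P_tilde" "p' \<in> P_tilde"
  shows "p ** p' \<in> P_tilde" "res2 (p ** p') = res2 p ** res2 p'"
proof -
  note z = P_tilde_entries[OF assms(1)] P_tilde_entries[OF assms(2)]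
  have "\<forall>i. i \<noteq> 1 \<longrightarrow> i \<noteq> 2 \<longrightarrow> (p ** p') $ i $ 1 = 0 \<and> (p ** p') $ i $ 2 = 0"
    by (simp add: forall_7 matrix_matrix_mult_def sum_7 z)
  then show "p ** p' \<in> P_tilde" using assms by (auto simp: P_tilde_def)
  show "res2 (p ** p') = res2 p ** res2 p'"
    by (simp add: res2_def matrix_matrix_mult_def sum_7 sum_2 vec_eq_iff forall_2 z)
qed

lemma P_tilde_inv:
  fixes p :: "'k::field^7^7"
  assumes p: "p \<in> P_tilde" and char: "(2::'k) \<noteq> 0"
  shows "matrix_inv p \<in> P_tilde"
proof -
  let ?A = "matrix_inv (res2 p)"
  have i: "invertible p" "p \<in> SO Q7" using p invertible_SO by (auto simp: P_tilde_def)
  have r: "res2 p ** ?A = mat 1" by (rule matrix_inv_right[OF P_tilde_levi(1)[OF p char]])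
  have lin: "p *v vec7 x y 0 0 0 0 0 = vec7 (p$1$1 * x + p$1$2 * y) (p$2$1 * x + p$2$2 * y) 0 0 0 0 0" for x y
    using P_tilde_entries[OF p] by (simp add: vec_eq_iff forall_7 matrix_vector_mult_def sum_7)
  have "p *v vec7 (?A$1$1) (?A$2$1) 0 0 0 0 0 = e1" "p *v vec7 (?A$1$2) (?A$2$2) 0 0 0 0 0 = e2"
    using r by (simp_all add: lin vec_eq_iff forall_2 matrix_matrix_mult_def sum_2 res2_def)
  then have "matrix_inv p *v e1 = vec7 (?A$1$1) (?A$2$1) 0 0 0 0 0"
    "matrix_inv p *v e2 = vec7 (?A$1$2) (?A$2$2) 0 0 0 0 0"
    using matrix_inv_cancel_vec(1)[OF i(1)] by metis+
  then show ?thesis using i by (intro P_tildeI(1)) simp_all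
qed

text \<open>Equivariance restated for the stabiliser of the plane: to apply it, only the first two
  columns of an orthogonal matrix have to be known.\<close>

lemma Ind_P_tilde:
  fixes \<tau> :: "'k::field^2^2 \<Rightarrow> 'v \<Rightarrow> 'v"
  assumes "\<xi> \<in> Ind \<tau>" "p \<in> P_tilde" "g \<in> SO Q7" and char: "(2::'k) \<noteq> 0"
  shows "\<xi> (p ** g) = \<tau> (res2 p) (\<xi> g)"
proof -
  obtain b u where bu: "b \<in> SO Q3" "u \<in> U_tilde" and p: "p = levi (res2 p) b ** u"
    using P_tilde_levi(2)[OF assms(2) char] by blast
  have "\<forall>a\<in>carrier GL. \<forall>b\<in>SO Q3. \<forall>u\<in>U_tilde. \<forall>g\<in>SO Q7. \<xi> (levi a b ** u ** g) = \<tau> a (\<xi> g)"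
    using assms(1) by (simp add: Ind_def)
  then have "\<xi> (levi (res2 p) b ** u ** g) = \<tau> (res2 p) (\<xi> g)"
    using P_tilde_levi(1)[OF assms(2) char] bu assms(3) by (simp add: carrier_GL)
  then show ?thesis by (simp only: p[symmetric])
qed

section \<open>Orbits on isotropic planes\<close>

text \<open>Transitivity on isotropic lines. A Weyl element makes the lowest weight coordinate,
  number 3, nonzero; five positive root subgroups clear coordinates 7, 6, 4, 2, 1 against it;
  isotropy forces coordinate 5 to vanish; and a last Weyl word carries coordinate 3 to coordinate
  5.\<close>

lemma G2_isotropic_transitive:
  fixes v :: "'k::field^7"
  assumes char: "(2::'k) \<noteq> 0" and v: "v \<noteq> 0" "q7 v v = 0"
  shows "\<exists>g\<in>G2. \<exists>c. c \<noteq> 0 \<and> g *v v = vec7 0 0 0 0 c 0 0"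
proof -
  let ?P = "\<lambda>v. \<exists>g\<in>G2. \<exists>c. c \<noteq> 0 \<and> g *v v = vec7 0 0 0 0 c 0 (0::'k)"
  have step: "?P v" if g: "g \<in> G2" and P: "?P (g *v v)" for g v
  proof -
    obtain g' c where "g' \<in> G2" "c \<noteq> 0" "(g' ** g) *v v = vec7 0 0 0 0 c 0 0"
      using P by auto
    then show ?thesis using mult_G2[OF _ g] by blast
  qed
  have P3: "?P (vec7 v1 v2 v3 v4 v5 v6 v7)"
    if nz: "v3 \<noteq> 0" and iso: "q7 (vec7 v1 v2 v3 v4 v5 v6 v7) (vec7 v1 v2 v3 v4 v5 v6 v7) = 0"
    for v1 v2 v3 v4 v5 v6 v7 :: 'k
  proof -
    \<comment> \<open>The clearing is stacked backwards: from \<open>A\<close> to \<open>E\<close>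
      each statement admits further nonzero coordinates and is reduced to the preceding one by one
      group element.\<close>
    have A: "?P (vec7 0 0 v3 0 0 0 0)"
    proof (intro bexI exI conjI)
      show "(w_a ** w_b ** w_a ** w_b ** w_a) *v vec7 0 0 v3 0 0 0 0 = vec7 0 0 0 0 v3 0 0" by simp
    qed (use nz in auto)
    have B: "?P (vec7 v1 0 v3 0 x 0 0)" if "q7 (vec7 v1 0 v3 0 x 0 0) (vec7 v1 0 v3 0 x 0 0) = 0" for v1 x
    proof (rule step[of "x_3a2b (- v1 / v3)"])
      have "2 * (v3 * x) = 0" using that by (simp add: q7_def algebra_simps)
      then have "x = 0" using nz char by simp
      then show "?P (x_3a2b (- v1 / v3) *v vec7 v1 0 v3 0 x 0 0)" using A nz by simp
    qed simp
    have inv: "q7 (g *v u) (g *v u) = 0" if "q7 u u = 0" "g \<in> G2" for g and u :: "'k^7"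
      using that SO_Q7_q7[of g u u] G2_subset_SO by auto
    have C: "?P (vec7 v1 v2 v3 0 x 0 0)" if "q7 (vec7 v1 v2 v3 0 x 0 0) (vec7 v1 v2 v3 0 x 0 0) = 0" for v1 v2 x
    proof (rule step[of "x_3ab (- v2 / v3)"])
      show "?P (x_3ab (- v2 / v3) *v vec7 v1 v2 v3 0 x 0 0)"
        using inv[OF that, of "x_3ab (- v2 / v3)"] B nz by simp
    qed simp
    have D: "?P (vec7 v1 v2 v3 v4 x 0 0)" if "q7 (vec7 v1 v2 v3 v4 x 0 0) (vec7 v1 v2 v3 v4 x 0 0) = 0" for v1 v2 v4 x
    proof (rule step[of "x_2ab (v4 / v3)"])
      show "?P (x_2ab (v4 / v3) *v vec7 v1 v2 v3 v4 x 0 0)"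
        using inv[OF that, of "x_2ab (v4 / v3)"] C nz by simp
    qed simp
    have E: "?P (vec7 v1 v2 v3 v4 x v6 0)" if "q7 (vec7 v1 v2 v3 v4 x v6 0) (vec7 v1 v2 v3 v4 x v6 0) = 0" for v1 v2 v4 x v6
    proof (rule step[of "x_ab (- v6 / v3)"])
      show "?P (x_ab (- v6 / v3) *v vec7 v1 v2 v3 v4 x v6 0)"
        using inv[OF that, of "x_ab (- v6 / v3)"] D nz by simp
    qed simp
    show ?thesis
    proof (rule step[of "x_a (v7 / v3)"])
      show "?P (x_a (v7 / v3) *v vec7 v1 v2 v3 v4 v5 v6 v7)"
        using inv[OF iso, of "x_a (v7 / v3)"] E nz by simp
    qed simp
  qed
  have inv: "q7 (g *v u) (g *v u) = 0" if "q7 u u = 0" "g \<in> G2" for g and u :: "'k^7"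
    using that SO_Q7_q7[of g u u] G2_subset_SO by auto
  have P3': "?P u" if "u $ 3 \<noteq> 0" "q7 u u = 0" for u :: "'k^7"
    using P3[of "u$3" "u$1" "u$2" "u$4" "u$5" "u$6" "u$7"] that by (simp add: vec7_eta)
  have "\<exists>g\<in>G2. (g *v v) $ 3 \<noteq> 0"
  proof -
    let ?v = "vec7 (v$1) (v$2) (v$3) (v$4) (v$5) (v$6) (v$7)"
    \<comment> \<open>Coordinate 4 has weight 0 and cannot be the only nonzero one, since the vector
      is isotropic and 2 is invertible.\<close>
    have "\<exists>i\<in>{1,2,3,5,6,7}. v $ i \<noteq> 0"
    proof (rule ccontr)
      assume *: "\<not> ?thesis"
      then have "2 * (v$4 * v$4) = 0" using v(2) by (simp add: q7_def)
      then have "v $ 4 = 0" using char by simp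
      with * have "v = 0" by (simp add: vec_eq_iff forall_7)
      with v show False by simp
    qed
    then consider "v$3 \<noteq> 0" | "v$7 \<noteq> 0" | "v$6 \<noteq> 0" | "v$2 \<noteq> 0" | "v$1 \<noteq> 0" | "v$5 \<noteq> 0" by auto
    then have "\<exists>g\<in>G2. (g *v ?v) $ 3 \<noteq> 0"
    proof cases
      case 1 then show ?thesis by (intro bexI[of _ "mat 1"]) auto
    next
      case 2 then show ?thesis by (intro bexI[of _ "w_a"]) auto
    next
      case 3 then show ?thesis by (intro bexI[of _ "w_a ** w_b"]) auto
    next
      case 4 then show ?thesis by (intro bexI[of _ "w_a ** w_b ** w_a"]) auto
    next
      case 5 then show ?thesis by (intro bexI[of _ "w_a ** w_b ** w_a ** w_b"]) auto
    next
      case 6 then show ?thesis by (intro bexI[of _ "w_a ** w_b ** w_a ** w_b ** w_a"]) auto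
    qed
    then show ?thesis by (simp only: vec7_eta)
  qed
  then obtain g where "g \<in> G2" "(g *v v) $ 3 \<noteq> 0" by blast
  then show ?thesis using step[of g v] P3'[of "g *v v"] inv[OF v(2)] by blast
qed

text \<open>With \<open>plane15\<close>, membership in the two representative planes. The weights of
  \<open>e1\<close> and \<open>e5\<close> add up to 3\<alpha>+2\<beta>, which is not a weight, so
  the octonion product vanishes on \<open>plane15\<close>; those of \<open>e1\<close> and
  \<open>e2\<close> add up to the weight of \<open>e5\<close>.\<close>

definition plane12 :: "'k::field^7 \<Rightarrow> bool" where
  "plane12 x \<longleftrightarrow> (\<exists>s t. x = vec7 s t 0 0 0 0 0)"

definition plane15 :: "'k::field^7 \<Rightarrow> bool" where
  "plane15 x \<longleftrightarrow> (\<exists>s t. x = vec7 s 0 0 0 t 0 0)"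

text \<open>Once x is a multiple of \<open>e5\<close>, orthogonality gives \<open>w3 = 0\<close>. If
  \<open>w6\<close> or \<open>w7\<close> is nonzero, elements fixing the line of \<open>e5\<close>
  reduce the second vector to the span of \<open>e5\<close> and the sixth basis vector, and
  \<open>w_a\<close> moves that plane to \<open>plane12\<close>. Otherwise isotropy also clears
  \<open>w4\<close>, and the \<beta>-Levi moves what is left into \<open>plane15\<close>.\<close>

lemma G2_isotropic_planes:
  fixes x y :: "'k::field^7"
  assumes char: "(2::'k) \<noteq> 0" and x: "x \<noteq> 0" "q7 x x = 0" and y: "q7 y y = 0" "q7 x y = 0"
  shows "\<exists>g\<in>G2. plane12 (g *v x) \<and> plane12 (g *v y) \<or> plane15 (g *v x) \<and> plane15 (g *v y)"
proof -
  let ?P = "\<lambda>x y. \<exists>g\<in>G2. plane12 (g *v x) \<and> plane12 (g *v y) \<or> plane15 (g *v x) \<and> plane15 (g *v y)"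
  have step: "?P x y" if g: "g \<in> G2" and P: "?P (g *v x) (g *v y)" for g x y
  proof -
    obtain g' where "g' \<in> G2" "plane12 ((g' ** g) *v x) \<and> plane12 ((g' ** g) *v y) \<or>
        plane15 ((g' ** g) *v x) \<and> plane15 ((g' ** g) *v y)" using P by auto
    then show ?thesis using g mult_G2 by blast
  qed
  have inv: "q7 (g *v u) (g *v v) = q7 u v" if "g \<in> G2" for g and u v :: "'k^7"
    using that SO_Q7_q7[of g u v] G2_subset_SO by auto
  have "?P (vec7 0 0 0 0 c 0 0) w" if c: "c \<noteq> 0" and w: "q7 w w = 0" "q7 (vec7 0 0 0 0 c 0 0) w = 0" for c :: 'k and w
  proof -
    let ?e = "vec7 0 0 0 0 c 0 0"
    define w1 w2 w3 w4 w5 w6 w7 where "w1 = w$1" "w2 = w$2" "w3 = w$3" "w4 = w$4" "w5 = w$5" "w6 = w$6" "w7 = w$7"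
    have "w = vec7 w1 w2 w3 w4 w5 w6 w7" unfolding w1_w2_w3_w4_w5_w6_w7_def by (simp add: vec7_eta)
    moreover have "w3 = 0" using w(2) c by (simp add: q7_def w1_w2_w3_w4_w5_w6_w7_def)
    ultimately have w_eq: "w = vec7 w1 w2 0 w4 w5 w6 w7" by simp
    have close: "?P ?e (vec7 0 0 0 0 w5 w6 0)" for w5 w6 :: 'k
      by (rule step[of w_a]; (intro bexI[of _ "mat 1"])?) (auto simp: plane12_def)
    have B: "?P ?e (vec7 w1 w2 0 w4 w5 w6 0)" if w6: "w6 \<noteq> 0"
      and iso: "q7 (vec7 w1 w2 0 w4 w5 w6 0) (vec7 w1 w2 0 w4 w5 w6 0) = 0" for w1 w2 w4 w5 w6 :: 'k
    proof (rule step[of "x_a (- w4 / w6)"])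
      let ?w = "x_a (- w4 / w6) *v vec7 w1 w2 0 w4 w5 w6 0"
      obtain a b where ab: "?w = vec7 w1 a 0 0 b w6 0" using w6 by simp
      have "q7 ?w ?w = 0" unfolding inv[OF x_in_G2(1)] by (rule iso)
      then have "2 * (a * w6) = 0" unfolding ab by (simp add: q7_def algebra_simps)
      then have a: "a = 0" using w6 char by simp
      have "?P ?e (vec7 w1 0 0 0 b w6 0)"
        by (rule step[of "x_2ab (w1 / w6)"]) (use w6 close in simp_all)
      then show "?P (x_a (- w4 / w6) *v ?e) ?w" unfolding ab a by simp
    qed simp
    show ?thesis
    proof (cases "w7 = 0")
      case 7: True
      show ?thesis
      proof (cases "w6 = 0")
        case False
        then show ?thesis using B w(1) unfolding w_eq 7 by blast
      next
        case 6: True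
        have "2 * (w4 * w4) = 0" using w(1) unfolding w_eq 6 7 by (simp add: q7_def)
        then have 4: "w4 = 0" using char by simp
        show ?thesis
        proof (cases "w2 = 0")
          case True
          then show ?thesis unfolding w_eq 4 6 7
            by (intro bexI[of _ "mat 1"]) (auto simp: plane15_def)
        next
          case False
          show ?thesis unfolding w_eq 4 6 7
            by (intro bexI[of _ "w_b ** x_b (- w1 / w2)"]) (use False in \<open>auto simp: plane15_def\<close>)
        qed
      qed
    next
      case False
      show ?thesis
      proof (rule step[of "w_b ** x_b (w6 / w7)"])
        let ?g = "w_b ** x_b (w6 / w7)"
        have "q7 (?g *v w) (?g *v w) = 0" using inv[of ?g w w] w(1) by simp
        then show "?P (?g *v ?e) (?g *v w)" using B[of "- w7"] False unfolding w_eq by simp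
      qed simp
    qed
  qed
  note main = this
  obtain g c where g: "g \<in> G2" "c \<noteq> 0" "g *v x = vec7 0 0 0 0 c 0 0"
    using G2_isotropic_transitive[OF char x] by blast
  have "?P (g *v x) (g *v y)" unfolding g(3)
    by (rule main) (use g(2) y inv[OF g(1)] g(3) in \<open>auto simp flip: g(3)\<close>)
  then show ?thesis using step[OF g(1)] by blast
qed

text \<open>The second case, that of the closed orbit, is the one that cuspidality along \<open>V_a\<close> rules out.\<close>

lemma SO_orbits:
  fixes s :: "'k::field^7^7"
  assumes char: "(2::'k) \<noteq> 0" and s: "s \<in> SO Q7"
  shows "(\<exists>g\<in>G2. s ** g \<in> P_tilde) \<or>
    (\<exists>g\<in>G2. \<forall>n\<in>V_a. s ** (g ** n ** matrix_inv g) ** matrix_inv s \<in> P_tilde \<and>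
       res2 (s ** (g ** n ** matrix_inv g) ** matrix_inv s) = mat 1)"
proof -
  \<comment> \<open>The coset of s modulo \<open>P_tilde\<close> corresponds to the isotropic plane
    spanned by these two vectors.\<close>
  let ?x = "matrix_inv s *v e1" and ?y = "matrix_inv s *v e2"
  have si: "invertible s" by (rule invertible_SO[OF s])
  have q: "q7 ?x ?x = 0" "q7 ?y ?y = 0" "q7 ?x ?y = 0"
    by (simp_all only: SO_Q7_q7[OF inv_SO[OF s]]) (simp_all add: q7_def)
  have "?x \<noteq> 0"
  proof
    assume "?x = 0"
    then have "s *v ?x = 0" by simp
    then have "e1 = (0::'k^7)" by (simp only: matrix_inv_cancel_vec[OF si])
    then show False by (simp add: vec_eq_iff forall_7)
  qed
  from G2_isotropic_planes[OF char this q(1,2,3)] obtain g where g: "g \<in> G2"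
    and pl: "plane12 (g *v ?x) \<and> plane12 (g *v ?y) \<or> plane15 (g *v ?x) \<and> plane15 (g *v ?y)" by blast
  let ?g = "matrix_inv g"
  have ig: "invertible g" and gS: "g \<in> SO Q7" using g invertible_G2 G2_subset_SO by auto
  from pl show ?thesis
  proof
    assume *: "plane12 (g *v ?x) \<and> plane12 (g *v ?y)"
    have "g ** matrix_inv s \<in> P_tilde"
      using * s gS unfolding plane12_def by (elim conjE exE) (rule P_tildeI(1); simp)
    from P_tilde_inv[OF this char] have "s ** ?g \<in> P_tilde"
      using si ig by (simp add: matrix_inv_mult invertible_matrix_inv matrix_inv_matrix_inv)
    then show ?thesis using inv_G2[OF g] by blast
  next
    assume *: "plane15 (g *v ?x) \<and> plane15 (g *v ?y)"
    have "s ** (?g ** n ** matrix_inv ?g) ** matrix_inv s \<in> P_tilde \<and>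
       res2 (s ** (?g ** n ** matrix_inv ?g) ** matrix_inv s) = mat 1" if n: "n \<in> V_a" for n
    proof -
      let ?p = "s ** (?g ** n ** matrix_inv ?g) ** matrix_inv s"
      have nU: "n \<in> U_max" using n radicals_subset_U_max by blast
      \<comment> \<open>\<open>V_a\<close> fixes this plane pointwise and does not merely preserve
        it, which is what makes \<open>res2\<close> trivial.\<close>
      have fix15: "n *v z = z" if z15: "plane15 z" for z
      proof -
        obtain a b where z: "z = vec7 a 0 0 0 b 0 0" using z15 by (auto simp: plane15_def)
        show ?thesis unfolding z using U_max_entries[OF nU] V_a_entry[OF n]
          by (simp add: vec_eq_iff forall_7 matrix_vector_mult_def sum_7)
      qed
      have "?p *v e1 = e1" "?p *v e2 = e2"
        using * fix15 by (simp_all add: matrix_inv_matrix_inv ig matrix_inv_cancel_vec si)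
      moreover have "?p \<in> SO Q7"
        using n subgroups_subset_G2(3) G2_subset_SO s gS by (auto simp: subset_iff)
      ultimately show ?thesis using P_tildeI[of ?p 1 0 0 1] by (simp add: vector_mat_1)
    qed
    then show ?thesis using inv_G2[OF g] by blast
  qed
qed

section \<open>Invariant bilinear forms\<close>

lemma sum_additive_character:
  fixes \<psi> :: "'k::{field,finite} \<Rightarrow> complex"
  assumes \<psi>: "nontrivial_additive_character \<psi>"
  shows "(\<Sum>c\<in>UNIV. \<psi> (c * x)) = (if x = 0 then of_nat (card (UNIV :: 'k set)) else 0)"
proof (cases "x = 0")
  case True
  then show ?thesis using \<psi> by (simp add: nontrivial_additive_character_def)
next
  case False
  obtain y where y: "\<psi> y \<noteq> 1" using \<psi> by (auto simp: nontrivial_additive_character_def)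
  have "bij (\<lambda>c. c + y / x)" by (rule bij_betw_byWitness[of _ "\<lambda>c. c - y / x"]) auto
  then have "(\<Sum>c\<in>UNIV. \<psi> (c * x)) = (\<Sum>c\<in>UNIV. \<psi> ((c + y / x) * x))"
    by (rule sum.reindex_bij_betw[symmetric])
  also have "\<dots> = (\<Sum>c\<in>UNIV. \<psi> (c * x)) * \<psi> y"
    using \<psi> False by (simp add: nontrivial_additive_character_def distrib_right sum_distrib_right)
  finally show ?thesis using y False by (metis mult_cancel_left1)
qed

text \<open>Total functions represent functions on \<open>SO Q7\<close>; \<open>B_cong\<close> says
  that the values elsewhere do not matter. Thus indicator cut-offs may be inserted freely, and
  equalities of functions need checking only on the group.\<close>

locale invariant_form =
  fixes \<psi> :: "'k::{field,finite} \<Rightarrow> complex"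
    and sV :: "complex \<Rightarrow> 'v::ab_group_add \<Rightarrow> 'v" and \<rho> :: "'k^7^7 \<Rightarrow> 'v \<Rightarrow> 'v"
    and sT :: "complex \<Rightarrow> 't::ab_group_add \<Rightarrow> 't" and \<tau> :: "'k^2^2 \<Rightarrow> 't \<Rightarrow> 't"
    and B :: "'v \<Rightarrow> ('k^7^7 \<Rightarrow> 't) \<Rightarrow> complex"
  assumes char: "(2::'k) \<noteq> 0"
    and \<psi>: "nontrivial_additive_character \<psi>"
    and repV: "representation sV G2 \<rho>" and cusp: "cuspidal_G2 \<rho>"
    and repT: "representation sT (carrier GL) \<tau>"
    and B_lin: "Vector_Spaces.linear sV (*) (\<lambda>v. B v \<xi>)"
    and B_add: "B v (\<lambda>x. \<xi> x + \<xi>' x) = B v \<xi> + B v \<xi>'"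
    and B_scale: "B v (\<lambda>x. sT c (\<xi> x)) = c * B v \<xi>"
    and B_cong: "(\<And>x. x \<in> SO Q7 \<Longrightarrow> \<xi> x = \<xi>' x) \<Longrightarrow> B v \<xi> = B v \<xi>'"
    and B_inv: "h \<in> G2 \<Longrightarrow> B (\<rho> h v) (\<lambda>x. \<xi> (x ** h)) = B v \<xi>"
begin

lemma linear_sumD:
  assumes "Vector_Spaces.linear sV (*) k"
  shows "k (v + w) = k v + k w" "k (sV c v) = c * k v" "k (sum F A) = (\<Sum>i\<in>A. k (F i))" "k 0 = 0"
proof -
  interpret Vector_Spaces.linear sV "(*)" k by (rule assms)
  show "k (v + w) = k v + k w" "k (sV c v) = c * k v" "k (sum F A) = (\<Sum>i\<in>A. k (F i))" "k 0 = 0"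
    by (simp_all add: add scale sum zero)
qed

lemma linearI:
  assumes "\<And>v w. k (v + w) = k v + k w" "\<And>c v. k (sV c v) = c * k v"
  shows "Vector_Spaces.linear sV (*) k"
proof -
  have "vector_space sV" "vector_space ((*) :: complex \<Rightarrow> complex \<Rightarrow> complex)"
    using B_lin by (simp_all add: Vector_Spaces.linear_iff)
  then show ?thesis using assms by (simp add: Vector_Spaces.linear_iff)
qed

lemma \<rho>_mult: "g \<in> G2 \<Longrightarrow> g' \<in> G2 \<Longrightarrow> \<rho> (g ** g') v = \<rho> g (\<rho> g' v)"
  using repV by (simp add: representation_def)

lemma \<rho>_lin:
  assumes "g \<in> G2"
  shows "\<rho> g (v + w) = \<rho> g v + \<rho> g w" "\<rho> g (sV c v) = sV c (\<rho> g v)"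
    "\<rho> g (sum F A) = (\<Sum>i\<in>A. \<rho> g (F i))"
proof -
  have "Vector_Spaces.linear sV sV (\<rho> g)" using assms repV by (simp add: representation_def)
  then interpret Vector_Spaces.linear sV sV "\<rho> g" .
  show "\<rho> g (v + w) = \<rho> g v + \<rho> g w" "\<rho> g (sV c v) = sV c (\<rho> g v)"
    "\<rho> g (sum F A) = (\<Sum>i\<in>A. \<rho> g (F i))" by (simp_all add: add scale sum)
qed

lemma \<tau>_mult: "invertible a \<Longrightarrow> invertible a' \<Longrightarrow> \<tau> (a ** a') t = \<tau> a (\<tau> a' t)"
  using repT by (simp add: representation_def carrier_GL)

lemma \<tau>_one: "\<tau> (mat 1) t = t"
  using repT by (simp add: representation_def)

lemma \<tau>_lin:
  assumes "invertible a"
  shows "\<tau> a (t + t') = \<tau> a t + \<tau> a t'" "\<tau> a (sT c t) = sT c (\<tau> a t)" "\<tau> a 0 = 0"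
    "\<tau> a (t - t') = \<tau> a t - \<tau> a t'" "\<tau> a (sum F A) = (\<Sum>i\<in>A. \<tau> a (F i))"
proof -
  have "Vector_Spaces.linear sT sT (\<tau> a)" using assms repT by (simp add: representation_def carrier_GL)
  then interpret Vector_Spaces.linear sT sT "\<tau> a" .
  show "\<tau> a (t + t') = \<tau> a t + \<tau> a t'" "\<tau> a (sT c t) = sT c (\<tau> a t)" "\<tau> a 0 = 0"
    "\<tau> a (t - t') = \<tau> a t - \<tau> a t'" "\<tau> a (sum F A) = (\<Sum>i\<in>A. \<tau> a (F i))"
    by (simp_all add: add scale zero diff sum)
qed

lemma sT_zero: "sT c 0 = 0"
proof -
  obtain T where "finite_dimensional_vector_space sT T" using repT by (auto simp: representation_def)
  then interpret finite_dimensional_vector_space sT T .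
  show ?thesis by simp
qed

text \<open>Cuspidality in dual form: averaging v over the conjugate of N gives a fixed vector,
  hence 0, while an invariant functional multiplies k v by the order of N.\<close>

lemma cuspidal_functional:
  assumes N: "N \<in> {U_max, V_a, V_b}" and g: "g \<in> G2" and k: "Vector_Spaces.linear sV (*) k"
    and inv: "\<And>n v. n \<in> N \<Longrightarrow> k (\<rho> (g ** n ** matrix_inv g) v) = k v"
  shows "k v = 0"
proof -
  have grp: "matrix_group N" and sub: "N \<subseteq> G2"
    using N matrix_group_U_max matrix_group_V_a matrix_group_V_b subgroups_subset_G2 by auto
  note Nd = matrix_groupD[OF grp]
  let ?c = "\<lambda>n. g ** n ** matrix_inv g"
  have cG: "?c n \<in> G2" if "n \<in> N" for n using that sub g by auto
  have cm: "?c m ** ?c n = ?c (m ** n)" for m n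
    by (simp add: matrix_mul_assoc matrix_inv_cancel invertible_G2[OF g])
  define w where "w = (\<Sum>n\<in>N. \<rho> (?c n) v)"
  have "\<rho> (?c m) w = w" if m: "m \<in> N" for m
  proof -
    have "\<rho> (?c m) w = (\<Sum>n\<in>N. \<rho> (?c (m ** n)) v)"
      unfolding w_def \<rho>_lin(3)[OF cG[OF m]]
      by (rule sum.cong) (simp_all add: \<rho>_mult[symmetric] cG m cm)
    also have "\<dots> = w" unfolding w_def
      by (rule matrix_group_finite_sum_left(1)[OF grp m, of "\<lambda>n. \<rho> (?c n) v"])
    finally show ?thesis .
  qed
  then have "w = 0" using cusp N g unfolding cuspidal_G2_def by blast
  moreover have "k w = of_nat (card N) * k v"
    unfolding w_def linear_sumD(3)[OF k] by (simp add: inv)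
  moreover have "card N \<noteq> 0" using Nd(1) by (auto simp: card_eq_0_iff)
  ultimately show ?thesis using linear_sumD(4)[OF k] by simp
qed

lemma B_zero: "B v (\<lambda>x. 0) = 0"
  using B_scale[of v 0 "\<lambda>x. 0"] by (simp add: sT_zero)

lemma B_sum: "B v (\<lambda>x. \<Sum>i\<in>I. F i x) = (\<Sum>i\<in>I. B v (F i))"
  by (induct I rule: infinite_finite_induct) (simp_all add: B_zero B_add)

lemma B_diff: "B v (\<lambda>x. \<xi> x - \<xi>' x) = B v \<xi> - B v \<xi>'"
  using B_add[of v "\<lambda>x. \<xi> x - \<xi>' x" \<xi>'] by simp

lemma SO_sum_right:
  fixes F :: "'k^7^7 \<Rightarrow> 'a::comm_monoid_add"
  assumes "s \<in> SO Q7"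
  shows "(\<Sum>x\<in>SO Q7. F (s ** matrix_inv x)) = (\<Sum>x\<in>SO Q7. F x)"
proof -
  have "(\<Sum>x\<in>SO Q7. F (s ** matrix_inv x)) = (\<Sum>x\<in>SO Q7. F (s ** x))"
    by (rule sum.reindex_bij_betw[OF matrix_group_mult_bij(3)[OF matrix_group_SO assms], of "\<lambda>x. F (s ** x)"])
  also have "\<dots> = (\<Sum>x\<in>SO Q7. F x)"
    by (rule sum.reindex_bij_betw[OF matrix_group_mult_bij(1)[OF matrix_group_SO assms]])
  finally show ?thesis .
qed

lemma one_P_tilde: "mat 1 \<in> P_tilde" "res2 (mat 1) = (mat 1 :: 'k^2^2)"
  unfolding P_tilde_def using one_SO by (simp_all add: res2_def vec_eq_iff forall_2) (simp_all add: mat_def)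

lemma P_tilde_SO: "p \<in> P_tilde \<Longrightarrow> p \<in> SO Q7"
  by (simp add: P_tilde_def)

text \<open>Restrict \<open>\<eta>\<close> to single cosets of \<open>P_tilde\<close>. On a coset
  that meets \<open>G2\<close> the restriction is zero by equivariance. On any other coset a
  conjugate of \<open>V_a\<close> leaves the restriction unchanged, so the form becomes an invariant
  functional in v and cuspidality kills it.\<close>

lemma closed_orbit_vanishing:
  assumes eq: "\<And>p x. p \<in> P_tilde \<Longrightarrow> x \<in> SO Q7 \<Longrightarrow> \<eta> (p ** x) = \<tau> (res2 p) (\<eta> x)"
    and zero: "\<And>g. g \<in> G2 \<Longrightarrow> \<eta> g = 0"
  shows "B v \<eta> = 0"
proof -
  let ?\<eta> = "\<lambda>s x. if x ** matrix_inv s \<in> P_tilde then \<eta> x else 0"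
  have piece: "B v (?\<eta> s) = 0" if s: "s \<in> SO Q7" for s
  proof -
    have si: "invertible s" by (rule invertible_SO[OF s])
    from SO_orbits[OF char s] consider
      (opn) g where "g \<in> G2" "s ** g \<in> P_tilde" |
      (closd) g where "g \<in> G2" "\<And>n. n \<in> V_a \<Longrightarrow> s ** (g ** n ** matrix_inv g) ** matrix_inv s \<in> P_tilde"
        "\<And>n. n \<in> V_a \<Longrightarrow> res2 (s ** (g ** n ** matrix_inv g) ** matrix_inv s) = mat 1" by blast
    then show ?thesis
    proof cases
      case opn
      have "?\<eta> s x = 0" if x: "x \<in> SO Q7" for x
      proof (cases "x ** matrix_inv s \<in> P_tilde")
        case True
        then have P: "x ** matrix_inv s ** (s ** g) \<in> P_tilde" using opn(2) by (rule P_tilde_mult(1))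
        have ig: "invertible g" by (rule invertible_G2[OF opn(1)])
        have "x = (x ** matrix_inv s ** (s ** g)) ** matrix_inv g"
          using si ig by (simp add: matrix_mul_assoc matrix_inv_cancel)
        then have "\<eta> x = \<tau> (res2 (x ** matrix_inv s ** (s ** g))) (\<eta> (matrix_inv g))"
          using eq[OF P, of "matrix_inv g"] opn(1) G2_subset_SO by auto
        also have "\<dots> = 0"
          using zero[of "matrix_inv g"] opn(1) \<tau>_lin(3)[OF P_tilde_levi(1)[OF P char]] by simp
        finally show ?thesis by simp
      qed simp
      then have "B v (?\<eta> s) = B v (\<lambda>x. 0)" by (intro B_cong) simp
      then show ?thesis by (simp add: B_zero)
    next
      case closd
      have inv: "B (\<rho> (g ** n ** matrix_inv g) v) (?\<eta> s) = B v (?\<eta> s)" if n: "n \<in> V_a" for n v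
      proof -
        let ?m = "g ** n ** matrix_inv g" and ?q = "s ** (g ** n ** matrix_inv g) ** matrix_inv s"
        have m: "?m \<in> G2" using closd(1) n subgroups_subset_G2 by auto
        then have mS: "?m \<in> SO Q7" using G2_subset_SO by blast
        note q = closd(2)[OF n] closd(3)[OF n]
        have "?\<eta> s (x ** ?m) = ?\<eta> s x" if x: "x \<in> SO Q7" for x
        proof -
          have xm: "x ** ?m ** matrix_inv s = (x ** matrix_inv s) ** ?q"
            using si by (simp add: matrix_mul_assoc matrix_inv_cancel)
          have "x ** matrix_inv s = (x ** ?m ** matrix_inv s) ** matrix_inv ?q"
            unfolding xm using invertible_SO[OF P_tilde_SO[OF q(1)]] by (simp add: matrix_inv_cancel(3))
          then have iff: "x ** ?m ** matrix_inv s \<in> P_tilde \<longleftrightarrow> x ** matrix_inv s \<in> P_tilde"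
            using P_tilde_mult(1)[OF _ q(1)] P_tilde_mult(1)[OF _ P_tilde_inv[OF q(1) char]] xm by metis
          show ?thesis
          proof (cases "x ** matrix_inv s \<in> P_tilde")
            case True
            have "\<eta> (x ** ?m) = \<eta> ((x ** matrix_inv s) ** ?q ** s)"
              using si by (simp add: matrix_mul_assoc matrix_inv_cancel)
            also have "\<dots> = \<tau> (res2 (x ** matrix_inv s)) (\<eta> s)"
              using P_tilde_mult[OF True q(1)] s by (simp add: eq q(2))
            also have "\<dots> = \<eta> ((x ** matrix_inv s) ** s)" using True s by (simp add: eq)
            also have "\<dots> = \<eta> x" using si by (simp add: matrix_inv_cancel)
            finally show ?thesis using True iff by simp
          qed (use iff in simp)
        qed
        then have "B (\<rho> ?m v) (?\<eta> s) = B (\<rho> ?m v) (\<lambda>x. ?\<eta> s (x ** ?m))" by (intro B_cong) simp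
        also have "\<dots> = B v (?\<eta> s)" by (rule B_inv[OF m])
        finally show ?thesis .
      qed
      show ?thesis
        by (rule cuspidal_functional[OF _ closd(1) B_lin inv, of V_a]) auto
    qed
  qed
  have "B v (\<lambda>x. \<Sum>s\<in>SO Q7. ?\<eta> s x) = 0" unfolding B_sum by (simp add: piece)
  \<comment> \<open>Summing over all s instead of coset representatives counts every coset as often
    as \<open>P_tilde\<close> has elements.\<close>
  moreover have "(\<Sum>s\<in>SO Q7. ?\<eta> s x) = (\<Sum>s\<in>(P_tilde :: ('k^7^7) set). \<eta> x)" if x: "x \<in> SO Q7" for x
  proof -
    have "(\<Sum>s\<in>SO Q7. ?\<eta> s x) = (\<Sum>s\<in>SO (Q7 :: 'k^7^7). if s \<in> P_tilde then \<eta> x else 0)"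
      by (rule SO_sum_right[OF x, of "\<lambda>s. if s \<in> P_tilde then \<eta> x else 0"])
    also have "\<dots> = (\<Sum>s\<in>(P_tilde :: ('k^7^7) set). \<eta> x)"
      by (rule sum.mono_neutral_cong_right) (auto simp: P_tilde_SO)
    finally show ?thesis .
  qed
  then have "B v (\<lambda>x. \<Sum>s\<in>SO Q7. ?\<eta> s x) = B v (\<lambda>x. \<Sum>s\<in>(P_tilde :: ('k^7^7) set). \<eta> x)"
    by (intro B_cong)
  ultimately have "of_nat (card (P_tilde :: ('k^7^7) set)) * B v \<eta> = 0"
    by (simp only: B_sum) simp
  moreover have "card (P_tilde :: ('k^7^7) set) \<noteq> 0" using one_P_tilde(1) by (auto simp: card_eq_0_iff)
  ultimately show ?thesis by simp
qed

text \<open>The equivariant function supported on \<open>P_tilde\<close> with value t at 1. The form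
  \<open>\<beta>\<close> obtained from it is what Frobenius reciprocity attaches to \<open>B\<close>
  on the open orbit.\<close>

definition \<delta> :: "'t \<Rightarrow> 'k^7^7 \<Rightarrow> 't" where
  "\<delta> t x = (if x \<in> P_tilde then \<tau> (res2 x) t else 0)"

definition \<beta> :: "'v \<Rightarrow> 't \<Rightarrow> complex" where
  "\<beta> v t = B v (\<delta> t)"

lemma \<beta>_linear: "Vector_Spaces.linear sV (*) (\<lambda>v. \<beta> v t)"
  unfolding \<beta>_def by (rule B_lin)

lemma \<beta>_right: "\<beta> v (t + t') = \<beta> v t + \<beta> v t'" "\<beta> v (sT c t) = c * \<beta> v t"
proof -
  have "\<delta> (t + t') x = \<delta> t x + \<delta> t' x" "\<delta> (sT c t) x = sT c (\<delta> t x)" for x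
    using P_tilde_levi(1)[OF _ char, of x] by (auto simp: \<delta>_def \<tau>_lin sT_zero)
  then have "\<delta> (t + t') = (\<lambda>x. \<delta> t x + \<delta> t' x)" "\<delta> (sT c t) = (\<lambda>x. sT c (\<delta> t x))" by auto
  then show "\<beta> v (t + t') = \<beta> v t + \<beta> v t'" "\<beta> v (sT c t) = c * \<beta> v t"
    by (simp_all add: \<beta>_def B_add B_scale)
qed

lemma \<beta>_inv:
  assumes h: "h \<in> G2" "h \<in> P_tilde"
  shows "\<beta> (\<rho> h v) (\<tau> (res2 h) t) = \<beta> v t"
proof -
  have "\<delta> (\<tau> (res2 h) t) x = \<delta> t (x ** h)" if x: "x \<in> SO Q7" for x
  proof -
    have hi: "invertible h" by (rule invertible_G2[OF h(1)])
    have "x \<in> P_tilde" if "x ** h \<in> P_tilde"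
      using P_tilde_mult(1)[OF that P_tilde_inv[OF h(2) char]] hi by (simp add: matrix_inv_cancel)
    then have iff: "x ** h \<in> P_tilde \<longleftrightarrow> x \<in> P_tilde" using P_tilde_mult(1)[OF _ h(2)] by blast
    show ?thesis
    proof (cases "x \<in> P_tilde")
      case True
      then show ?thesis using iff P_tilde_mult(2)[OF True h(2)]
          P_tilde_levi(1)[OF True char] P_tilde_levi(1)[OF h(2) char]
        by (simp add: \<delta>_def \<tau>_mult)
    qed (simp add: \<delta>_def iff)
  qed
  then have "B (\<rho> h v) (\<delta> (\<tau> (res2 h) t)) = B (\<rho> h v) (\<lambda>x. \<delta> t (x ** h))" by (rule B_cong)
  then show ?thesis unfolding \<beta>_def by (simp add: B_inv[OF h(1)])
qed

text \<open>On \<open>G2\<close> the multiple of \<open>\<xi>\<close> by the order of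
  \<open>G2 \<inter> P_tilde\<close> equals the sum of the right translates of
  \<open>\<delta> (\<xi> g)\<close>. The difference is equivariant and zero on \<open>G2\<close>, so
  \<open>closed_orbit_vanishing\<close> applies; invariance then moves each translation onto
  v.\<close>

lemma B_eq_sum_\<beta>:
  assumes \<xi>: "\<xi> \<in> Ind \<tau>"
  shows "of_nat (card (G2 \<inter> P_tilde :: ('k^7^7) set)) * B v \<xi> = (\<Sum>g\<in>G2. \<beta> (\<rho> g v) (\<xi> g))"
proof -
  let ?F = "\<lambda>x. \<Sum>g\<in>G2. \<delta> (\<xi> g) (x ** matrix_inv g)"
  let ?\<eta> = "\<lambda>x. (\<Sum>p\<in>G2 \<inter> (P_tilde :: ('k^7^7) set). \<xi> x) - ?F x"
  note \<xi>_P = Ind_P_tilde[OF \<xi> _ _ char]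
  have gS: "g \<in> SO Q7" if "g \<in> G2" for g :: "'k^7^7" using that G2_subset_SO by blast
  have \<delta>_P: "\<delta> t (p ** x) = \<tau> (res2 p) (\<delta> t x)" if p: "p \<in> P_tilde" for p x t
  proof -
    have pinv: "invertible p" by (rule invertible_SO[OF P_tilde_SO[OF p]])
    have "x \<in> P_tilde" if "p ** x \<in> P_tilde"
      using P_tilde_mult(1)[OF P_tilde_inv[OF p char] that] pinv by (simp add: matrix_inv_cancel)
    then have iff: "p ** x \<in> P_tilde \<longleftrightarrow> x \<in> P_tilde" using P_tilde_mult(1)[OF p] by blast
    show ?thesis
    proof (cases "x \<in> P_tilde")
      case True
      then show ?thesis using iff P_tilde_mult(2)[OF p True]
          P_tilde_levi(1)[OF True char] P_tilde_levi(1)[OF p char]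
        by (simp add: \<delta>_def \<tau>_mult)
    next
      case False
      then show ?thesis using iff \<tau>_lin(3)[OF P_tilde_levi(1)[OF p char]] by (simp add: \<delta>_def)
    qed
  qed
  have "B v ?\<eta> = 0"
  proof (rule closed_orbit_vanishing)
    fix p x :: "'k^7^7" assume p: "p \<in> P_tilde" and x: "x \<in> SO Q7"
    note \<tau>p = \<tau>_lin[OF P_tilde_levi(1)[OF p char]]
    show "?\<eta> (p ** x) = \<tau> (res2 p) (?\<eta> x)"
      by (simp add: \<tau>p \<xi>_P[OF p x] \<delta>_P[OF p] matrix_mul_assoc[symmetric])
  next
    fix x :: "'k^7^7" assume x: "x \<in> G2"
    have trm: "\<delta> (\<xi> g) (x ** matrix_inv g) = (if x ** matrix_inv g \<in> P_tilde then \<xi> x else 0)" if g: "g \<in> G2" for g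
    proof (cases "x ** matrix_inv g \<in> P_tilde")
      case True
      have "\<xi> x = \<xi> ((x ** matrix_inv g) ** g)" using invertible_G2[OF g] by (simp add: matrix_inv_cancel)
      also have "\<dots> = \<tau> (res2 (x ** matrix_inv g)) (\<xi> g)" by (rule \<xi>_P[OF True gS[OF g]])
      finally show ?thesis using True by (simp add: \<delta>_def)
    qed (simp add: \<delta>_def)
    have "?F x = (\<Sum>g\<in>G2. if x ** matrix_inv g \<in> P_tilde then \<xi> x else 0)"
      by (rule sum.cong) (simp_all add: trm)
    also have "\<dots> = (\<Sum>g\<in>G2. if x ** g \<in> P_tilde then \<xi> x else 0)"
      by (rule sum.reindex_bij_betw[OF matrix_group_mult_bij(3)[OF matrix_group_G2 x],
            of "\<lambda>g. if x ** g \<in> P_tilde then \<xi> x else 0"])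
    also have "\<dots> = (\<Sum>g\<in>(G2 :: ('k^7^7) set). if g \<in> P_tilde then \<xi> x else 0)"
      by (rule sum.reindex_bij_betw[OF matrix_group_mult_bij(1)[OF matrix_group_G2 x],
            of "\<lambda>g. if g \<in> P_tilde then \<xi> x else 0"])
    also have "\<dots> = (\<Sum>p\<in>G2 \<inter> (P_tilde :: ('k^7^7) set). \<xi> x)"
      by (rule sum.mono_neutral_cong_right) auto
    finally show "?\<eta> x = 0" by simp
  qed
  then have "(\<Sum>p\<in>G2 \<inter> (P_tilde :: ('k^7^7) set). B v \<xi>) = (\<Sum>g\<in>G2. B v (\<lambda>x. \<delta> (\<xi> g) (x ** matrix_inv g)))"
    by (simp only: B_diff B_sum right_minus_eq)
  also have "\<dots> = (\<Sum>g\<in>G2. \<beta> (\<rho> g v) (\<xi> g))"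
  proof (rule sum.cong[OF refl])
    fix g :: "'k^7^7" assume g: "g \<in> G2"
    have "B v (\<lambda>x. \<delta> (\<xi> g) (x ** matrix_inv g)) = B (\<rho> g v) (\<lambda>x. \<delta> (\<xi> g) (x ** g ** matrix_inv g))"
      by (rule B_inv[OF g, symmetric])
    also have "\<dots> = \<beta> (\<rho> g v) (\<xi> g)"
      using invertible_G2[OF g] by (simp add: \<beta>_def matrix_inv_cancel)
    finally show "B v (\<lambda>x. \<delta> (\<xi> g) (x ** matrix_inv g)) = \<beta> (\<rho> g v) (\<xi> g)" .
  qed
  finally show ?thesis by simp
qed

section \<open>Fourier expansion into Whittaker functionals\<close>

lemma U_max_plane12:
  assumes "u \<in> U_max"
  shows "u *v vec7 x y 0 0 0 0 (0::'k) = vec7 (x + y * u$1$2) y 0 0 (x * u$5$1 + y * u$5$2) 0 0"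
  by (simp add: vec_eq_iff forall_7 matrix_vector_mult_def sum_7 U_max_entries[OF assms] mult.commute)

text \<open>In \<open>E\<close> and \<open>L\<close> the weight is the inverse of
  \<open>psi_U\<close>, so these are unnormalised projections of \<open>\<beta>\<close> in its first
  variable to the functionals equivariant under \<open>V_b\<close> and \<open>U_max\<close>.\<close>

definition E :: "'t \<Rightarrow> 'v \<Rightarrow> complex" where
  "E t v = (\<Sum>u\<in>V_b. \<psi> (u$5$1) * \<beta> (\<rho> u v) t)"

definition L :: "'t \<Rightarrow> 'v \<Rightarrow> complex" where
  "L t v = (\<Sum>u\<in>U_max. \<psi> (u$5$1 - u$1$2) * \<beta> (\<rho> u v) t)"

lemma \<psi>_add: "\<psi> (x + y) = \<psi> x * \<psi> y"
  and \<psi>_zero: "\<psi> 0 = 1"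
  using \<psi> by (auto simp: nontrivial_additive_character_def)

lemma G2I: "u \<in> U_max \<Longrightarrow> u \<in> G2" "u \<in> V_b \<Longrightarrow> u \<in> G2" "u \<in> V_a \<Longrightarrow> u \<in> G2"
  "u \<in> V_b \<Longrightarrow> u \<in> U_max" "u \<in> V_a \<Longrightarrow> u \<in> U_max"
  using subgroups_subset_G2 radicals_subset_U_max by blast+

lemma weighted_sum_linear:
  assumes "N \<subseteq> G2"
  shows "Vector_Spaces.linear sV (*) (\<lambda>v. \<Sum>u\<in>N. \<omega> u * \<beta> (\<rho> u v) t)"
proof (rule linearI)
  note b = linear_sumD[OF \<beta>_linear]
  have r: "\<rho> u (v + w) = \<rho> u v + \<rho> u w" "\<rho> u (sV c v) = sV c (\<rho> u v)" if "u \<in> N" for u v w c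
    using that assms by (auto simp: \<rho>_lin)
  show "(\<Sum>u\<in>N. \<omega> u * \<beta> (\<rho> u (v + w)) t) = (\<Sum>u\<in>N. \<omega> u * \<beta> (\<rho> u v) t) + (\<Sum>u\<in>N. \<omega> u * \<beta> (\<rho> u w) t)" for v w
    by (simp add: r b distrib_left sum.distrib)
  show "(\<Sum>u\<in>N. \<omega> u * \<beta> (\<rho> u (sV c v)) t) = c * (\<Sum>u\<in>N. \<omega> u * \<beta> (\<rho> u v) t)" for c v
    by (simp add: r b sum_distrib_left mult.left_commute)
qed

lemma weighted_sum_translate:
  assumes N: "matrix_group N" "N \<subseteq> G2" and h: "h \<in> N"
    and \<omega>: "\<And>u. u \<in> N \<Longrightarrow> \<omega> (u ** h) = \<omega> u * c"
  shows "c * (\<Sum>u\<in>N. \<omega> u * \<beta> (\<rho> u (\<rho> h v)) t) = (\<Sum>u\<in>N. \<omega> u * \<beta> (\<rho> u v) t)"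
proof -
  have "c * (\<Sum>u\<in>N. \<omega> u * \<beta> (\<rho> u (\<rho> h v)) t) = (\<Sum>u\<in>N. \<omega> (u ** h) * \<beta> (\<rho> (u ** h) v) t)"
    unfolding sum_distrib_left
    by (rule sum.cong) (use N(2) h in \<open>auto simp: \<omega> \<rho>_mult subset_iff\<close>)
  also have "\<dots> = (\<Sum>u\<in>N. \<omega> u * \<beta> (\<rho> u v) t)"
    by (rule matrix_group_finite_sum_left(2)[OF N(1) h, of "\<lambda>u. \<omega> u * \<beta> (\<rho> u v) t"])
  finally show ?thesis .
qed

text \<open>Conjugating the weight by an element of \<open>G2 \<inter> P_tilde\<close> that
  normalises N costs only a simultaneous translation of both arguments. So conjugate characters give
  translates of one and the same projection.\<close>

lemma weighted_sum_conj:
  assumes m: "m \<in> G2" "m \<in> P_tilde" and norm: "normalizes m N" and N: "N \<subseteq> G2"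
    and \<omega>: "\<And>u. u \<in> N \<Longrightarrow> \<omega>' (m ** u ** matrix_inv m) = \<omega> u"
  shows "(\<Sum>u\<in>N. \<omega> u * \<beta> (\<rho> u v) t) = (\<Sum>u\<in>N. \<omega>' u * \<beta> (\<rho> u (\<rho> m v)) (\<tau> (res2 m) t))"
proof -
  let ?c = "\<lambda>u. m ** u ** matrix_inv m"
  have c: "?c u \<in> N" if "u \<in> N" for u using norm that by (simp add: normalizes_def)
  have mi: "invertible m" using norm by (simp add: normalizes_def)
  have bij: "bij_betw ?c N N" by (rule conj_bij_betw[OF _ mi c]) simp_all
  have "(\<Sum>u\<in>N. \<omega>' u * \<beta> (\<rho> u (\<rho> m v)) (\<tau> (res2 m) t)) =
      (\<Sum>u\<in>N. \<omega>' (?c u) * \<beta> (\<rho> (?c u) (\<rho> m v)) (\<tau> (res2 m) t))"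
    by (rule sum.reindex_bij_betw[OF bij, symmetric])
  also have "\<dots> = (\<Sum>u\<in>N. \<omega> u * \<beta> (\<rho> u v) t)"
  proof (rule sum.cong[OF refl])
    fix u assume u: "u \<in> N"
    have uG: "u \<in> G2" "?c u \<in> G2" using u c[OF u] N by auto
    have "\<rho> (?c u) (\<rho> m v) = \<rho> (?c u ** m) v" using uG m by (simp only: \<rho>_mult)
    also have "?c u ** m = m ** u" using mi by (simp add: matrix_inv_cancel)
    also have "\<rho> (m ** u) v = \<rho> m (\<rho> u v)" using uG m by (simp only: \<rho>_mult)
    finally show "\<omega>' (?c u) * \<beta> (\<rho> (?c u) (\<rho> m v)) (\<tau> (res2 m) t) = \<omega> u * \<beta> (\<rho> u v) t"
      using u by (simp add: \<omega> \<beta>_inv[OF m])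
  qed
  finally show ?thesis by simp
qed

lemma x_b_P_tilde: "x_b r \<in> (P_tilde :: ('k^7^7) set)"
    "res2 (x_b r) = (vector [vector [1, r], vector [0, 1]] :: 'k^2^2)"
  and h_diag_P_tilde: "a \<noteq> 0 \<Longrightarrow> b \<noteq> 0 \<Longrightarrow> h_diag a b \<in> (P_tilde :: ('k^7^7) set)"
  and x_neg_b_P_tilde: "x_neg_b r \<in> (P_tilde :: ('k^7^7) set)"
  and w_b_P_tilde: "w_b \<in> (P_tilde :: ('k^7^7) set)"
  using G2_subset_SO h_diag_in_G2[of a b] by (auto intro!: P_tildeI)

lemma conj_entry_51:
  assumes m: "m *v vec7 x y 0 0 0 0 (0::'k) = e1" "invertible m" and u: "u \<in> U_max"
    and m5: "\<And>v. (m *v v) $ 5 = \<mu> * v $ 5"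
  shows "(m ** u ** matrix_inv m) $ 5 $ 1 = \<mu> * (x * u$5$1 + y * u$5$2)"
proof -
  have "matrix_inv m *v e1 = vec7 x y 0 0 0 0 0"
    using matrix_inv_cancel_vec(1)[OF m(2), of "vec7 x y 0 0 0 0 0"] unfolding m(1) .
  then have "((m ** u ** matrix_inv m) *v e1) $ 5 = \<mu> * (x * u$5$1 + y * u$5$2)"
    by (simp add: m5 U_max_plane12[OF u] del: mult_vec7_basis)
  then show ?thesis by (simp only: mult_vec7_basis)
qed

lemma fifth_coordinate:
  "(x_neg_b r *v v) $ 5 = v $ (5::7)" "(w_b *v v) $ 5 = v $ (5::7)" "(h_diag a b *v v) $ 5 = a * b * v $ (5::7)"
  by (subst vec7_eta[of v, symmetric], simp)+

text \<open>The entries (5,1) and (5,2) are, up to sign, the coordinates of \<alpha> and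
  \<alpha>+\<beta> on \<open>V_b\<close>. The Levi subgroup of \<beta> acts on this pair and is
  transitive on its nonzero linear forms.\<close>

lemma V_b_characters_conjugate:
  fixes c d :: 'k
  assumes "(c, d) \<noteq> (0, 0)"
  shows "\<exists>m\<in>G2 \<inter> P_tilde. normalizes m V_b \<and>
    (\<forall>u\<in>V_b. (m ** u ** matrix_inv m) $ 5 $ 1 = c * u$5$1 + d * u$5$2)"
proof (cases "c = 0")
  case False
  \<comment> \<open>Chosen so that the inverse of \<open>?m\<close> sends \<open>e1\<close> to
    \<open>e1\<close> plus d/c times \<open>e2\<close>, while coordinate 5 is scaled by c; this
    produces the form with coefficients c and d.\<close>
  let ?m = "h_diag 1 c ** x_neg_b (- d / c)"
  have m: "?m *v vec7 1 (d / c) 0 0 0 0 0 = e1" "invertible ?m" "\<And>v. (?m *v v) $ 5 = c * v $ 5"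
    using False by (simp_all add: invertible_mult fifth_coordinate)
  show ?thesis
  proof (intro bexI conjI ballI)
    show "normalizes ?m V_b"
      by (intro normalizes_mult normalizes_h_diag normalizes_x_b) (use False in auto)
    show "(?m ** u ** matrix_inv ?m) $ 5 $ 1 = c * u$5$1 + d * u$5$2" if "u \<in> V_b" for u
    proof -
      have "c * (1 * a + d / c * b) = c * a + d * b" for a b using False by (simp add: field_simps)
      then show ?thesis using conj_entry_51[OF m(1,2) G2I(4)[OF that] m(3)] by (simp only:)
    qed
  qed (use False h_diag_in_G2[of 1 c] h_diag_P_tilde[of 1 c] x_neg_b_P_tilde P_tilde_mult in auto)
next
  case True
  then have d: "d \<noteq> 0" using assms by simp
  let ?m = "h_diag 1 d ** w_b"
  have m: "?m *v vec7 0 1 0 0 0 0 0 = e1" "invertible ?m" "\<And>v. (?m *v v) $ 5 = d * v $ 5"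
    using d by (simp_all add: invertible_mult fifth_coordinate)
  show ?thesis
  proof (intro bexI conjI ballI)
    show "normalizes ?m V_b"
      by (intro normalizes_mult normalizes_h_diag normalizes_w) (use d in auto)
    show "(?m ** u ** matrix_inv ?m) $ 5 $ 1 = c * u$5$1 + d * u$5$2" if "u \<in> V_b" for u
      using conj_entry_51[OF m(1,2) G2I(4)[OF that] m(3)] True by simp
  qed (use d h_diag_in_G2[of 1 d] h_diag_P_tilde[of 1 d] w_b_P_tilde P_tilde_mult in auto)
qed

definition q :: complex where "q = of_nat (card (UNIV :: 'k set))"

lemma q_nonzero: "q \<noteq> 0"
  by (simp add: q_def)

text \<open>Fourier inversion over the characters of \<open>V_b\<close> that factor through its two coordinates
  \<open>(5,1)\<close> and \<open>(5,2)\<close>: the trivial one drops out by cuspidality along \<open>V_b\<close>, and the others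
  are conjugate under \<open>G2 \<inter> P_tilde\<close>.\<close>

lemma \<beta>_expansion:
  "\<exists>K m. (\<forall>z\<in>- {(0, 0)}. m z \<in> G2 \<inter> P_tilde) \<and>
     (\<forall>v t. \<beta> v t = K * (\<Sum>z\<in>- {(0::'k, 0::'k)}. E (\<tau> (res2 (m z)) t) (\<rho> (m z) v)))"
proof -
  let ?S = "{u \<in> V_b. u$5$1 = 0 \<and> u$5$2 = (0::'k)}"
  have "\<exists>m. \<forall>z\<in>- {(0, 0)}. m z \<in> G2 \<inter> P_tilde \<and> normalizes (m z) V_b \<and>
    (\<forall>u\<in>V_b. (m z ** u ** matrix_inv (m z)) $ 5 $ 1 = fst z * u$5$1 + snd z * (u$5$2 :: 'k))"
  proof (rule bchoice, rule ballI)
    fix z :: "'k \<times> 'k" assume "z \<in> - {(0, 0)}"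
    then have "(fst z, snd z) \<noteq> (0, 0)" by auto
    from V_b_characters_conjugate[OF this]
    show "\<exists>m. m \<in> G2 \<inter> P_tilde \<and> normalizes m V_b \<and>
      (\<forall>u\<in>V_b. (m ** u ** matrix_inv m) $ 5 $ 1 = fst z * u$5$1 + snd z * u$5$2)" by blast
  qed
  then obtain m where mm: "\<forall>z\<in>- {(0, 0)}. m z \<in> G2 \<inter> P_tilde \<and> normalizes (m z) V_b \<and>
    (\<forall>u\<in>V_b. (m z ** u ** matrix_inv (m z)) $ 5 $ 1 = fst z * u$5$1 + snd z * (u$5$2 :: 'k))"
    by (rule exE)
  then have m: "\<And>z. z \<noteq> (0, 0) \<Longrightarrow> m z \<in> G2" "\<And>z. z \<noteq> (0, 0) \<Longrightarrow> m z \<in> P_tilde"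
    "\<And>z. z \<noteq> (0, 0) \<Longrightarrow> normalizes (m z) V_b"
    "\<And>z u. z \<noteq> (0, 0) \<Longrightarrow> u \<in> V_b \<Longrightarrow>
      (m z ** u ** matrix_inv (m z)) $ 5 $ 1 = fst z * u$5$1 + snd z * (u$5$2 :: 'k)" by blast+
  define \<Phi> where "\<Phi> z v t = (\<Sum>u\<in>V_b. \<psi> (fst z * u$5$1 + snd z * u$5$2) * \<beta> (\<rho> u v) t)" for z v t
  have V_b_51: "(u ** u') $ 5 $ 1 = u$5$1 + u'$5$1" if "u \<in> V_b" "u' \<in> V_b" for u u' :: "'k^7^7"
    using that by (simp add: U_max_mult_entries G2I)
  have \<Phi>0: "\<Phi> (0, 0) v t = 0" for v t
  proof -
    have lin: "Vector_Spaces.linear sV (*) (\<lambda>v. \<Phi> (0, 0) v t)"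
      unfolding \<Phi>_def by (rule weighted_sum_linear) (rule subgroups_subset_G2)
    show ?thesis
    proof (rule cuspidal_functional[OF _ _ lin, of V_b "mat 1"])
      fix n v assume n: "n \<in> (V_b :: ('k^7^7) set)"
      have one: "mat 1 ** n ** matrix_inv (mat 1) = n" by (simp add: matrix_inv_eqI)
      have "1 * (\<Sum>u\<in>V_b. 1 * \<beta> (\<rho> u (\<rho> n v)) t) = (\<Sum>u\<in>V_b. 1 * \<beta> (\<rho> u v) t)"
        by (rule weighted_sum_translate[OF matrix_group_V_b _ n]) (auto intro: subgroups_subset_G2 G2I)
      then show "\<Phi> (0, 0) (\<rho> (mat 1 ** n ** matrix_inv (mat 1)) v) t = \<Phi> (0, 0) v t"
        unfolding one by (simp add: \<Phi>_def \<psi>_zero)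
    qed simp_all
  qed
  have \<Phi>: "\<Phi> z v t = E (\<tau> (res2 (m z)) t) (\<rho> (m z) v)" if "z \<noteq> (0, 0)" for z v t
    unfolding \<Phi>_def E_def
    by (rule weighted_sum_conj[OF m(1,2,3)]) (use that m(4) G2I in auto)
  have "(\<Sum>z\<in>UNIV. \<Phi> z v t) = q * q * of_nat (card ?S) * \<beta> v t" for v t
  proof -
    have "(\<Sum>z\<in>UNIV. \<Phi> z v t) =
        (\<Sum>u\<in>V_b. (\<Sum>z\<in>UNIV. \<psi> (fst z * u$5$1 + snd z * u$5$2)) * \<beta> (\<rho> u v) t)"
      unfolding \<Phi>_def sum_distrib_right by (rule sum.swap)
    also have "\<dots> = (\<Sum>u\<in>V_b. (\<Sum>c\<in>UNIV. \<psi> (c * u$5$1)) * (\<Sum>d\<in>UNIV. \<psi> (d * u$5$2)) * \<beta> (\<rho> u v) t)"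
      by (simp add: \<psi>_add sum_product sum.cartesian_product UNIV_Times_UNIV[symmetric] case_prod_unfold del: UNIV_Times_UNIV)
    also have "\<dots> = (\<Sum>u\<in>V_b. if u$5$1 = 0 \<and> u$5$2 = 0 then q * q * \<beta> (\<rho> u v) t else 0)"
      by (rule sum.cong) (auto simp: sum_additive_character[OF \<psi>] q_def)
    also have "\<dots> = (\<Sum>u\<in>?S. q * q * \<beta> (\<rho> u v) t)"
      by (rule sum.mono_neutral_cong_right) auto
    also have "\<dots> = (\<Sum>u\<in>?S. q * q * \<beta> v t)"
    proof (rule sum.cong[OF refl])
      fix u :: "'k^7^7" assume u: "u \<in> ?S"
      then have uU: "u \<in> U_max" and u12: "u$1$2 = 0" using G2I V_b_entry by auto
      \<comment> \<open>The elements surviving orthogonality fix \<open>e1\<close> and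
        \<open>e2\<close>, so \<open>\<beta>\<close> does not see them and each contributes the same
        term.\<close>
      have "u \<in> P_tilde" "res2 u = mat 1"
        using P_tildeI[of u 1 0 0 1] U_max_columns[OF uU] u u12 G2I(1)[OF uU] G2_subset_SO
        by (auto simp: vector_mat_1)
      then show "q * q * \<beta> (\<rho> u v) t = q * q * \<beta> v t"
        using \<beta>_inv[OF G2I(1)[OF uU], of v t] by (simp add: \<tau>_one)
    qed
    finally show ?thesis by simp
  qed
  moreover have "(\<Sum>z\<in>UNIV. \<Phi> z v t) = (\<Sum>z\<in>- {(0, 0)}. \<Phi> z v t)" for v t
    by (rule sum.mono_neutral_right) (auto simp: \<Phi>0)
  moreover have "card ?S \<noteq> 0"
  proof -
    have "mat 1 \<in> ?S" using matrix_groupD(1)[OF matrix_group_V_b] by (simp, simp add: mat_def)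
    then have "?S \<noteq> {}" by blast
    moreover have "finite ?S" by (rule finite)
    ultimately show ?thesis using card_0_eq by blast
  qed
  ultimately have eq: "q * q * of_nat (card ?S) * \<beta> v t = (\<Sum>z\<in>- {(0, 0)}. \<Phi> z v t)"
    and nz: "q * q * of_nat (card ?S) \<noteq> 0" for v t
    using q_nonzero by simp_all
  have inv: "b = inverse a * (a * b)" if "a \<noteq> 0" for a b :: complex
    using that by simp
  have \<beta>_eq: "\<beta> v t = inverse (q * q * of_nat (card ?S)) * (\<Sum>z\<in>- {(0, 0)}. \<Phi> z v t)" for v t
    unfolding eq[symmetric] by (rule inv[OF nz])
  have \<Phi>_eq: "(\<Sum>z\<in>- {(0, 0)}. \<Phi> z v t) = (\<Sum>z\<in>- {(0, 0)}. E (\<tau> (res2 (m z)) t) (\<rho> (m z) v))" for v t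
    by (rule sum.cong) (auto simp: \<Phi>)
  show ?thesis
  proof (intro exI conjI allI)
    show "\<forall>z\<in>- {(0, 0)}. m z \<in> G2 \<inter> P_tilde" using m(1,2) by blast
    show "\<beta> v t = inverse (q * q * of_nat (card ?S)) *
        (\<Sum>z\<in>- {(0, 0)}. E (\<tau> (res2 (m z)) t) (\<rho> (m z) v))" for v t
      unfolding \<beta>_eq \<Phi>_eq ..
  qed
qed

text \<open>The same for the extensions to \<open>U_max\<close> of the character defining \<open>E\<close>; here the
  degenerate one drops out by cuspidality along \<open>V_a\<close>.\<close>

lemma E_expansion:
  "E t v = inverse q * (\<Sum>c\<in>- {0}. L (\<tau> (res2 (h_diag c 1)) t) (\<rho> (h_diag c 1) v))"
proof -
  define \<Phi> where "\<Phi> c v t = (\<Sum>u\<in>U_max. \<psi> (u$5$1 - c * u$1$2) * \<beta> (\<rho> u v) t)" for c v t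
  have \<Phi>0: "\<Phi> 0 v t = 0" for v t
  proof -
    have lin: "Vector_Spaces.linear sV (*) (\<lambda>v. \<Phi> 0 v t)"
      unfolding \<Phi>_def by (rule weighted_sum_linear) (rule subgroups_subset_G2)
    show ?thesis
    proof (rule cuspidal_functional[OF _ _ lin, of V_a "mat 1"])
      fix n v assume n: "n \<in> (V_a :: ('k^7^7) set)"
      have one: "mat 1 ** n ** matrix_inv (mat 1) = n" by (simp add: matrix_inv_eqI)
      have "1 * (\<Sum>u\<in>U_max. \<psi> (u$5$1) * \<beta> (\<rho> u (\<rho> n v)) t) = (\<Sum>u\<in>U_max. \<psi> (u$5$1) * \<beta> (\<rho> u v) t)"
        by (rule weighted_sum_translate[OF matrix_group_U_max])
          (use n in \<open>auto intro: G2I simp: U_max_mult_entries G2I V_a_entry\<close>)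
      then show "\<Phi> 0 (\<rho> (mat 1 ** n ** matrix_inv (mat 1)) v) t = \<Phi> 0 v t"
        unfolding one by (simp add: \<Phi>_def)
    qed simp_all
  qed
  have \<Phi>: "\<Phi> c v t = L (\<tau> (res2 (h_diag c 1)) t) (\<rho> (h_diag c 1) v)" if c: "c \<noteq> 0" for c v t
    unfolding \<Phi>_def L_def
  proof (rule weighted_sum_conj)
    fix u :: "'k^7^7" assume u: "u \<in> U_max"
    \<comment> \<open>This torus element scales the root \<beta> by c and acts trivially on
      \<alpha>, so all nontrivial extensions become the one in \<open>L\<close>.\<close>
    let ?m = "h_diag c 1 :: 'k^7^7"
    have "((?m ** u ** matrix_inv ?m) *v e1) $ 5 = u$5$1" "((?m ** u ** matrix_inv ?m) *v e2) $ 1 = c * u$1$2"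
      using c by (simp_all add: U_max_plane12[OF u] del: mult_vec7_basis)
    then show "\<psi> ((?m ** u ** matrix_inv ?m) $ 5 $ 1 - (?m ** u ** matrix_inv ?m) $ 1 $ 2) = \<psi> (u$5$1 - c * u$1$2)"
      by (simp only: mult_vec7_basis)
  qed (use c h_diag_in_G2[of c 1] h_diag_P_tilde[of c 1] normalizes_h_diag[of c 1] subgroups_subset_G2 in auto)
  have "(\<Sum>c\<in>UNIV. \<Phi> c v t) = (\<Sum>u\<in>U_max. (\<Sum>c\<in>UNIV. \<psi> (u$5$1 - c * u$1$2)) * \<beta> (\<rho> u v) t)"
    unfolding \<Phi>_def sum_distrib_right by (rule sum.swap)
  also have "\<dots> = (\<Sum>u\<in>U_max. \<psi> (u$5$1) * (\<Sum>c\<in>UNIV. \<psi> (c * (- u$1$2))) * \<beta> (\<rho> u v) t)"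
    by (simp add: sum_distrib_left \<psi>_add[symmetric])
  also have "\<dots> = (\<Sum>u\<in>U_max. if u$1$2 = 0 then \<psi> (u$5$1) * q * \<beta> (\<rho> u v) t else 0)"
    unfolding sum_additive_character[OF \<psi>] by (rule sum.cong) (auto simp: q_def)
  also have "\<dots> = (\<Sum>u\<in>V_b. \<psi> (u$5$1) * q * \<beta> (\<rho> u v) t)"
    by (rule sum.mono_neutral_cong_right) (auto simp: V_b_iff)
  also have "\<dots> = q * E t v" unfolding E_def sum_distrib_left by (simp add: mult_ac)
  finally have "q * E t v = (\<Sum>c\<in>- {0}. \<Phi> c v t)"
    by (subst (asm) sum.mono_neutral_right[of UNIV "- {0}"]) (auto simp: \<Phi>0)
  also have "\<dots> = (\<Sum>c\<in>- {0}. L (\<tau> (res2 (h_diag c 1)) t) (\<rho> (h_diag c 1) v))"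
    by (rule sum.cong) (auto simp: \<Phi>)
  finally show ?thesis using q_nonzero by (simp add: field_simps)
qed

lemma L_Hom_char: "L t \<in> Hom_char sV U_max \<rho> (psi_U \<psi>)"
proof -
  have "Vector_Spaces.linear sV (*) (L t)"
    unfolding L_def[abs_def] by (rule weighted_sum_linear) (rule subgroups_subset_G2)
  moreover have "L t (\<rho> h v) = psi_U \<psi> h * L t v" if h: "h \<in> U_max" for h v
  proof -
    have *: "\<psi> (h$5$1 - h$1$2) * L t (\<rho> h v) = L t v" unfolding L_def
      by (rule weighted_sum_translate[OF matrix_group_U_max _ h])
        (use h in \<open>auto intro: G2I simp: U_max_mult_entries add_diff_add \<psi>_add\<close>)
    have "psi_U \<psi> h * \<psi> (h$5$1 - h$1$2) = 1"
      unfolding psi_U_eq[OF \<psi> h] \<psi>_add[symmetric] by (simp add: \<psi>_zero)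
    then show ?thesis unfolding *[symmetric] mult.assoc[symmetric] by simp
  qed
  ultimately show ?thesis by (simp add: Hom_char_def)
qed

lemma L_right: "L (t + t') v = L t v + L t' v" "L (sT c t) v = c * L t v"
  by (simp_all add: L_def \<beta>_right distrib_left sum.distrib sum_distrib_left mult.left_commute)

text \<open>\<open>x_b\<close> acts on the plane through \<open>N_GL2\<close>. Translating the
  summation variable by it removes the action on t at the price of a value of the character, so
  \<open>L\<close> is a Whittaker functional in each variable, for inverse characters.\<close>

lemma L_N_GL2:
  assumes "n \<in> N_GL2"
  shows "L (\<tau> n t) v = inverse (\<psi> (n $ 1 $ 2)) * L t v"
proof -
  obtain x where n: "n = vector [vector [1, x], vector [0, 1]]" using assms by (auto simp: N_GL2_def)
  have res: "res2 (x_b x) = n" by (simp add: x_b_P_tilde n)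
  have x: "x_b x \<in> U_max" by simp
  let ?F = "\<lambda>u. \<psi> (u$5$1 - u$1$2) * \<beta> (\<rho> u v) (\<tau> n t)"
  have "L (\<tau> n t) v = (\<Sum>u\<in>U_max. ?F (x_b x ** u))"
    unfolding L_def by (rule matrix_group_finite_sum_left(1)[OF matrix_group_U_max x, symmetric])
  also have "\<dots> = (\<Sum>u\<in>U_max. \<psi> (- x) * (\<psi> (u$5$1 - u$1$2) * \<beta> (\<rho> u v) t))"
  proof (rule sum.cong[OF refl])
    fix u :: "'k^7^7" assume u: "u \<in> U_max"
    have "\<beta> (\<rho> (x_b x ** u) v) (\<tau> n t) = \<beta> (\<rho> u v) t"
      using \<beta>_inv[OF x_in_G2(3) x_b_P_tilde(1), of x "\<rho> u v" t] G2I(1)[OF u]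
      by (simp add: \<rho>_mult res)
    then show "?F (x_b x ** u) = \<psi> (- x) * (\<psi> (u$5$1 - u$1$2) * \<beta> (\<rho> u v) t)"
      using \<psi>_add[of "- x" "u$5$1 - u$1$2"] u by (simp add: U_max_mult_entries algebra_simps)
  qed
  also have "\<dots> = \<psi> (- x) * L t v" by (simp add: L_def sum_distrib_left)
  also have "\<psi> (- x) = inverse (\<psi> x)"
    using \<psi>_add[of x "- x"] \<psi>_zero by (metis add.right_inverse inverse_unique)
  finally show ?thesis by (simp add: n)
qed

text \<open>Uniqueness in each variable makes \<open>L t v\<close> a fixed multiple of \<Lambda> t
  times l v. The expansions express \<open>\<beta>\<close>, and with it \<open>B\<close>, by
  translates of \<open>L\<close>, and equivariance of \<open>\<xi>\<close> absorbs the translations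
  into the sum over \<open>G2\<close>.\<close>

theorem uniqueness:
  assumes l_unique: "\<And>l'. l' \<in> Hom_char sV U_max \<rho> (psi_U \<psi>) \<Longrightarrow> \<exists>c. \<forall>v. l' v = c * l v"
    and \<Lambda>_unique: "\<And>\<Lambda>'. \<Lambda>' \<in> Hom_char sT N_GL2 \<tau> (\<lambda>n. inverse (\<psi> (n $ 1 $ 2))) \<Longrightarrow> \<exists>c. \<forall>t. \<Lambda>' t = c * \<Lambda> t"
    and l0: "l \<noteq> (\<lambda>_. 0)"
  shows "\<exists>c. \<forall>v. \<forall>\<xi>\<in>Ind \<tau>. B v \<xi> = c * (\<Sum>g\<in>G2. l (\<rho> g v) * \<Lambda> (\<xi> g))"
proof -
  obtain v0 where v0: "l v0 \<noteq> 0" using l0 by auto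
  define C where "C t = L t v0 / l v0" for t
  have LC: "L t v = C t * l v" for t v
  proof -
    obtain c where "\<And>v. L t v = c * l v" using l_unique[OF L_Hom_char] by blast
    then show ?thesis using v0 by (simp add: C_def)
  qed
  have "C \<in> Hom_char sT N_GL2 \<tau> (\<lambda>n. inverse (\<psi> (n $ 1 $ 2)))"
  proof -
    obtain T where "finite_dimensional_vector_space sT T" using repT by (auto simp: representation_def)
    then have "vector_space sT" by (simp add: finite_dimensional_vector_space_def)
    moreover have "vector_space ((*) :: complex \<Rightarrow> complex \<Rightarrow> complex)"
      using B_lin by (simp add: Vector_Spaces.linear_iff)
    ultimately have "Vector_Spaces.linear sT (*) C"
      unfolding Vector_Spaces.linear_iff by (simp add: C_def L_right add_divide_distrib)
    then show ?thesis by (simp add: Hom_char_def C_def L_N_GL2)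
  qed
  from \<Lambda>_unique[OF this] obtain \<kappa> where \<kappa>: "\<And>t. C t = \<kappa> * \<Lambda> t" by blast
  let ?W = "\<lambda>v \<xi>. \<Sum>g\<in>G2. l (\<rho> g v) * \<Lambda> (\<xi> g)"
  \<comment> \<open>The property handed down through the expansions: summing F over
    \<open>G2\<close> gives a multiple of the standard sum, with a factor independent of v and
    \<open>\<xi>\<close>.\<close>
  define good where "good F \<longleftrightarrow> (\<exists>a. \<forall>v. \<forall>\<xi>\<in>Ind \<tau>. (\<Sum>g\<in>G2. F (\<rho> g v) (\<xi> g)) = a * ?W v \<xi>)"
    for F :: "'v \<Rightarrow> 't \<Rightarrow> complex"
  have good_L: "good (\<lambda>v t. L t v)" unfolding good_def
    by (intro exI[of _ \<kappa>]) (simp add: LC \<kappa> sum_distrib_left mult_ac)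
  have good_sum: "good (\<lambda>v t. \<Sum>i\<in>I. F i v t)" if F: "\<And>i. i \<in> I \<Longrightarrow> good (F i)"
    for I and F :: "'i \<Rightarrow> 'v \<Rightarrow> 't \<Rightarrow> complex"
  proof -
    have "\<forall>i\<in>I. \<exists>a. \<forall>v. \<forall>\<xi>\<in>Ind \<tau>. (\<Sum>g\<in>G2. F i (\<rho> g v) (\<xi> g)) = a * ?W v \<xi>"
      using F unfolding good_def by blast
    then obtain a where "\<forall>i\<in>I. \<forall>v. \<forall>\<xi>\<in>Ind \<tau>. (\<Sum>g\<in>G2. F i (\<rho> g v) (\<xi> g)) = a i * ?W v \<xi>"
      by (rule bchoice[THEN exE])
    then have a: "(\<Sum>i\<in>I. \<Sum>g\<in>G2. F i (\<rho> g v) (\<xi> g)) = (\<Sum>i\<in>I. a i) * ?W v \<xi>" if "\<xi> \<in> Ind \<tau>" for v \<xi>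
      unfolding sum_distrib_right using that by (intro sum.cong) auto
    show ?thesis unfolding good_def
      by (intro exI[of _ "\<Sum>i\<in>I. a i"] allI ballI) (subst sum.swap, rule a)
  qed
  have good_scale: "good (\<lambda>v t. c * F v t)" if F: "good F" for c F
  proof -
    obtain a where "\<forall>v. \<forall>\<xi>\<in>Ind \<tau>. (\<Sum>g\<in>G2. F (\<rho> g v) (\<xi> g)) = a * ?W v \<xi>"
      using F unfolding good_def by blast
    then show ?thesis unfolding good_def by (intro exI[of _ "c * a"]) (simp flip: sum_distrib_left)
  qed
  have good_translate: "good (\<lambda>v t. F (\<rho> m v) (\<tau> (res2 m) t))"
    if F: "good F" and m: "m \<in> G2" "m \<in> P_tilde" for F m
  proof -
    obtain a where a: "\<And>v \<xi>. \<xi> \<in> Ind \<tau> \<Longrightarrow> (\<Sum>g\<in>G2. F (\<rho> g v) (\<xi> g)) = a * ?W v \<xi>"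
      using F unfolding good_def by blast
    have "(\<Sum>g\<in>G2. F (\<rho> m (\<rho> g v)) (\<tau> (res2 m) (\<xi> g))) = a * ?W v \<xi>" if \<xi>: "\<xi> \<in> Ind \<tau>" for v \<xi>
    proof -
      \<comment> \<open>Equivariance turns the action of \<open>res2 m\<close> on
        \<open>\<xi> g\<close> into \<open>\<xi> (m ** g)\<close>, and then m disappears by
        reindexing.\<close>
      have "(\<Sum>g\<in>G2. F (\<rho> m (\<rho> g v)) (\<tau> (res2 m) (\<xi> g))) = (\<Sum>g\<in>G2. F (\<rho> (m ** g) v) (\<xi> (m ** g)))"
      proof (rule sum.cong[OF refl])
        fix g :: "'k^7^7" assume g: "g \<in> G2"
        then have "g \<in> SO Q7" using G2_subset_SO by blast
        from Ind_P_tilde[OF \<xi> m(2) this char]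
        show "F (\<rho> m (\<rho> g v)) (\<tau> (res2 m) (\<xi> g)) = F (\<rho> (m ** g) v) (\<xi> (m ** g))"
          using g m(1) by (simp add: \<rho>_mult)
      qed
      also have "\<dots> = (\<Sum>g\<in>G2. F (\<rho> g v) (\<xi> g))"
        by (rule matrix_group_finite_sum_left(1)[OF matrix_group_G2 m(1), of "\<lambda>g. F (\<rho> g v) (\<xi> g)"])
      finally show ?thesis using a[OF \<xi>] by simp
    qed
    then show ?thesis unfolding good_def by blast
  qed
  have good_E: "good (\<lambda>v t. E t v)"
    unfolding E_expansion
    by (intro good_scale good_sum good_translate[OF good_L] h_diag_in_G2 h_diag_P_tilde) auto
  obtain K m where m: "\<forall>z\<in>- {(0, 0)}. m z \<in> G2 \<inter> P_tilde"
    and "\<forall>v t. \<beta> v t = K * (\<Sum>z\<in>- {(0::'k, 0::'k)}. E (\<tau> (res2 (m z)) t) (\<rho> (m z) v))"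
    using \<beta>_expansion by blast
  then have \<beta>_eq: "\<beta> = (\<lambda>v t. K * (\<Sum>z\<in>- {(0::'k, 0::'k)}. E (\<tau> (res2 (m z)) t) (\<rho> (m z) v)))"
    by (intro ext) blast
  have "good \<beta>" unfolding \<beta>_eq
    by (intro good_scale good_sum good_translate[OF good_E]) (use m in auto)
  then obtain a where a: "\<And>v \<xi>. \<xi> \<in> Ind \<tau> \<Longrightarrow> (\<Sum>g\<in>G2. \<beta> (\<rho> g v) (\<xi> g)) = a * ?W v \<xi>"
    unfolding good_def by blast
  let ?n = "of_nat (card (G2 \<inter> P_tilde :: ('k^7^7) set)) :: complex"
  have "mat 1 \<in> G2 \<inter> (P_tilde :: ('k^7^7) set)" using one_P_tilde(1) by simp
  then have "G2 \<inter> (P_tilde :: ('k^7^7) set) \<noteq> {}" by blast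
  moreover have "finite (G2 \<inter> (P_tilde :: ('k^7^7) set))" by (rule finite)
  ultimately have "?n \<noteq> 0" using card_0_eq of_nat_eq_0_iff by blast
  then have "B v \<xi> = (a / ?n) * ?W v \<xi>" if "\<xi> \<in> Ind \<tau>" for v \<xi>
    using B_eq_sum_\<beta>[OF that, of v] a[OF that, of v] by (simp add: field_simps)
  then show ?thesis by blast
qed

end

section \<open>Multiplicity one for \<open>GL\<^sub>2\<close> and \<open>G2\<close>\<close>

lemma N_GL2_elem: "n \<in> N_GL2 \<longleftrightarrow> n $ 1 $ 1 = 1 \<and> n $ 2 $ 1 = 0 \<and> n $ 2 $ 2 = 1"
  by (auto simp: N_GL2_def image_iff vec_eq_iff forall_2)

abbreviation n2 :: "'k::field \<Rightarrow> 'k^2^2" where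
  "n2 x \<equiv> vector [vector [1, x], vector [0, 1]]"

lemma n2_add: "n2 x ** n2 y = n2 (x + y)"
  by (simp add: vec_eq_iff forall_2 matrix_matrix_mult_def sum_2 add.commute)

lemma n2_zero: "n2 0 = mat 1"
  by (simp add: vec_eq_iff forall_2)

lemma n2_inv: "invertible (n2 x)" "matrix_inv (n2 x) = n2 (- x)"
  using n2_add[of x "- x"] by (auto simp: n2_zero intro: invertibleI matrix_inv_eqI)

lemma matrix_group_N_GL2: "matrix_group (N_GL2 :: ('k::field^2^2) set)"
  unfolding matrix_group_def
proof (intro conjI ballI)
  show "mat 1 \<in> (N_GL2 :: ('k^2^2) set)" by (simp add: N_GL2_elem)
  fix g :: "'k^2^2" assume "g \<in> N_GL2"
  then obtain x where g: "g = n2 x" by (auto simp: N_GL2_def)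
  show "invertible g" "matrix_inv g \<in> N_GL2" unfolding g by (simp_all only: n2_inv) (simp add: N_GL2_elem)
  fix g' :: "'k^2^2" assume "g' \<in> N_GL2"
  then obtain y where g': "g' = n2 y" by (auto simp: N_GL2_def)
  show "g ** g' \<in> N_GL2" unfolding g g' n2_add by (simp add: N_GL2_elem)
qed

text \<open>Transposition about the antidiagonal: it reverses products and fixes
  \<open>N_GL2\<close> pointwise.\<close>

definition theta2 :: "'k::field^2^2 \<Rightarrow> 'k^2^2" where
  "theta2 a = vector [vector [a$2$2, a$1$2], vector [a$2$1, a$1$1]]"

lemma theta2_mult: "theta2 (a ** b) = theta2 b ** theta2 a"
  by (simp add: theta2_def vec_eq_iff forall_2 matrix_matrix_mult_def sum_2 algebra_simps)

lemma multiplicity_cond_GL2: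
  fixes \<psi> :: "'k::field \<Rightarrow> complex"
  assumes \<psi>: "nontrivial_additive_character \<psi>" and a: "invertible a"
  shows "multiplicity_cond N_GL2 (\<lambda>n. inverse (\<psi> (n $ 1 $ 2))) theta2 a"
proof -
  have \<psi>_add: "\<psi> (x + y) = \<psi> x * \<psi> y" "\<psi> 0 = 1" for x y
    using \<psi> by (auto simp: nontrivial_additive_character_def)
  have nN: "n2 x \<in> N_GL2" for x :: 'k by (simp add: N_GL2_elem)
  have d: "a$1$1 * a$2$2 - a$1$2 * a$2$1 \<noteq> 0" using a by (simp add: invertible_det_nz det_2)
  show ?thesis
  proof (cases "a$2$1 = 0")
    case False
    \<comment> \<open>Conjugation by \<open>n2 ?t\<close> exchanges the diagonal entries, since the
      new (1,1) entry is that of a plus \<open>?t\<close> times the (2,1) entry; the off-diagonal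
      entries are unchanged.\<close>
    let ?t = "(a$2$2 - a$1$1) / a$2$1"
    have "theta2 a = n2 ?t ** a ** n2 (- ?t)"
      using False by (simp add: theta2_def vec_eq_iff forall_2 matrix_matrix_mult_def sum_2 field_simps)
    moreover have "inverse (\<psi> (n2 ?t $ 1 $ 2)) * inverse (\<psi> (n2 (- ?t) $ 1 $ 2)) = 1"
      using \<psi>_add(1)[of ?t "- ?t"] \<psi>_add(2) by (simp flip: inverse_mult_distrib)
    ultimately show ?thesis using nN unfolding multiplicity_cond_def by blast
  next
    case 0: True
    then have nz: "a$1$1 \<noteq> 0" "a$2$2 \<noteq> 0" using d by auto
    show ?thesis
    proof (cases "a$1$1 = a$2$2")
      case True
      then have "theta2 a = mat 1 ** a ** mat 1" by (simp add: theta2_def vec_eq_iff forall_2)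
      moreover have "mat 1 \<in> (N_GL2 :: ('k^2^2) set)" by (simp add: N_GL2_elem)
      ultimately show ?thesis unfolding multiplicity_cond_def
        by (intro disjI1 bexI[of _ "mat 1"] conjI) (simp_all add: \<psi>_add)
    next
      case False
      then have "a$1$1 / a$2$2 \<noteq> 1" using nz by simp
      then obtain y where y: "\<psi> (a$1$1 / a$2$2 * y) \<noteq> \<psi> y" using character_separates[OF \<psi>] by blast
      have "n2 (a$1$1 / a$2$2 * y) ** a = a ** n2 y"
        using 0 nz by (simp add: vec_eq_iff forall_2 matrix_matrix_mult_def sum_2 field_simps)
      moreover have "inverse (\<psi> (n2 (a$1$1 / a$2$2 * y) $ 1 $ 2)) \<noteq> inverse (\<psi> (n2 y $ 1 $ 2))"
        using y by simp
      ultimately show ?thesis using nN unfolding multiplicity_cond_def by blast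
    qed
  qed
qed

lemma matrix_group_carrier_GL: "matrix_group (carrier GL :: ('k::field^'n^'n) set)"
  by (simp add: matrix_group_def carrier_GL invertible_mult invertible_matrix_inv)

lemma Whittaker_functional_unique_GL2:
  fixes \<psi> :: "'k::{field,finite} \<Rightarrow> complex"
  assumes \<psi>: "nontrivial_additive_character \<psi>"
    and irr: "irreducible_representation s (carrier GL) \<tau>"
    and \<Lambda>: "\<Lambda> \<in> Hom_char s N_GL2 \<tau> (\<lambda>n. inverse (\<psi> (n $ 1 $ 2)))" "\<Lambda> \<noteq> (\<lambda>_. 0)"
    and \<Lambda>': "\<Lambda>' \<in> Hom_char s N_GL2 \<tau> (\<lambda>n. inverse (\<psi> (n $ 1 $ 2)))"
  shows "\<exists>c. \<forall>t. \<Lambda>' t = c * \<Lambda> t"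
proof (rule multiplicity_one[OF irr matrix_group_carrier_GL matrix_group_N_GL2, where \<theta> = theta2, OF _ _ _ _ _ _ _ _ _ \<Lambda> \<Lambda>'])
  have \<psi>_add: "\<psi> (x + y) = \<psi> x * \<psi> y" "\<psi> 0 = 1" for x y
    using \<psi> by (auto simp: nontrivial_additive_character_def)
  show "N_GL2 \<subseteq> (carrier GL :: ('k^2^2) set)"
    using matrix_groupD(3)[OF matrix_group_N_GL2] by (auto simp: carrier_GL)
  show "inverse (\<psi> ((u ** u') $ 1 $ 2)) = inverse (\<psi> (u $ 1 $ 2)) * inverse (\<psi> (u' $ 1 $ 2))"
    if "u \<in> N_GL2" "u' \<in> N_GL2" for u u'
    using that by (simp add: N_GL2_elem matrix_matrix_mult_def sum_2 \<psi>_add mult.commute)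
  show "inverse (\<psi> ((mat 1 :: 'k^2^2) $ 1 $ 2)) = 1" by (simp add: \<psi>_add)
  show "theta2 g \<in> carrier GL" if "g \<in> carrier GL" for g :: "'k^2^2"
    using that by (simp add: carrier_GL invertible_det_nz det_2 theta2_def mult.commute)
  show "theta2 u \<in> N_GL2" "inverse (\<psi> (theta2 u $ 1 $ 2)) = inverse (\<psi> (u $ 1 $ 2))"
    "theta2 (theta2 u) = u" if "u \<in> N_GL2" for u :: "'k^2^2"
    using that by (simp_all add: N_GL2_elem theta2_def vec_eq_iff forall_2)
  show "theta2 (g ** g') = theta2 g' ** theta2 g" for g g' :: "'k^2^2" by (rule theta2_mult)
  show "multiplicity_cond N_GL2 (\<lambda>n. inverse (\<psi> (n $ 1 $ 2))) theta2 g" if "g \<in> carrier GL" for g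
    using that by (intro multiplicity_cond_GL2[OF \<psi>]) (simp add: carrier_GL)
qed

lemma Whittaker_functional_unique_G2:
  fixes \<psi> :: "'k::{field,finite} \<Rightarrow> complex"
  assumes \<psi>: "nontrivial_additive_character \<psi>"
    and irr: "irreducible_representation s G2 \<rho>"
    and l: "l \<in> Hom_char s U_max \<rho> (psi_U \<psi>)" "l \<noteq> (\<lambda>_. 0)"
    and l': "l' \<in> Hom_char s U_max \<rho> (psi_U \<psi>)"
  shows "\<exists>c. \<forall>v. l' v = c * l v"
proof (rule multiplicity_one[OF irr matrix_group_G2 matrix_group_U_max, where \<theta> = theta, OF _ _ _ _ _ _ _ _ _ l l'])
  show "U_max \<subseteq> (G2 :: ('k^7^7) set)" by (rule subgroups_subset_G2)
  show "psi_U \<psi> (u ** u') = psi_U \<psi> u * psi_U \<psi> u'" if "u \<in> U_max" "u' \<in> U_max" for u u'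
    by (rule psi_U_mult[OF \<psi> that])
  show "psi_U \<psi> (mat 1) = 1" by (rule psi_U_x[OF \<psi>])
  show "theta g \<in> G2" if "g \<in> G2" for g :: "'k^7^7" by (rule theta_G2[OF that])
  show "theta u \<in> U_max" if "u \<in> U_max" for u :: "'k^7^7" by (rule theta_U_max[OF that])
  show "psi_U \<psi> (theta u) = psi_U \<psi> u" if "u \<in> U_max" for u by (rule psi_U_theta[OF \<psi> that])
  show "theta (theta u) = u" if u: "u \<in> U_max" for u :: "'k^7^7"
  proof -
    have "theta (theta u) = (h_diag 1 (- 1) ** h_diag 1 (- 1)) ** u ** (h_diag 1 (- 1) ** h_diag 1 (- 1))"
      using invertible_U_max[OF u]
      by (simp add: theta_def matrix_inv_mult invertible_mult invertible_matrix_inv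
          matrix_inv_matrix_inv matrix_mul_assoc)
    then show ?thesis by (simp add: h_sq)
  qed
  show "theta (g ** g') = theta g' ** theta g" if "g \<in> G2" "g' \<in> G2" for g g' :: "'k^7^7"
    using that by (intro theta_mult invertible_G2)
  show "multiplicity_cond U_max (psi_U \<psi>) theta g" if "g \<in> G2" for g
    by (rule multiplicity_cond_G2[OF \<psi> that])
qed

section \<open>The functional equation\<close>

text \<open>Invariance makes the chosen representatives irrelevant, so the coset sum can be traded
  for a sum over the whole group, where reindexing is available.\<close>

lemma coset_sum_eq:
  fixes F :: "'k::{field,finite}^'n^'n \<Rightarrow> complex"
  assumes H: "matrix_group H" "H \<subseteq> G" and G: "matrix_group G"
    and F: "\<And>h g. h \<in> H \<Longrightarrow> g \<in> G \<Longrightarrow> F (h ** g) = F g"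
  shows "of_nat (card H) * coset_sum H G F = (\<Sum>g\<in>G. F g)"
proof -
  let ?C = "rcosets\<^bsub>GL\<lparr>carrier := G\<rparr>\<^esub> H"
  have coset: "H #>\<^bsub>GL\<^esub> a = (\<lambda>h. h ** a) ` H" for a
    by (auto simp: r_coset_def)
  have C: "?C = (\<lambda>a. (\<lambda>h. h ** a) ` H) ` G"
    by (auto simp: RCOSETS_def coset)
  note Hd = matrix_groupD[OF H(1)] and Gd = matrix_groupD[OF G]
  have inj: "inj_on (\<lambda>h. h ** a) H" if "a \<in> G" for a
    by (rule inj_onI) (metis Gd(3)[OF that] matrix_inv_cancel(3))
  have "\<Union>?C = G"
  proof (intro equalityI subsetI)
    fix x assume "x \<in> \<Union>?C"
    then obtain a h where "a \<in> G" "h \<in> H" "x = h ** a" unfolding C by blast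
    then show "x \<in> G" using H(2) Gd(2)[of h a] by blast
  next
    fix x assume "x \<in> G"
    moreover have "x \<in> (\<lambda>h. h ** x) ` H" using Hd(1) by (intro image_eqI[of _ _ "mat 1"]) simp_all
    ultimately show "x \<in> \<Union>?C" unfolding C by blast
  qed
  moreover have "A \<inter> A' = {}" if A: "A \<in> ?C" "A' \<in> ?C" "A \<noteq> A'" for A A'
  proof (rule ccontr)
    assume "A \<inter> A' \<noteq> {}"
    then obtain x where x: "x \<in> A" "x \<in> A'" by blast
    have eq: "B = (\<lambda>h. h ** x) ` H" if B: "B \<in> ?C" "x \<in> B" for B
    proof -
      obtain a h where ah: "a \<in> G" "B = (\<lambda>h. h ** a) ` H" "h \<in> H" "x = h ** a" using B unfolding C by blast
      have bij: "(\<lambda>k. k ** h) ` H = H" using matrix_group_mult_bij(2)[OF H(1) ah(3)] by (simp add: bij_betw_def)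
      have "(\<lambda>k. k ** x) ` H = (\<lambda>k. k ** a) ` ((\<lambda>k. k ** h) ` H)"
        unfolding image_image ah(4) by (simp add: matrix_mul_assoc)
      then show ?thesis unfolding bij ah(2) by simp
    qed
    show False using eq[OF A(1) x(1)] eq[OF A(2) x(2)] A(3) by simp
  qed
  ultimately have "(\<Sum>g\<in>G. F g) = (\<Sum>A\<in>?C. \<Sum>g\<in>A. F g)"
    using sum.Union_disjoint[of ?C F] by simp
  also have "\<dots> = (\<Sum>A\<in>?C. of_nat (card H) * F (SOME g. g \<in> A))"
  proof (rule sum.cong[OF refl])
    fix A assume "A \<in> ?C"
    then obtain a where a: "a \<in> G" "A = (\<lambda>h. h ** a) ` H" unfolding C by blast
    have const: "F g = F a" if "g \<in> A" for g using that a F by auto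
    have "A \<noteq> {}" using a Hd(1) by blast
    then have "(SOME g. g \<in> A) \<in> A" by (simp add: some_in_eq)
    then have "F (SOME g. g \<in> A) = F a" by (rule const)
    moreover have "(\<Sum>g\<in>A. F g) = of_nat (card A) * F a" by (simp add: const)
    moreover have "card A = card H" unfolding a(2) by (rule card_image[OF inj[OF a(1)]])
    ultimately show "(\<Sum>g\<in>A. F g) = of_nat (card H) * F (SOME g. g \<in> A)" by simp
  qed
  finally show ?thesis by (simp add: coset_sum_def sum_distrib_left)
qed

section \<open>Equivariance of the summands and of the intertwining sum\<close>

lemma U_H_induct [consumes 1, case_names one x_b other]:
  assumes "u \<in> U_H" "P (mat 1)"
    "\<And>r u. u \<in> U_H \<Longrightarrow> P u \<Longrightarrow> P (x_b r ** u)"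
    "\<And>r u x. u \<in> U_H \<Longrightarrow> P u \<Longrightarrow> x \<in> {x_2ab, x_3ab, x_3a2b} \<Longrightarrow> P (x r ** u)"
  shows "P u"
  by (rule generate_GL_induct_left[OF _ assms(1)[unfolded U_H_def]])
    (use assms in \<open>auto simp: U_H_def\<close>)

lemma x_H_P_tilde:
  assumes "x \<in> {x_2ab, x_3ab, x_3a2b}"
  shows "x r \<in> P_tilde" "res2 (x r) = mat 1"
proof -
  have "x r \<in> SO Q7" "x r *v e1 = e1" "x r *v e2 = e2" using assms G2_subset_SO by auto
  from P_tildeI[OF this] show "x r \<in> P_tilde" "res2 (x r) = mat 1" by (simp_all add: vector_mat_1)
qed

text \<open>The substitution that moves an element of the parabolic subgroup across the intertwining
  sum. Over a finite field injectivity suffices; that the image stays in \<open>U_tilde\<close> is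
  the ideal property of \<open>block_strict\<close>.\<close>

lemma U_tilde_translate_bij:
  fixes D :: "'k::{field,finite}^7^7"
  assumes D: "D \<in> SO Q7" "block_upper D" "block_upper (matrix_inv D)" and u0: "u0 \<in> U_tilde"
  shows "bij_betw (\<lambda>u. matrix_inv D ** u ** D ** u0) U_tilde U_tilde"
proof -
  let ?f = "\<lambda>u. matrix_inv D ** u ** D ** u0"
  have Di: "invertible D" and ui: "invertible u0"
    using D u0 invertible_SO by (auto simp: U_tilde_iff)
  have "?f u \<in> U_tilde" if u: "u \<in> U_tilde" for u
  proof -
    have e: "?f u - mat 1 = matrix_inv D ** (u - mat 1) ** D ** u0 + (u0 - mat 1)"
      by (simp add: matrix_diff_mult matrix_mul_assoc matrix_inv_left[OF Di])
    have "block_strict (?f u - mat 1)" unfolding e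
      using u u0 D U_tilde_upper[OF u0] by (intro block_strict_add block_strict_mult) (auto simp: U_tilde_iff)
    moreover have "?f u \<in> SO Q7" using u u0 D by (simp add: U_tilde_iff)
    ultimately show ?thesis by (simp only: U_tilde_iff)
  qed
  moreover have "inj_on ?f U_tilde"
  proof (rule inj_onI)
    fix u u' assume "?f u = ?f u'"
    then have "matrix_inv D ** u ** D = matrix_inv D ** u' ** D" by (metis matrix_inv_cancel(3)[OF ui])
    then have "matrix_inv D ** u = matrix_inv D ** u'" by (metis matrix_inv_cancel(3)[OF Di])
    then show "u = u'" by (metis matrix_inv_cancel(2)[OF Di])
  qed
  ultimately show ?thesis by (simp add: bij_betw_def endo_inj_surj image_subset_iff)
qed

lemma w2_vec7: "w2 *v vec7 v1 v2 v3 v4 v5 v6 v7 =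
    vec7 (- v6) (- v7) (- v5) (- v4) (- v3) (- v1) (- v2)"
proof -
  have inv: "matrix_inv w_a = w_a ** w_a ** (w_a :: 'a^7^7)" "matrix_inv w_b = w_b ** w_b ** (w_b :: 'a^7^7)"
    by (rule matrix_inv_eqI, rule matrix_eq_vec7I, simp)+
  show ?thesis unfolding w2_def inv by simp
qed

lemma w2_G2: "w2 \<in> (G2 :: ('k::field^7^7) set)"
  using h_diag_in_G2[of "1::'k" "- 1"] by (simp add: w2_def)

lemma star_one: "star (mat 1 :: 'k::field^2^2) = mat 1"
  by (simp add: star_eq matrix_inv_eqI transpose_mat J2_J2)

lemma star_n2: "star (n2 x) = n2 (- x)"
  unfolding star_eq n2_inv
  by (simp add: vec_eq_iff forall_2 matrix_matrix_mult_def sum_2 transpose_def J2_def)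

text \<open>\<open>w2\<close> exchanges the plane of \<open>e1\<close>, \<open>e2\<close> with the
  span of the last two basis vectors. Conjugation therefore brings the last diagonal block to the
  first place, and the signs cancel.\<close>

lemma w2_levi_conj:
  assumes a: "invertible a" and b: "b \<in> SO Q3"
  defines "z \<equiv> w2 ** levi a b ** matrix_inv w2"
  shows "z \<in> P_tilde" "res2 z = star a"
proof -
  have wi: "invertible (w2 :: 'a^7^7)" by (rule invertible_G2[OF w2_G2])
  have wS: "(w2 :: 'a^7^7) \<in> SO Q7" using w2_G2 G2_subset_SO by blast
  have "w2 *v vec7 0 0 0 0 0 (- 1) 0 = (e1 :: 'a^7)" "w2 *v vec7 0 0 0 0 0 0 (- 1) = (e2 :: 'a^7)"
    by (simp_all add: w2_vec7)
  then have w: "matrix_inv w2 *v (e1 :: 'a^7) = vec7 0 0 0 0 0 (- 1) 0"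
    "matrix_inv w2 *v (e2 :: 'a^7) = vec7 0 0 0 0 0 0 (- 1)"
    by (metis matrix_inv_cancel_vec(1)[OF wi])+
  have "z *v e1 = vec7 (star a $ 1 $ 1) (star a $ 2 $ 1) 0 0 0 0 0"
    "z *v e2 = vec7 (star a $ 1 $ 2) (star a $ 2 $ 2) 0 0 0 0 0"
    unfolding z_def by (simp_all add: w levi_eq w2_vec7)
  note z = this
  have "z \<in> SO Q7" unfolding z_def using Q7_levi(1)[OF a b] wS by simp
  from P_tildeI[OF this z] show "z \<in> P_tilde" "res2 z = star a"
    by (simp_all add: vec_eq_iff forall_2)
qed

text \<open>Write y as a Levi element D times u0 and substitute for u the conjugate of u by the
  inverse of D, times u0. Then D comes out on the left of \<open>w2\<close> as an element of
  \<open>P_tilde\<close> acting through \<open>star (res2 y)\<close>.\<close>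

lemma intertwining_equivariant:
  fixes \<xi> :: "'k::{field,finite}^7^7 \<Rightarrow> 't" and \<Lambda> :: "'t \<Rightarrow> complex"
  assumes char: "(2::'k) \<noteq> 0" and \<xi>: "\<xi> \<in> Ind \<tau>" and y: "y \<in> P_tilde" and g: "g \<in> SO Q7"
  shows "(\<Sum>u\<in>U_tilde. \<Lambda> (\<xi> (w2 ** u ** (y ** g)))) =
    (\<Sum>u\<in>U_tilde. \<Lambda> (\<tau> (star (res2 y)) (\<xi> (w2 ** u ** g))))"
proof -
  let ?a = "res2 y"
  have a: "invertible ?a" by (rule P_tilde_levi(1)[OF y char])
  obtain b u0 where b: "b \<in> SO Q3" and u0: "u0 \<in> U_tilde" and y_eq: "y = levi ?a b ** u0"
    using P_tilde_levi(2)[OF y char] by blast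
  let ?D = "levi ?a b"
  let ?z = "w2 ** ?D ** matrix_inv w2"
  have D: "?D \<in> SO Q7" by (rule Q7_levi(1)[OF a b])
  have Di: "invertible ?D" by (rule invertible_SO[OF D])
  have wi: "invertible (w2 :: 'k^7^7)" by (rule invertible_G2[OF w2_G2])
  have wS: "(w2 :: 'k^7^7) \<in> SO Q7" using w2_G2 G2_subset_SO by blast
  have bij: "bij_betw (\<lambda>u. matrix_inv ?D ** u ** ?D ** u0) U_tilde U_tilde"
  proof (rule U_tilde_translate_bij[OF D _ _ u0])
    show "block_upper ?D" unfolding levi_eq by (rule block_upper_diag_blocks)
    show "block_upper (matrix_inv ?D)" unfolding Q7_levi(2)[OF a b] by (rule block_upper_diag_blocks)
  qed
  have "(\<Sum>u\<in>U_tilde. \<Lambda> (\<tau> (star ?a) (\<xi> (w2 ** u ** g)))) =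
      (\<Sum>u\<in>U_tilde. \<Lambda> (\<tau> (star ?a) (\<xi> (w2 ** (matrix_inv ?D ** u ** ?D ** u0) ** g))))"
    by (rule sum.reindex_bij_betw[OF bij, symmetric])
  also have "\<dots> = (\<Sum>u\<in>U_tilde. \<Lambda> (\<xi> (w2 ** u ** (y ** g))))"
  proof (rule sum.cong[OF refl])
    fix u :: "'k^7^7" assume u: "u \<in> U_tilde"
    have uS: "u \<in> SO Q7" "u0 \<in> SO Q7" using u u0 by (simp_all add: U_tilde_iff)
    let ?x = "w2 ** (matrix_inv ?D ** u ** ?D ** u0) ** g"
    have "?x \<in> SO Q7" using uS D wS g by simp
    from Ind_P_tilde[OF \<xi> w2_levi_conj(1)[OF a b] this char]
    have "\<tau> (star ?a) (\<xi> ?x) = \<xi> (?z ** ?x)" by (simp only: w2_levi_conj(2)[OF a b])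
    also have "?z ** ?x = w2 ** u ** (levi ?a b ** u0 ** g)"
      by (simp add: matrix_mul_assoc matrix_inv_cancel[OF wi] matrix_inv_cancel[OF Di])
    also have "levi ?a b ** u0 ** g = y ** g" by (simp only: y_eq[symmetric])
    finally show "\<Lambda> (\<tau> (star ?a) (\<xi> ?x)) = \<Lambda> (\<xi> (w2 ** u ** (y ** g)))" by simp
  qed
  finally show ?thesis by simp
qed

text \<open>\<open>x_b\<close> is kept apart because there the two factors of a summand transform by
  inverse characters that cancel, whereas under the other generators of \<open>U_H\<close> each
  factor is invariant by itself.\<close>

lemma U_H_invariantI:
  fixes F :: "'k::field^7^7 \<Rightarrow> complex"
  assumes b: "\<And>r g. g \<in> G2 \<Longrightarrow> F (x_b r ** g) = F g"
    and x: "\<And>x r g. x \<in> {x_2ab, x_3ab, x_3a2b} \<Longrightarrow> g \<in> G2 \<Longrightarrow> F (x r ** g) = F g"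
    and h: "h \<in> U_H" and g: "g \<in> G2"
  shows "F (h ** g) = F g"
  using h g
proof (induct arbitrary: g rule: U_H_induct)
  case (x_b r u)
  then show ?case using b[of "u ** g" r] subsetD[OF subgroups_subset_G2(2) x_b(1)] by (simp add: matrix_mul_assoc)
next
  case (other r u x)
  then show ?case using x[of x "u ** g" r] subsetD[OF subgroups_subset_G2(2) other(1)] by (simp add: matrix_mul_assoc)
qed simp

theorem theorem6p6:
  fixes \<psi> :: "'k::{field,finite} \<Rightarrow> complex"
    and sV :: "complex \<Rightarrow> 'v::ab_group_add \<Rightarrow> 'v"
    and \<rho> :: "'k^7^7 \<Rightarrow> 'v \<Rightarrow> 'v"
    and sT :: "complex \<Rightarrow> 't::ab_group_add \<Rightarrow> 't"
    and \<tau> :: "'k^2^2 \<Rightarrow> 't \<Rightarrow> 't"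
  assumes "odd CHAR('k)"
    and "nontrivial_additive_character \<psi>"
    and "irreducible_representation sV G2 \<rho>"
    and "generic_G2 sV \<psi> \<rho>"
    and "cuspidal_G2 \<rho>"
    and "irreducible_representation sT (carrier GL) \<tau>"
    and "generic_GL2 sT \<tau>"
  shows "\<exists>\<gamma>::complex.
    \<forall>l \<in> Hom_char sV U_max \<rho> (psi_U \<psi>) - {\<lambda>_. 0}.
    \<forall>\<Lambda> \<in> Hom_char sT N_GL2 \<tau> (\<lambda>n. inverse (\<psi> (n $ 1 $ 2))) - {\<lambda>_. 0}.
    \<forall>W \<in> Whittaker \<rho> l. \<forall>f \<in> Ind_Whittaker \<tau> \<Lambda>.
      Psi W (M_w2 f) = \<gamma> * Psi W f"
proof (cases "\<exists>l0 \<Lambda>0. l0 \<in> Hom_char sV U_max \<rho> (psi_U \<psi>) - {\<lambda>_. 0} \<and>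
    \<Lambda>0 \<in> Hom_char sT N_GL2 \<tau> (\<lambda>n. inverse (\<psi> (n $ 1 $ 2))) - {\<lambda>_. 0}")
  case False
  then show ?thesis by blast
next
  case True
  note \<psi> = assms(2)
  let ?HV = "Hom_char sV U_max \<rho> (psi_U \<psi>)"
  let ?HT = "Hom_char sT N_GL2 \<tau> (\<lambda>n. inverse (\<psi> (n $ 1 $ 2)))"
  \<comment> \<open>The number must be found before the functionals are given. It is computed from
    one pair; any other pair consists of multiples of it, and both sides scale alike.\<close>
  obtain l0 \<Lambda>0 where l0: "l0 \<in> ?HV" "l0 \<noteq> (\<lambda>_. 0)" and \<Lambda>0: "\<Lambda>0 \<in> ?HT" "\<Lambda>0 \<noteq> (\<lambda>_. 0)"
    using True by blast
  have repV: "representation sV G2 \<rho>" and repT: "representation sT (carrier GL) \<tau>"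
    using assms(3,6) by (simp_all add: irreducible_representation_def)
  have char: "(2::'k) \<noteq> 0"
  proof
    assume "(2::'k) = 0"
    then have "of_nat 2 = (0::'k)" by simp
    then have "CHAR('k) dvd 2" by (simp only: of_nat_eq_0_iff_char_dvd)
    then have "CHAR('k) = 1" using assms(1) by (metis dvd_refl prime_nat_iff two_is_prime_nat)
    then have "of_nat 1 = (0::'k)" by (simp only: of_nat_eq_0_iff_char_dvd) simp
    then show False by simp
  qed
  have \<rho>m: "\<rho> (g ** g') v = \<rho> g (\<rho> g' v)" if "g \<in> G2" "g' \<in> G2" for g g' v
    using repV that by (simp add: representation_def)
  have \<tau>m: "\<tau> (a ** a') t = \<tau> a (\<tau> a' t)" if "invertible a" "invertible a'" for a a' t
    using repT that by (simp add: representation_def carrier_GL)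
  have \<tau>1: "\<tau> (mat 1) t = t" for t using repT by (simp add: representation_def)
  have \<rho>l: "Vector_Spaces.linear sV sV (\<rho> g)" if "g \<in> G2" for g
    using repV that by (simp add: representation_def)
  have \<tau>l: "Vector_Spaces.linear sT sT (\<tau> a)" if "invertible a" for a
    using repT that by (simp add: representation_def carrier_GL)
  have gS: "g \<in> SO Q7" if "g \<in> G2" for g :: "'k^7^7" using that G2_subset_SO by blast
  have w2S: "(w2 :: 'k^7^7) \<in> SO Q7" by (rule gS[OF w2_G2])
  let ?d = "d1 :: 'k^2^2"
  have d: "invertible ?d" by (simp add: invertible_det_nz det_2 d1_def)
  \<comment> \<open>The left-hand side summed over all of \<open>G2\<close>, with
    \<open>M_w2\<close> unfolded at the identity of \<open>GL\<^sub>2\<close>, where only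
    \<open>d1\<close> remains to act.\<close>
  define B where "B v \<xi> = (\<Sum>g\<in>G2. \<Sum>u\<in>U_tilde. l0 (\<rho> g v) * \<Lambda>0 (\<tau> ?d (\<xi> (w2 ** u ** g))))" for v \<xi>
  have l0lin: "Vector_Spaces.linear sV (*) l0" and \<Lambda>0lin: "Vector_Spaces.linear sT (*) \<Lambda>0"
    using l0 \<Lambda>0 by (simp_all add: Hom_char_def)
  interpret invariant_form \<psi> sV \<rho> sT \<tau> B
  proof (rule invariant_form.intro)
    show "(2::'k) \<noteq> 0" "nontrivial_additive_character \<psi>" "representation sV G2 \<rho>" "cuspidal_G2 \<rho>"
      "representation sT (carrier GL) \<tau>" by (fact char \<psi> repV assms(5) repT)+
    show "Vector_Spaces.linear sV (*) (\<lambda>v. B v \<xi>)" for \<xi>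
    proof -
      have "l0 (\<rho> g (v + w)) = l0 (\<rho> g v) + l0 (\<rho> g w)" "l0 (\<rho> g (sV c v)) = c * l0 (\<rho> g v)"
        if "g \<in> G2" for g v w c
        using \<rho>l[OF that] l0lin by (simp_all add: Vector_Spaces.linear_iff)
      then show ?thesis using l0lin
        by (simp add: Vector_Spaces.linear_iff B_def sum.distrib sum_distrib_left distrib_right mult.assoc)
    qed
    have lin: "\<Lambda>0 (\<tau> ?d (t + t')) = \<Lambda>0 (\<tau> ?d t) + \<Lambda>0 (\<tau> ?d t')" "\<Lambda>0 (\<tau> ?d (sT c t)) = c * \<Lambda>0 (\<tau> ?d t)" for t t' c
      using \<tau>l[OF d] \<Lambda>0lin by (simp_all add: Vector_Spaces.linear_iff)
    show "B v (\<lambda>x. \<xi> x + \<xi>' x) = B v \<xi> + B v \<xi>'" for v \<xi> \<xi>'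
      by (simp add: B_def lin sum.distrib distrib_left)
    show "B v (\<lambda>x. sT c (\<xi> x)) = c * B v \<xi>" for v c \<xi>
      by (simp add: B_def lin sum_distrib_left mult.left_commute)
    show "B v \<xi> = B v \<xi>'" if "\<And>x. x \<in> SO Q7 \<Longrightarrow> \<xi> x = \<xi>' x" for v \<xi> \<xi>'
      unfolding B_def by (intro sum.cong refl) (simp add: that w2S gS U_tilde_iff)
    show "B (\<rho> h v) (\<lambda>x. \<xi> (x ** h)) = B v \<xi>" if h: "h \<in> G2" for h v \<xi>
    proof -
      let ?F = "\<lambda>g. \<Sum>u\<in>U_tilde. l0 (\<rho> g v) * \<Lambda>0 (\<tau> ?d (\<xi> (w2 ** u ** g)))"
      have "B (\<rho> h v) (\<lambda>x. \<xi> (x ** h)) = (\<Sum>g\<in>G2. ?F (g ** h))"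
        unfolding B_def by (intro sum.cong refl) (simp add: \<rho>m h matrix_mul_assoc)
      also have "\<dots> = B v \<xi>" unfolding B_def
        by (rule matrix_group_finite_sum_left(2)[OF matrix_group_G2 h])
      finally show ?thesis .
    qed
  qed
  obtain \<gamma> where \<gamma>: "\<And>v \<xi>. \<xi> \<in> Ind \<tau> \<Longrightarrow> B v \<xi> = \<gamma> * (\<Sum>g\<in>G2. l0 (\<rho> g v) * \<Lambda>0 (\<xi> g))"
    using uniqueness[OF Whittaker_functional_unique_G2[OF \<psi> assms(3) l0]
        Whittaker_functional_unique_GL2[OF \<psi> assms(6) \<Lambda>0] l0(2)] by blast
  have "Psi W (M_w2 f) = \<gamma> * Psi W f"
    if l: "l \<in> ?HV" and \<Lambda>: "\<Lambda> \<in> ?HT" and W: "W \<in> Whittaker \<rho> l" and f: "f \<in> Ind_Whittaker \<tau> \<Lambda>"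
    for l \<Lambda> W f
  proof -
    obtain v where W: "W = (\<lambda>g. l (\<rho> g v))" using W by (auto simp: Whittaker_def)
    obtain \<xi> where \<xi>: "\<xi> \<in> Ind \<tau>" and f: "f = (\<lambda>g a. \<Lambda> (\<tau> a (\<xi> g)))" using f by (auto simp: Ind_Whittaker_def)
    obtain x where x: "\<And>v. l v = x * l0 v" using Whittaker_functional_unique_G2[OF \<psi> assms(3) l0 l] by blast
    obtain y where y: "\<And>t. \<Lambda> t = y * \<Lambda>0 t" using Whittaker_functional_unique_GL2[OF \<psi> assms(6) \<Lambda>0 \<Lambda>] by blast
    have l_eq: "l (\<rho> u v) = psi_U \<psi> u * l v" if "u \<in> U_max" for u v using l that by (simp add: Hom_char_def)
    have \<Lambda>_n2: "\<Lambda> (\<tau> (n2 r) t) = inverse (\<psi> r) * \<Lambda> t" for r t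
      using \<Lambda> by (simp add: Hom_char_def N_GL2_def)
    have \<psi>0: "\<psi> r * inverse (\<psi> r) = 1" for r
    proof -
      have "\<psi> r * \<psi> (- r) = 1" using \<psi>_add[of r "- r"] \<psi>_zero by simp
      then show ?thesis by (metis mult_zero_left right_inverse zero_neq_one)
    qed
    let ?F1 = "\<lambda>g. W g * f g (mat 1)" and ?F2 = "\<lambda>g. W g * M_w2 f g (mat 1)"
    have F1: "?F1 (h ** g) = ?F1 g" if "h \<in> U_H" "g \<in> G2" for h g
    proof (rule U_H_invariantI[OF _ _ that])
      fix r and g :: "'k^7^7" assume g: "g \<in> G2"
      show "?F1 (x_b r ** g) = ?F1 g"
        using g \<psi>0[of r]
        by (simp add: W f \<tau>1 \<rho>m l_eq psi_U_x[OF \<psi>] Ind_P_tilde[OF \<xi> x_b_P_tilde(1) gS[OF g] char]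
            x_b_P_tilde(2) \<Lambda>_n2 mult.commute[of "inverse (\<psi> r)"])
      fix x assume x: "x \<in> {x_2ab, x_3ab, x_3a2b :: 'k \<Rightarrow> 'k^7^7}"
      then have "x r \<in> U_max" "x r \<in> G2" "psi_U \<psi> (x r) = 1" by (auto simp: psi_U_x[OF \<psi>])
      then show "?F1 (x r ** g) = ?F1 g"
        using g by (simp add: W f \<tau>1 \<rho>m l_eq Ind_P_tilde[OF \<xi> x_H_P_tilde(1)[OF x] gS[OF g] char]
            x_H_P_tilde(2)[OF x])
    qed
    have M: "M_w2 f g (mat 1) = (\<Sum>u\<in>U_tilde. \<Lambda> (\<tau> ?d (\<xi> (w2 ** u ** g))))" for g
      by (simp add: M_w2_def f star_one)
    have M_y: "M_w2 f (y ** g) (mat 1) = (\<Sum>u\<in>U_tilde. \<Lambda> (\<tau> ?d (\<tau> (star (res2 y)) (\<xi> (w2 ** u ** g)))))"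
      if "y \<in> P_tilde" "g \<in> G2" for y g
      unfolding M by (rule intertwining_equivariant[OF char \<xi> that(1) gS[OF that(2)], of "\<lambda>t. \<Lambda> (\<tau> ?d t)"])
    have F2: "?F2 (h ** g) = ?F2 g" if "h \<in> U_H" "g \<in> G2" for h g
    proof (rule U_H_invariantI[OF _ _ that])
      fix r and g :: "'k^7^7" assume g: "g \<in> G2"
      \<comment> \<open>\<open>star\<close> inverts the elements of \<open>N_GL2\<close>, and
        conjugation by \<open>d1\<close> undoes this. So \<open>M_w2 f\<close> transforms under
        \<open>x_b\<close> by the same character as f.\<close>
      have "?d ** n2 (- r) = n2 r ** ?d"
        by (simp add: vec_eq_iff forall_2 matrix_matrix_mult_def sum_2 d1_def)
      then have "\<tau> ?d (\<tau> (n2 (- r)) t) = \<tau> (n2 r) (\<tau> ?d t)" for t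
        using \<tau>m[OF d n2_inv(1), of "- r" t] \<tau>m[OF n2_inv(1) d, of r t] by simp
      then have "M_w2 f (x_b r ** g) (mat 1) = inverse (\<psi> r) * M_w2 f g (mat 1)"
        unfolding M_y[OF x_b_P_tilde(1) g] x_b_P_tilde(2) star_n2
        by (simp add: \<Lambda>_n2 M sum_distrib_left)
      then show "?F2 (x_b r ** g) = ?F2 g"
        using g \<psi>0[of r]
        by (simp add: W \<rho>m l_eq psi_U_x[OF \<psi>] mult.commute[of "inverse (\<psi> r)"])
      fix x assume x: "x \<in> {x_2ab, x_3ab, x_3a2b :: 'k \<Rightarrow> 'k^7^7}"
      then have "x r \<in> U_max" "x r \<in> G2" "psi_U \<psi> (x r) = 1" by (auto simp: psi_U_x[OF \<psi>])
      moreover have "M_w2 f (x r ** g) (mat 1) = M_w2 f g (mat 1)"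
        unfolding M_y[OF x_H_P_tilde(1)[OF x] g] x_H_P_tilde(2)[OF x] star_one by (simp add: \<tau>1 M)
      ultimately show "?F2 (x r ** g) = ?F2 g"
        using g by (simp add: W \<rho>m l_eq)
    qed
    let ?n = "of_nat (card (U_H :: ('k^7^7) set)) :: complex"
    note coset = coset_sum_eq[OF matrix_group_U_H subgroups_subset_G2(2) matrix_group_G2]
    have "?n * Psi W (M_w2 f) = (\<Sum>g\<in>G2. ?F2 g)" unfolding Psi_def by (rule coset[OF F2])
    also have "\<dots> = x * y * B v \<xi>"
      by (simp add: W M B_def x y sum_distrib_left mult_ac)
    also have "\<dots> = \<gamma> * (\<Sum>g\<in>G2. ?F1 g)"
      unfolding \<gamma>[OF \<xi>] by (simp add: W f \<tau>1 x y sum_distrib_left mult_ac)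
    also have "(\<Sum>g\<in>G2. ?F1 g) = ?n * Psi W f" unfolding Psi_def by (rule coset[OF F1, symmetric])
    finally have "?n * Psi W (M_w2 f) = ?n * (\<gamma> * Psi W f)" by (simp only: mult.left_commute)
    moreover have "?n \<noteq> 0"
    proof -
      have "finite (U_H :: ('k^7^7) set)" by (rule finite)
      moreover have "(U_H :: ('k^7^7) set) \<noteq> {}" using matrix_groupD(1)[OF matrix_group_U_H] by blast
      ultimately show ?thesis by simp
    qed
    ultimately show ?thesis by simp
  qed
  then show ?thesis by blast
qed

end
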